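(* Let $G$ be a group and let $L,N$ be normal subgroups of $G$ with $L\geqslant N$. Assume that there exists an integer $q\geq 2$ such that either (a$_q$) $N=\gamma_q(G)$ and $L=\gamma_{q-1}(G)$; or (b$_q$) $N\geqslant\gamma_q(G)$, $L=\gamma_{q-1}(G)N$, and $G$ admits a presentation $(F\mid R)$ with $R\leqslant\gamma_q(F)$. Then $$\dim_{\mathbb{R}}\mathcal{W}(G,L,N)=\sup\{\ell\in\mathbb{Z}_{\ge0}: \text{there is a coarsely proper } d_{\mathrm{scl}_{G,L}}\text{-bounded coarse homomorphism }(\mathbb{Z}^\ell,\|\cdot\|_1)\to([G,N],d_{\mathrm{scl}_{G,N}})\}$$ $$=\inf\{\ell\in\mathbb{Z}_{\ge0}: \text{for every } d_{\mathrm{scl}_{G,L}}\text{-bounded } A\subseteq[G,N] \text{ there is a coarsely proper coarse homomorphism }(A,d_{\mathrm{scl}_{G,N}})\to(\mathbb{Z}^\ell,\|\cdot\|_1)\},$$ and $$\dim_{\mathbb{R}}\mathcal{W}(G,L,N)\le\sup\{\ell\in\mathbb{Z}_{\ge0}: \text{there is a coarsely proper } d_{\mathrm{cl}_{G,L}}\text{-bounded coarse homomorphism }(\mathbb{Z}^\ell,\|\cdot\|_1)\to([G,N],d_{\mathrm{cl}_{G,N}})\}.$$ In particular, $\dim_{\mathbb{R}}\mathcal{W}(G,L,N)=\sup\{\operatorname{asdim}(A,d_{\mathrm{scl}_{G,N}}): A\subseteq[G,N] \text{ is } d_{\mathrm{scl}_{G,L}}\text{-bounded}\}$ and $\dim_{\mathbb{R}}\mathcal{W}(G,L,N)\le\sup\{\operatorname{asdim}(A,d_{\mathrm{cl}_{G,N}}):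 A\subseteq[G,N] \text{ is } d_{\mathrm{cl}_{G,L}}\text{-bounded}\}$.
   Context: $[g,h]=ghg^{-1}h^{-1}$; $\gamma_1(G)=G$, $\gamma_{k+1}(G)=[G,\gamma_k(G)]$; a presentation $(F\mid R)$ of $G$ means $F$ free, $R\trianglelefteq F$, $G\cong F/R$. For a normal subgroup $N$ of $G$, $[G,N]$ is generated by $[g,x]$ ($g\in G,x\in N$); $\mathrm{cl}_{G,N}$ is word length on $[G,N]$ with respect to these simple commutators; $\mathrm{scl}_{G,N}(y)=\lim_n\mathrm{cl}_{G,N}(y^n)/n$. On $[G,N]$, $d_{\mathrm{cl}_{G,N}}(y_1,y_2)=\mathrm{cl}_{G,N}(y_1^{-1}y_2)$ and $d_{\mathrm{scl}_{G,N}}(y_1,y_2)=\mathrm{scl}_{G,N}(y_1^{-1}y_2)$; the same formulas with $L$ in place of $N$ define $d_{\mathrm{cl}_{G,L}}, d_{\mathrm{scl}_{G,L}}$ on $[G,N]\subseteq[G,L]$. $\mathrm{Q}(N)^G$: homogeneous ($\psi(h^n)=n\psi(h)$) quasimorphisms on $N$ (finite defect $\mathscr D(\psi)=\sup|\psi(h_1h_2)-\psi(h_1)-\psi(h_2)|$) invariant under conjugation by $G$; $\mathrm{H}^1(N)^G$: $G$-invariant homomorphisms $N\to\mathbb{R}$; $\mathcal{W}(G,L,N)=\mathrm{Q}(N)^G/(\mathrm{H}^1(N)^G+i^*\mathrm{Q}(L)^G)$ with $i^*$ restriction from $L$ to $N$; dimension $\infty$ if infinite dimensional. Coarse notions for sets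 with functions $d_X,d_Y$ to $[0,\infty)$: controlled map (for each $S$ a $T$ with $d_X\le S\Rightarrow d_Y\le T$); coarsely proper map (for each $S$ a $T$ with $d_X>T\Rightarrow d_Y>S$); a map is $d_Y$-bounded if its image has finite $d_Y$-diameter. A pre-coarse homomorphism between groups is a map $\alpha$ with $\sup d(\alpha(gg'),\alpha(g)\alpha(g'))<\infty$; a coarse homomorphism is a controlled pre-coarse homomorphism. For a subset $A\subseteq[G,N]$, a coarse homomorphism $(A,d_{\mathrm{scl}_{G,N}})\to(\mathbb{Z}^\ell,\|\cdot\|_1)$ is understood as the restriction to $A$ of a pre-coarse homomorphism $[G,N]\to\mathbb{Z}^\ell$ whose restriction to $(A,d_{\mathrm{scl}_{G,N}})$ is controlled. $\operatorname{asdim}$ is the asymptotic dimension: $\operatorname{asdim}(X,d)\le n$ iff for every $r>0$ there are families $\mathcal U^0,\dots,\mathcal U^n$ of subsets of uniformly bounded $d$-diameter, each family $r$-disjoint (distinct members at $d$-distance $>r$), whose union covers $X$. *)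

theory Defs
  imports "HOL-Algebra.Algebra" "HOL-Library.Extended_Nat" Complex_Main
begin

definition commutator :: "('a,'b) monoid_scheme \<Rightarrow> 'a \<Rightarrow> 'a \<Rightarrow> 'a" where
  "commutator G g h = g \<otimes>\<^bsub>G\<^esub> h \<otimes>\<^bsub>G\<^esub> inv\<^bsub>G\<^esub> g \<otimes>\<^bsub>G\<^esub> inv\<^bsub>G\<^esub> h"

definition simple_comms :: "('a,'b) monoid_scheme \<Rightarrow> 'a set \<Rightarrow> 'a set" where
  "simple_comms G N = {commutator G g x | g x. g \<in> carrier G \<and> x \<in> N}"

definition comm_sub :: "('a,'b) monoid_scheme \<Rightarrow> 'a set \<Rightarrow> 'a set" where
  "comm_sub G N = generate G (simple_comms G N)"

text \<open>Lower central series, indexed from 1: gamma G 1 = G, gamma G (k+1) = [G, gamma G k].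
  (gamma G 0 is set to G by convention; it is never used.)\<close>
fun lcs :: "('a,'b) monoid_scheme \<Rightarrow> nat \<Rightarrow> 'a set" where
  "lcs G 0 = carrier G"
| "lcs G (Suc 0) = carrier G"
| "lcs G (Suc (Suc k)) = comm_sub G (lcs G (Suc k))"

fun eval_word :: "('a,'b) monoid_scheme \<Rightarrow> (bool \<times> 'a) list \<Rightarrow> 'a" where
  "eval_word G [] = \<one>\<^bsub>G\<^esub>"
| "eval_word G ((b, x) # w) =
     (if b then x else inv\<^bsub>G\<^esub> x) \<otimes>\<^bsub>G\<^esub> eval_word G w"

fun reduced_word :: "(bool \<times> 'a) list \<Rightarrow> bool" where
  "reduced_word [] = True"
| "reduced_word [_] = True"
| "reduced_word ((b, x) # (c, y) # w) =
     (\<not> (x = y \<and> b \<noteq> c) \<and> reduced_word ((c, y) # w))"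

definition free_basis :: "('a,'b) monoid_scheme \<Rightarrow> 'a set \<Rightarrow> bool" where
  "free_basis Fr B \<longleftrightarrow> B \<subseteq> carrier Fr \<and> generate Fr B = carrier Fr \<and>
     (\<forall>w. w \<noteq> [] \<and> reduced_word w \<and> snd ` set w \<subseteq> B \<longrightarrow> eval_word Fr w \<noteq> \<one>\<^bsub>Fr\<^esub>)"

definition free_group :: "('a,'b) monoid_scheme \<Rightarrow> bool" where
  "free_group F \<longleftrightarrow> group F \<and> (\<exists>B. free_basis F B)"

definition presentation ::
  "('f,'c) monoid_scheme \<Rightarrow> 'f set \<Rightarrow> ('a,'b) monoid_scheme \<Rightarrow> bool" where
  "presentation F R G \<longleftrightarrow> free_group F \<and> R \<lhd> F \<and> (F Mod R) \<cong> G"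

definition cl :: "('a,'b) monoid_scheme \<Rightarrow> 'a set \<Rightarrow> 'a \<Rightarrow> nat" where
  "cl G N y = (LEAST k. \<exists>ws. length ws = k \<and>
      set ws \<subseteq> simple_comms G N \<union> (\<lambda>c. inv\<^bsub>G\<^esub> c) ` simple_comms G N \<and>
      foldr (\<lambda>a b. a \<otimes>\<^bsub>G\<^esub> b) ws \<one>\<^bsub>G\<^esub> = y)"

definition scl :: "('a,'b) monoid_scheme \<Rightarrow> 'a set \<Rightarrow> 'a \<Rightarrow> real" where
  "scl G N y = lim (\<lambda>n::nat. real (cl G N (y [^]\<^bsub>G\<^esub> n)) / real n)"

definition d_cl :: "('a,'b) monoid_scheme \<Rightarrow> 'a set \<Rightarrow> 'a \<Rightarrow> 'a \<Rightarrow> real" where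
  "d_cl G N y1 y2 = real (cl G N (inv\<^bsub>G\<^esub> y1 \<otimes>\<^bsub>G\<^esub> y2))"

definition d_scl :: "('a,'b) monoid_scheme \<Rightarrow> 'a set \<Rightarrow> 'a \<Rightarrow> 'a \<Rightarrow> real" where
  "d_scl G N y1 y2 = scl G N (inv\<^bsub>G\<^esub> y1 \<otimes>\<^bsub>G\<^esub> y2)"

text \<open>Real functions on N are represented by functions vanishing outside N.\<close>
definition inv_hqm :: "('a,'b) monoid_scheme \<Rightarrow> 'a set \<Rightarrow> ('a \<Rightarrow> real) set" where
  "inv_hqm G N = {\<psi>. (\<forall>x. x \<notin> N \<longrightarrow> \<psi> x = 0)
      \<and> (\<exists>D. \<forall>h1\<in>N. \<forall>h2\<in>N. \<bar>\<psi> (h1 \<otimes>\<^bsub>G\<^esub> h2) - \<psi> h1 - \<psi> h2\<bar> \<le> D)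
      \<and> (\<forall>h\<in>N. \<forall>n::int. \<psi> (h [^]\<^bsub>G\<^esub> n) = of_int n * \<psi> h)
      \<and> (\<forall>g\<in>carrier G. \<forall>h\<in>N. \<psi> (g \<otimes>\<^bsub>G\<^esub> h \<otimes>\<^bsub>G\<^esub> inv\<^bsub>G\<^esub> g) = \<psi> h)}"

definition inv_hom :: "('a,'b) monoid_scheme \<Rightarrow> 'a set \<Rightarrow> ('a \<Rightarrow> real) set" where
  "inv_hom G N = {\<psi>. (\<forall>x. x \<notin> N \<longrightarrow> \<psi> x = 0)
      \<and> (\<forall>h1\<in>N. \<forall>h2\<in>N. \<psi> (h1 \<otimes>\<^bsub>G\<^esub> h2) = \<psi> h1 + \<psi> h2)
      \<and> (\<forall>g\<in>carrier G. \<forall>h\<in>N. \<psi> (g \<otimes>\<^bsub>G\<^esub> h \<otimes>\<^bsub>G\<^esub> inv\<^bsub>G\<^esub> g) = \<psi> h)}"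

definition restr_to :: "'a set \<Rightarrow> ('a \<Rightarrow> real) \<Rightarrow> ('a \<Rightarrow> real)" where
  "restr_to N \<phi> = (\<lambda>x. if x \<in> N then \<phi> x else 0)"

definition quot_dim :: "('x \<Rightarrow> real) set \<Rightarrow> ('x \<Rightarrow> real) set \<Rightarrow> enat" where
  "quot_dim Q V = Sup {enat (card S) | S. finite S \<and> S \<subseteq> Q \<and>
      (\<forall>c. (\<lambda>x. \<Sum>s\<in>S. c s * s x) \<in> V \<longrightarrow> (\<forall>s\<in>S. c s = 0))}"

definition dimW :: "('a,'b) monoid_scheme \<Rightarrow> 'a set \<Rightarrow> 'a set \<Rightarrow> enat" where
  "dimW G L N = quot_dim (inv_hqm G N)
     {(\<lambda>x. h x + k x) | h k. h \<in> inv_hom G N \<and> k \<in> restr_to N ` inv_hqm G L}"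

definition Zvec :: "nat \<Rightarrow> (nat \<Rightarrow> int) set" where
  "Zvec l = {v. \<forall>i\<ge>l. v i = 0}"

definition norm1 :: "nat \<Rightarrow> (nat \<Rightarrow> int) \<Rightarrow> real" where
  "norm1 l v = real_of_int (\<Sum>i<l. \<bar>v i\<bar>)"

definition d1 :: "nat \<Rightarrow> (nat \<Rightarrow> int) \<Rightarrow> (nat \<Rightarrow> int) \<Rightarrow> real" where
  "d1 l v w = norm1 l (\<lambda>i. w i - v i)"

definition controlled_on :: "'x set \<Rightarrow> ('x \<Rightarrow> 'x \<Rightarrow> real) \<Rightarrow> ('y \<Rightarrow> 'y \<Rightarrow> real) \<Rightarrow> ('x \<Rightarrow> 'y) \<Rightarrow> bool" where
  "controlled_on Xs dX dY f \<longleftrightarrow>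
     (\<forall>S. \<exists>T. \<forall>x\<in>Xs. \<forall>y\<in>Xs. dX x y \<le> S \<longrightarrow> dY (f x) (f y) \<le> T)"

definition coarsely_proper_on :: "'x set \<Rightarrow> ('x \<Rightarrow> 'x \<Rightarrow> real) \<Rightarrow> ('y \<Rightarrow> 'y \<Rightarrow> real) \<Rightarrow> ('x \<Rightarrow> 'y) \<Rightarrow> bool" where
  "coarsely_proper_on Xs dX dY f \<longleftrightarrow>
     (\<forall>S. \<exists>T. \<forall>x\<in>Xs. \<forall>y\<in>Xs. dX x y > T \<longrightarrow> dY (f x) (f y) > S)"

definition d_bounded :: "('y \<Rightarrow> 'y \<Rightarrow> real) \<Rightarrow> 'y set \<Rightarrow> bool" where
  "d_bounded d A \<longleftrightarrow> (\<exists>B. \<forall>x\<in>A. \<forall>y\<in>A. d x y \<le> B)"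

text \<open>Coarsely proper, d'-bounded coarse homomorphism (Z^l, l1) \<rightarrow> ([G,N], d),
  where d (resp. d') is the target distance d_(s)cl_{G,N} (resp. d_(s)cl_{G,L}).\<close>
definition coarse_hom_from_Z ::
  "('a,'b) monoid_scheme \<Rightarrow> 'a set \<Rightarrow> ('a \<Rightarrow> 'a \<Rightarrow> real) \<Rightarrow> ('a \<Rightarrow> 'a \<Rightarrow> real)
     \<Rightarrow> nat \<Rightarrow> ((nat \<Rightarrow> int) \<Rightarrow> 'a) \<Rightarrow> bool" where
  "coarse_hom_from_Z G T d d' l \<alpha> \<longleftrightarrow>
     \<alpha> ` Zvec l \<subseteq> T
     \<and> (\<exists>D. \<forall>v\<in>Zvec l. \<forall>w\<in>Zvec l. d (\<alpha> (\<lambda>i. v i + w i)) (\<alpha> v \<otimes>\<^bsub>G\<^esub> \<alpha> w) \<le> D)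
     \<and> controlled_on (Zvec l) (d1 l) d \<alpha>
     \<and> coarsely_proper_on (Zvec l) (d1 l) d \<alpha>
     \<and> d_bounded d' (\<alpha> ` Zvec l)"

text \<open>Coarsely proper coarse homomorphism (A, d) \<rightarrow> (Z^l, l1): the restriction to A of a
  pre-coarse homomorphism T = [G,N] \<rightarrow> Z^l which is controlled and coarsely proper on A.\<close>
definition coarse_hom_to_Z ::
  "('a,'b) monoid_scheme \<Rightarrow> 'a set \<Rightarrow> ('a \<Rightarrow> 'a \<Rightarrow> real) \<Rightarrow> 'a set
     \<Rightarrow> nat \<Rightarrow> ('a \<Rightarrow> (nat \<Rightarrow> int)) \<Rightarrow> bool" where
  "coarse_hom_to_Z G T d A l \<beta> \<longleftrightarrow>
     \<beta> ` T \<subseteq> Zvec l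
     \<and> (\<exists>D. \<forall>g\<in>T. \<forall>h\<in>T. d1 l (\<beta> (g \<otimes>\<^bsub>G\<^esub> h)) (\<lambda>i. \<beta> g i + \<beta> h i) \<le> D)
     \<and> controlled_on A d (d1 l) \<beta>
     \<and> coarsely_proper_on A d (d1 l) \<beta>"

definition asdim_le :: "'x set \<Rightarrow> ('x \<Rightarrow> 'x \<Rightarrow> real) \<Rightarrow> nat \<Rightarrow> bool" where
  "asdim_le Xs d n \<longleftrightarrow> (\<forall>r>0. \<exists>\<U> :: nat \<Rightarrow> 'x set set.
      (\<forall>i\<le>n. \<forall>U\<in>\<U> i. U \<subseteq> Xs)
      \<and> (\<exists>B. \<forall>i\<le>n. \<forall>U\<in>\<U> i. \<forall>x\<in>U. \<forall>y\<in>U. d x y \<le> B)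
      \<and> (\<forall>i\<le>n. \<forall>U\<in>\<U> i. \<forall>U'\<in>\<U> i. U \<noteq> U' \<longrightarrow> (\<forall>x\<in>U. \<forall>y\<in>U'. r < d x y))
      \<and> Xs \<subseteq> (\<Union>i\<le>n. \<Union>(\<U> i)))"

definition asdim :: "'x set \<Rightarrow> ('x \<Rightarrow> 'x \<Rightarrow> real) \<Rightarrow> enat" where
  "asdim Xs d = Inf {enat n | n. asdim_le Xs d n}"

end

theory Submission
  imports Defs "HOL-Analysis.Brouwer_Fixpoint"
begin

text \<open>The hypotheses give \<open>[G, L] \<le> N\<close>. For an invariant homogeneous
  quasimorphism \<open>\<phi>\<close> on \<open>N\<close> the function \<open>(g, l) \<mapsto> \<phi> [g, l]\<close> stays at bounded distance from a pairing
  that is homogeneous in \<open>g\<close>, and \<open>\<phi>\<close> is trivial in \<open>W(G, L, N)\<close> iff this pairing vanishes on all families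
  \<open>(g\<^sub>i, l\<^sub>i)\<close> with \<open>\<Prod> [g\<^sub>i, l\<^sub>i] \<in> [G, N]\<close>: by a Hahn-Banach argument \<open>\<phi>\<close> can first be corrected
  by a homomorphism so that it is bounded on simple \<open>(G, L)\<close>-commutators, and then be extended to \<open>L\<close>.
  Linearly independent classes therefore come with dual families, and
  \<open>m \<mapsto> \<Prod> [g\<^sub>i\<^sup>m, l\<^sub>i]\<close> has bounded \<open>(G, L)\<close>-commutator length while the quasimorphisms see \<open>m\<close>; this embeds
  \<open>\<int>\<^sup>l\<close>. Conversely all decompositions are quantitative in the defect, so Bavard's duality
  shows that finitely many quasimorphisms detect \<open>scl\<^bsub>G,N\<^esub>\<close> on \<open>scl\<^bsub>G,L\<^esub>\<close>-bounded sets. Everything else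
  follows from \<open>asdim \<int>\<^sup>l = l\<close>.\<close>

section \<open>Products of simple commutators\<close>

text \<open>Hahn-Banach needs an abelian setting, so the functionals live on the free abelian group
  on the elements of the subgroup. Radius is measured there by \<open>comm_words\<close>, which
  charges letters and commutators alike; the relators xy - x - y and gxg^-1 - x have radius at most
  3, so a functional of norm c restricts to a nearly invariant quasimorphism, and homogenizing it
  yields defect at most 12c. What has to be checked each time is domination: nothing cheap in the
  abelian group may take a large prescribed value. The obstacle is the cost of returning from the
  abelian group to the group by reordering letters. It is overcome by letting letters carry integer
  exponents: passing from a word to its m-th multiple keeps the number of letters, so this part of
  the cost does not grow with m and vanishes after division by m. The second concern is uniformity:
  the quasimorphism that detects the \<open>scl\<close> of an element depends on that element, so
  the final estimate may use only its defect 12, and every constant derived from it must be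
  independent of the element.\<close>

definition comm_prods :: "('a,'b) monoid_scheme \<Rightarrow> 'a set \<Rightarrow> nat \<Rightarrow> 'a set" where
  "comm_prods G N k = {foldr (\<lambda>a b. a \<otimes>\<^bsub>G\<^esub> b) ws \<one>\<^bsub>G\<^esub> | ws. length ws = k \<and> set ws \<subseteq> simple_comms G N}"

text \<open>An explicit count instead of a bound on \<open>d_cl\<close>: the elements compared need
  not lie in [G,N], and errors simply add up along chains and products.\<close>

definition near :: "('a,'b) monoid_scheme \<Rightarrow> 'a set \<Rightarrow> nat \<Rightarrow> 'a \<Rightarrow> 'a \<Rightarrow> bool" where
  "near G N k y z \<longleftrightarrow> inv\<^bsub>G\<^esub> y \<otimes>\<^bsub>G\<^esub> z \<in> comm_prods G N k"

lemma (in group) inv_cancel [simp]: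
  assumes "x \<in> carrier G" "y \<in> carrier G"
  shows "x \<otimes> (inv x \<otimes> y) = y" "inv x \<otimes> (x \<otimes> y) = y"
  using assms by (simp_all flip: m_assoc)

lemma (in monoid) foldr_mult_closed:
  assumes "set ws \<subseteq> carrier G"
  shows "foldr (\<otimes>) ws \<one> \<in> carrier G"
  using assms by (induction ws) auto

lemma (in monoid) foldr_mult_append:
  assumes "set us \<subseteq> carrier G" "set ws \<subseteq> carrier G"
  shows "foldr (\<otimes>) (us @ ws) \<one> = foldr (\<otimes>) us \<one> \<otimes> foldr (\<otimes>) ws \<one>"
  using assms by (induction us) (auto simp: m_assoc foldr_mult_closed)

context normal
begin

lemma mem_carrier' [simp]: "x \<in> H \<Longrightarrow> x \<in> carrier G"
  using subset by blast

lemma conj_mem [simp]: "g \<in> carrier G \<Longrightarrow> x \<in> H \<Longrightarrow> g \<otimes> x \<otimes> inv g \<in> H"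
  by (rule inv_op_closed2)

lemma conj_mem' [simp]: "g \<in> carrier G \<Longrightarrow> x \<in> H \<Longrightarrow> g \<otimes> (x \<otimes> inv g) \<in> H"
  using inv_op_closed2[of g x] by (simp add: m_assoc)

lemma commutator_mem: "g \<in> carrier G \<Longrightarrow> x \<in> H \<Longrightarrow> commutator G g x \<in> H"
  unfolding commutator_def by (simp add: m_closed)

lemma simple_comms_subset: "simple_comms G H \<subseteq> H"
  unfolding simple_comms_def using commutator_mem by auto

lemma simple_commsI: "g \<in> carrier G \<Longrightarrow> x \<in> H \<Longrightarrow> commutator G g x \<in> simple_comms G H"
  unfolding simple_comms_def by auto

lemma simple_comms_carrier: "simple_comms G H \<subseteq> carrier G"
  using simple_comms_subset subset by blast

lemma one_simple_comms: "\<one> \<in> simple_comms G H"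
  using simple_commsI[of \<one> \<one>] by (simp add: commutator_def)

lemma simple_comms_inv:
  assumes "c \<in> simple_comms G H"
  shows "inv c \<in> simple_comms G H"
proof -
  obtain g x where gx: "g \<in> carrier G" "x \<in> H" "c = commutator G g x"
    using assms unfolding simple_comms_def by auto
  have "inv c = commutator G (inv g) (g \<otimes> x \<otimes> inv g)"
    using gx unfolding commutator_def by (simp add: m_assoc inv_mult_group)
  then show ?thesis using gx by (simp add: simple_commsI)
qed

lemma simple_comms_conj:
  assumes "c \<in> simple_comms G H" "t \<in> carrier G"
  shows "t \<otimes> c \<otimes> inv t \<in> simple_comms G H"
proof -
  obtain g x where gx: "g \<in> carrier G" "x \<in> H" "c = commutator G g x"
    using assms unfolding simple_comms_def by auto
  have "t \<otimes> c \<otimes> inv t = commutator G (t \<otimes> g \<otimes> inv t) (t \<otimes> x \<otimes> inv t)"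
    using gx assms(2) unfolding commutator_def by (simp add: m_assoc inv_mult_group)
  then show ?thesis using gx assms(2) by (simp add: simple_commsI)
qed

lemma comm_prods_0: "comm_prods G H 0 = {\<one>}"
  unfolding comm_prods_def by auto

lemma comm_prods_1: "c \<in> simple_comms G H \<Longrightarrow> c \<in> comm_prods G H 1"
  unfolding comm_prods_def using simple_comms_carrier
  by (auto intro!: exI[of _ "[c]"])

lemma comm_prods_subset: "comm_prods G H k \<subseteq> H"
proof -
  have "foldr (\<otimes>) ws \<one> \<in> H" if "set ws \<subseteq> simple_comms G H" for ws
    using that simple_comms_subset by (induction ws) (auto simp: m_closed)
  then show ?thesis unfolding comm_prods_def by auto
qed

lemma comm_prods_carrier [simp]: "y \<in> comm_prods G H k \<Longrightarrow> y \<in> carrier G"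
  using comm_prods_subset subset by blast

lemma comm_prods_add:
  assumes "y \<in> comm_prods G H i" "z \<in> comm_prods G H j"
  shows "y \<otimes> z \<in> comm_prods G H (i + j)"
proof -
  obtain us ws where "length us = i" "set us \<subseteq> simple_comms G H" "y = foldr (\<otimes>) us \<one>"
    "length ws = j" "set ws \<subseteq> simple_comms G H" "z = foldr (\<otimes>) ws \<one>"
    using assms unfolding comm_prods_def by auto
  then show ?thesis unfolding comm_prods_def
    using foldr_mult_append[of us ws] simple_comms_carrier
    by (auto intro!: exI[of _ "us @ ws"])
qed

text \<open>\<open>[1, 1] = 1\<close> is itself a simple commutator, so padding makes the sets of
  products with exactly \<open>k\<close> factors increase with \<open>k\<close>.\<close>

lemma one_comm_prods: "\<one> \<in> comm_prods G H k"
proof (induction k)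
  case (Suc k)
  then show ?case
    using comm_prods_add[OF comm_prods_1[OF one_simple_comms] Suc] by simp
qed (simp add: comm_prods_0)

lemma comm_prods_mono: "i \<le> j \<Longrightarrow> y \<in> comm_prods G H i \<Longrightarrow> y \<in> comm_prods G H j"
  using comm_prods_add[OF _ one_comm_prods, of y i "j - i"] by simp

lemma comm_prods_Suc:
  assumes "y \<in> comm_prods G H (Suc k)"
  obtains c z where "c \<in> simple_comms G H" "z \<in> comm_prods G H k" "y = c \<otimes> z"
proof -
  obtain ws where ws: "length ws = Suc k" "set ws \<subseteq> simple_comms G H" "y = foldr (\<otimes>) ws \<one>"
    using assms unfolding comm_prods_def by auto
  then obtain c us where cu: "ws = c # us" by (cases ws) auto
  have "foldr (\<otimes>) us \<one> \<in> comm_prods G H k"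
    using ws cu unfolding comm_prods_def by auto
  then show thesis using that[of c] ws cu by auto
qed

lemma comm_prods_conj:
  assumes "y \<in> comm_prods G H k" "t \<in> carrier G"
  shows "t \<otimes> y \<otimes> inv t \<in> comm_prods G H k"
  using assms(1)
proof (induction k arbitrary: y)
  case (Suc k)
  obtain c z where cz: "c \<in> simple_comms G H" "z \<in> comm_prods G H k" "y = c \<otimes> z"
    using comm_prods_Suc[OF Suc.prems] by blast
  have "t \<otimes> y \<otimes> inv t = (t \<otimes> c \<otimes> inv t) \<otimes> (t \<otimes> z \<otimes> inv t)"
    using cz assms(2) simple_comms_carrier by (simp add: m_assoc subset_iff)
  then show ?case
    using comm_prods_add[OF comm_prods_1[OF simple_comms_conj[OF cz(1) assms(2)]] Suc.IH[OF cz(2)]]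
    by simp
qed (use assms(2) in \<open>simp add: comm_prods_0\<close>)

lemma comm_prods_inv:
  assumes "y \<in> comm_prods G H k"
  shows "inv y \<in> comm_prods G H k"
  using assms
proof (induction k arbitrary: y)
  case (Suc k)
  obtain c z where cz: "c \<in> simple_comms G H" "z \<in> comm_prods G H k" "y = c \<otimes> z"
    using comm_prods_Suc[OF Suc.prems] by blast
  have "inv y = inv z \<otimes> inv c"
    using cz simple_comms_carrier by (simp add: inv_mult_group subset_iff)
  then show ?case
    using comm_prods_add[OF Suc.IH[OF cz(2)] comm_prods_1[OF simple_comms_inv[OF cz(1)]]]
    by simp
qed (simp add: comm_prods_0)

lemma comm_prods_pow:
  assumes "y \<in> comm_prods G H k"
  shows "y [^] (m::nat) \<in> comm_prods G H (m * k)"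
  using assms
proof (induction m)
  case (Suc m)
  then show ?case using comm_prods_add[of "y [^] m" "m * k" y k] by (simp add: add.commute)
qed (simp add: comm_prods_0)

lemma comm_prods_comm_sub: "y \<in> comm_prods G H k \<Longrightarrow> y \<in> comm_sub G H"
proof (induction k arbitrary: y)
  case (Suc k)
  then show ?case unfolding comm_sub_def
    by (auto elim!: comm_prods_Suc intro: generate.eng generate.incl)
qed (auto simp: comm_prods_0 comm_sub_def generate.one)

lemma comm_sub_iff: "y \<in> comm_sub G H \<longleftrightarrow> (\<exists>k. y \<in> comm_prods G H k)"
proof
  show "\<exists>k. y \<in> comm_prods G H k" if "y \<in> comm_sub G H"
    using that unfolding comm_sub_def
    by (induction rule: generate.induct)
      (use comm_prods_0 comm_prods_1 comm_prods_add simple_comms_inv in blast)+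
qed (use comm_prods_comm_sub in blast)

lemma comm_sub_subset: "comm_sub G H \<subseteq> H"
  using comm_sub_iff comm_prods_subset by blast

lemma comm_sub_carrier [simp]: "y \<in> comm_sub G H \<Longrightarrow> y \<in> carrier G"
  using comm_sub_subset by auto

lemma comm_sub_mult [simp]: "y \<in> comm_sub G H \<Longrightarrow> z \<in> comm_sub G H \<Longrightarrow> y \<otimes> z \<in> comm_sub G H"
  unfolding comm_sub_iff using comm_prods_add by blast

lemma comm_sub_inv [simp]: "y \<in> comm_sub G H \<Longrightarrow> inv y \<in> comm_sub G H"
  unfolding comm_sub_iff using comm_prods_inv by blast

lemma comm_sub_one [simp]: "\<one> \<in> comm_sub G H"
  unfolding comm_sub_iff using one_comm_prods by blast

lemma comm_sub_pow [simp]: "y \<in> comm_sub G H \<Longrightarrow> y [^] (m::nat) \<in> comm_sub G H"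
  by (induction m) auto

lemma cl_eq: "cl G H y = (LEAST k. y \<in> comm_prods G H k)"
proof -
  have "simple_comms G H \<union> (\<lambda>c. inv c) ` simple_comms G H = simple_comms G H"
    using simple_comms_inv by auto
  then show ?thesis unfolding cl_def comm_prods_def
    by (intro arg_cong[of _ _ Least] ext) auto
qed

lemma cl_le: "y \<in> comm_prods G H k \<Longrightarrow> cl G H y \<le> k"
  unfolding cl_eq by (rule Least_le)

lemma cl_mem: "y \<in> comm_sub G H \<Longrightarrow> y \<in> comm_prods G H (cl G H y)"
  unfolding cl_eq comm_sub_iff by (rule LeastI_ex)

lemma near_refl: "y \<in> carrier G \<Longrightarrow> near G H k y y"
  unfolding near_def by (simp add: one_comm_prods)

lemma near_sym:
  assumes "near G H k y z" "y \<in> carrier G" "z \<in> carrier G"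
  shows "near G H k z y"
  using comm_prods_inv[of "inv y \<otimes> z" k] assms by (simp add: near_def inv_mult_group)

lemma near_trans:
  assumes "near G H i x y" "near G H j y z" "x \<in> carrier G" "y \<in> carrier G" "z \<in> carrier G"
  shows "near G H (i + j) x z"
  using comm_prods_add[of "inv x \<otimes> y" i "inv y \<otimes> z" j] assms by (simp add: near_def m_assoc)

text \<open>The error of the left factor gets conjugated by the right factor, which does not change
  the number of simple commutators.\<close>

lemma near_mult:
  assumes "near G H i x y" "near G H j x' y'"
    "x \<in> carrier G" "y \<in> carrier G" "x' \<in> carrier G" "y' \<in> carrier G"
  shows "near G H (i + j) (x \<otimes> x') (y \<otimes> y')"
proof -
  have "inv (x \<otimes> x') \<otimes> (y \<otimes> y')
      = (inv x' \<otimes> (inv x \<otimes> y) \<otimes> inv (inv x')) \<otimes> (inv x' \<otimes> y')"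
    using assms by (simp add: m_assoc inv_mult_group)
  then show ?thesis
    using comm_prods_add[OF comm_prods_conj[of "inv x \<otimes> y" i "inv x'"], of "inv x' \<otimes> y'" j] assms
    by (simp add: near_def)
qed

lemma near_conj:
  assumes "g \<in> carrier G" "x \<in> H"
  shows "near G H 1 x (g \<otimes> x \<otimes> inv g)"
proof -
  have "inv x \<otimes> (g \<otimes> x \<otimes> inv g) = commutator G (inv x \<otimes> g) x"
    using assms by (simp add: commutator_def m_assoc inv_mult_group)
  then show ?thesis
    using assms comm_prods_1[OF simple_commsI[of "inv x \<otimes> g" x]] by (simp add: near_def)
qed

lemma near_commute:
  assumes "g \<in> carrier G" "x \<in> H"
  shows "near G H 1 (x \<otimes> g) (g \<otimes> x)"
proof -
  have "inv (x \<otimes> g) \<otimes> (g \<otimes> x) = commutator G (inv g) (inv x)"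
    using assms by (simp add: commutator_def m_assoc inv_mult_group)
  then show ?thesis
    using assms comm_prods_1[OF simple_commsI[of "inv g" "inv x"]] by (simp add: near_def)
qed

lemma near_comm_sub:
  assumes "near G H k y z" "y \<in> comm_sub G H" "z \<in> carrier G"
  shows "z \<in> comm_sub G H"
proof -
  have "inv y \<otimes> z \<in> comm_sub G H"
    using assms(1) comm_sub_iff unfolding near_def by blast
  from comm_sub_mult[OF assms(2) this] show ?thesis using assms by simp
qed

lemma near_comm_prods:
  assumes "near G H i y z" "y \<in> comm_prods G H j" "z \<in> carrier G"
  shows "z \<in> comm_prods G H (i + j)"
  using comm_prods_add[OF assms(2) assms(1)[unfolded near_def]] assms(2,3)
  by (simp add: add.commute)

end

section \<open>Words with integer exponents and their classes in the free abelian group\<close>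

fun word_count :: "('a \<times> int) list \<Rightarrow> 'a \<Rightarrow>\<^sub>0 int" where
  "word_count [] = 0"
| "word_count ((x, n) # w) = Poly_Mapping.single x n + word_count w"

fun word_prod :: "('a,'b) monoid_scheme \<Rightarrow> ('a \<times> int) list \<Rightarrow> 'a" where
  "word_prod G [] = \<one>\<^bsub>G\<^esub>"
| "word_prod G ((x, n) # w) = x [^]\<^bsub>G\<^esub> n \<otimes>\<^bsub>G\<^esub> word_prod G w"

definition word_inv :: "('a \<times> int) list \<Rightarrow> ('a \<times> int) list" where
  "word_inv w = rev (map (\<lambda>(x, n). (x, - n)) w)"

text \<open>Multiplies exponents instead of repeating the word: the class is that of
  \<open>m\<close> copies, but the number of letters, and with it the cost of reordering, stays that
  of \<open>w\<close>.\<close>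

definition word_scale :: "int \<Rightarrow> ('a \<times> int) list \<Rightarrow> ('a \<times> int) list" where
  "word_scale m w = map (\<lambda>(x, n). (x, m * n)) w"

text \<open>The value at \<open>w\<close> of the linear extension of \<open>\<phi>\<close> to the
  free abelian group; for a homogeneous quasimorphism it approximates the value at the product of
  \<open>w\<close>.\<close>

definition word_val :: "('a \<Rightarrow> real) \<Rightarrow> ('a \<times> int) list \<Rightarrow> real" where
  "word_val \<phi> w = (\<Sum>(x, n)\<leftarrow>w. of_int n * \<phi> x)"

abbreviation word_over :: "'a set \<Rightarrow> ('a \<times> int) list \<Rightarrow> bool" where
  "word_over M w \<equiv> fst ` set w \<subseteq> M"

lemma word_count_append: "word_count (u @ w) = word_count u + word_count w"
  by (induction u rule: word_count.induct) (auto simp: add.assoc)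

lemma word_count_inv: "word_count (word_inv w) = - word_count w"
  unfolding word_inv_def
  by (induction w rule: word_count.induct) (auto simp: word_count_append single_uminus)

lemma word_count_replicate: "word_count (concat (replicate m w)) = (\<Sum>i<m. word_count w)"
  by (induction m) (auto simp: word_count_append add.commute)

lemma word_count_scale: "word_count (word_scale (int m) w) = (\<Sum>i<m. word_count w)"
  unfolding word_scale_def
proof (induction w rule: word_count.induct)
  case (2 x n w)
  have "Poly_Mapping.single x (int m * n) = (\<Sum>i<m. Poly_Mapping.single x n)"
    by (induction m) (auto simp: ring_distribs single_add)
  with 2 show ?case by (simp add: sum.distrib)
qed simp

lemma word_over_inv [simp]: "word_over M (word_inv w) \<longleftrightarrow> word_over M w"
  by (simp add: word_inv_def image_image case_prod_beta)

lemma word_over_scale [simp]: "word_over M (word_scale m w) \<longleftrightarrow> word_over M w"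
  by (simp add: word_scale_def image_image case_prod_beta)

lemma length_word_inv [simp]: "length (word_inv w) = length w"
  by (simp add: word_inv_def)

lemma length_word_scale [simp]: "length (word_scale m w) = length w"
  by (simp add: word_scale_def)

lemma length_concat_replicate: "length (concat (replicate m w)) = m * length w"
  by (induction m) auto

lemma word_over_replicate: "word_over M w \<Longrightarrow> word_over M (concat (replicate m w))"
  by (auto simp: image_subset_iff)

lemma word_val_append: "word_val \<phi> (u @ w) = word_val \<phi> u + word_val \<phi> w"
  by (simp add: word_val_def)

lemma word_val_Nil: "word_val \<phi> [] = 0"
  by (simp add: word_val_def)

lemma word_val_Cons: "word_val \<phi> ((x, n) # w) = of_int n * \<phi> x + word_val \<phi> w"
  by (simp add: word_val_def)

lemma word_val_inv: "word_val \<phi> (word_inv w) = - word_val \<phi> w"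
  by (induction w rule: word_count.induct)
    (auto simp: word_inv_def word_val_append word_val_Cons word_val_Nil)

lemma word_val_scale: "word_val \<phi> (word_scale m w) = of_int m * word_val \<phi> w"
  by (induction w rule: word_count.induct)
    (auto simp: word_scale_def word_val_Cons word_val_Nil ring_distribs)

context group
begin

lemma word_prod_closed [simp]: "word_over (carrier G) w \<Longrightarrow> word_prod G w \<in> carrier G"
  by (induction w rule: word_count.induct) auto

lemma word_prod_append:
  "word_over (carrier G) u \<Longrightarrow> word_over (carrier G) w \<Longrightarrow>
    word_prod G (u @ w) = word_prod G u \<otimes> word_prod G w"
  by (induction u rule: word_count.induct) (auto simp: m_assoc)

lemma word_prod_inv:
  "word_over (carrier G) w \<Longrightarrow> word_prod G (word_inv w) = inv (word_prod G w)"
proof (induction w rule: word_count.induct)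
  case (2 x n w)
  have "word_prod G (word_inv ((x, n) # w)) = word_prod G (word_inv w) \<otimes> x [^] (- n)"
    using 2(2) word_prod_append[of "word_inv w" "[(x, - n)]"] word_over_inv[of w "carrier G"]
    by (simp add: word_inv_def)
  then show ?case using 2 by (simp add: int_pow_neg inv_mult_group)
qed (simp add: word_inv_def)

lemma word_prod_replicate:
  assumes "word_over (carrier G) w"
  shows "word_prod G (concat (replicate m w)) = word_prod G w [^] m"
proof (induction m)
  case (Suc m)
  have "word_prod G (concat (replicate (Suc m) w)) = word_prod G w \<otimes> word_prod G w [^] m"
    using word_prod_append[OF assms word_over_replicate[OF assms]] Suc by simp
  then show ?case
    using assms pow_mult_distrib nat_pow_Suc2[of "word_prod G w" m] by simp
qed simp

end

context normal
begin

lemma int_pow_mem [simp]: "x \<in> H \<Longrightarrow> x [^] (n::int) \<in> H"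
  using subgroup_int_pow_closed[OF subgroup_axioms] by simp

lemma word_over_carrier: "word_over H w \<Longrightarrow> word_over (carrier G) w"
  using subset by blast

lemma word_prod_mem: "word_over H w \<Longrightarrow> word_prod G w \<in> H"
  by (induction w rule: word_count.induct) (auto simp: m_closed)

lemma word_prod_trivial:
  assumes "word_over H w" "word_count w = 0"
  shows "word_prod G w \<in> comm_prods G H (length w)"
  using assms
proof (induction w rule: length_induct)
  case (1 w)
  show ?case
  proof (cases w)
    case Nil
    then show ?thesis by (simp add: comm_prods_0)
  next
    case (Cons p r)
    obtain x n where p: "p = (x, n)" by (cases p)
    have x: "x \<in> H" and r: "word_over H r" using 1 Cons p by auto
    show ?thesis
    proof (cases "x \<in> fst ` set r")
      case True
      then obtain n' where "(x, n') \<in> set r" by auto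
      then obtain a b where ab: "r = a @ (x, n') # b" by (meson split_list)
      let ?v = "(x, n + n') # a @ b"
      have a: "word_over H a" and b: "word_over H b" using r ab by auto
      have "word_count ?v = word_count w"
        using Cons p ab by (simp add: word_count_append single_add)
      then have IH: "word_prod G ?v \<in> comm_prods G H (length ?v)"
        using "1.IH"[rule_format, of ?v] "1.prems" Cons p ab a b x
        by (simp del: word_count.simps word_prod.simps)
      have H: "word_prod G a \<in> H" "word_prod G b \<in> H" using a b by (auto simp: word_prod_mem)
      have v: "word_prod G ?v = x [^] n \<otimes> ((x [^] n' \<otimes> word_prod G a) \<otimes> word_prod G b)"
        using x H a b by (simp add: word_prod_append word_over_carrier int_pow_mult m_assoc)
      have w: "word_prod G w = x [^] n \<otimes> ((word_prod G a \<otimes> x [^] n') \<otimes> word_prod G b)"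
        using x H a b Cons p ab
        by (simp add: word_prod_append word_over_carrier m_assoc)
      have "near G H (0 + ((0 + 1) + 0)) (word_prod G ?v) (word_prod G w)"
        unfolding v w using x H near_commute[of "word_prod G a" "x [^] n'"]
        by (intro near_mult[OF near_refl near_mult[OF _ near_refl]]) auto
      then show ?thesis
        using near_comm_prods[OF _ IH, of 1 "word_prod G w"] Cons p ab 1 word_prod_mem[of w] by auto
    next
      case False
      have "Poly_Mapping.lookup (word_count r) x = 0" using False
        by (induction r rule: word_count.induct) (auto simp: lookup_add lookup_single)
      moreover have "Poly_Mapping.lookup (word_count w) x = n + Poly_Mapping.lookup (word_count r) x"
        using Cons p by (simp add: lookup_add)
      ultimately have "n = 0" using 1 by simp
      then have "word_prod G r \<in> comm_prods G H (length r)" "word_prod G w = word_prod G r"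
        using 1 Cons p r by (auto simp: word_over_carrier)
      then show ?thesis using comm_prods_mono[of "length r" "length w"] Cons by simp
    qed
  qed
qed

lemma word_prod_near:
  assumes "word_over H u" "word_over H w" "word_count u = word_count w"
  shows "near G H (length u + length w) (word_prod G u) (word_prod G w)"
proof -
  have "word_prod G (word_inv u @ w) \<in> comm_prods G H (length (word_inv u @ w))"
    using assms word_over_inv[of u H]
    by (intro word_prod_trivial) (simp_all add: image_Un word_count_append word_count_inv)
  moreover have "word_prod G (word_inv u @ w) = inv (word_prod G u) \<otimes> word_prod G w"
    using assms by (simp add: word_prod_append word_prod_inv word_over_carrier)
  ultimately show ?thesis by (simp add: near_def)
qed

end

section \<open>A Hahn-Banach theorem for abelian groups\<close>

text \<open>The partial functional is its graph \<open>\<Gamma>\<close>, not assumed single-valued: domination on \<open>E 0\<close> makes it so.\<close>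
lemma dominated_additive_extension:
  fixes E :: "nat \<Rightarrow> 'v::ab_group_add set" and \<Gamma> :: "('v \<times> real) set" and c :: real
  assumes E0: "0 \<in> E 0"
    and E_add: "\<And>i j u v. u \<in> E i \<Longrightarrow> v \<in> E j \<Longrightarrow> u + v \<in> E (i + j)"
    and E_minus: "\<And>i u. u \<in> E i \<Longrightarrow> - u \<in> E i"
    and G_zero: "(0, 0) \<in> \<Gamma>"
    and G_add: "\<And>u s v t. (u, s) \<in> \<Gamma> \<Longrightarrow> (v, t) \<in> \<Gamma> \<Longrightarrow> (u + v, s + t) \<in> \<Gamma>"
    and G_minus: "\<And>u s. (u, s) \<in> \<Gamma> \<Longrightarrow> (- u, - s) \<in> \<Gamma>"
    and dom: "\<And>k u s. (u, s) \<in> \<Gamma> \<Longrightarrow> u \<in> E k \<Longrightarrow> s \<le> c * real k"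
  obtains F where "\<And>u v. F (u + v) = F u + F v" "\<And>u s. (u, s) \<in> \<Gamma> \<Longrightarrow> F u = s"
    "\<And>k u. u \<in> E k \<Longrightarrow> \<bar>F u\<bar> \<le> c * real k"
proof -
  define good :: "('v \<times> real) set \<Rightarrow> bool" where
    "good D \<longleftrightarrow> \<Gamma> \<subseteq> D \<and> (\<forall>u s v t. (u, s) \<in> D \<longrightarrow> (v, t) \<in> D \<longrightarrow> (u + v, s + t) \<in> D)
      \<and> (\<forall>u s. (u, s) \<in> D \<longrightarrow> (- u, - s) \<in> D)
      \<and> (\<forall>k u s. (u, s) \<in> D \<longrightarrow> u \<in> E k \<longrightarrow> s \<le> c * real k)" for D
  have "\<exists>M\<in>{D. good D}. \<forall>M1\<in>{D. good D}. M \<subseteq> M1 \<longrightarrow> M1 = M"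
  proof (rule subset_Zorn_nonempty)
    show "{D. good D} \<noteq> {}" using G_add G_minus dom by (auto simp: good_def)
  next
    fix C assume C: "C \<noteq> {}" "subset.chain {D. good D} C"
    then have g: "good D" if "D \<in> C" for D using that by (auto simp: subset.chain_def)
    have tot: "D \<subseteq> D' \<or> D' \<subseteq> D" if "D \<in> C" "D' \<in> C" for D D'
      using C that by (auto simp: subset_chain_def)
    have "good (\<Union>C)"
      unfolding good_def
    proof (intro conjI allI impI)
      show "\<Gamma> \<subseteq> \<Union>C" using C g unfolding good_def by blast
    next
      fix u s v t assume "(u, s) \<in> \<Union>C" "(v, t) \<in> \<Union>C"
      then obtain D D' where "D \<in> C" "D' \<in> C" "(u, s) \<in> D" "(v, t) \<in> D'" by auto
      then obtain B where "B \<in> C" "(u, s) \<in> B" "(v, t) \<in> B" using tot by blast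
      then show "(u + v, s + t) \<in> \<Union>C" using g[of B] unfolding good_def by blast
    next
      fix u s assume "(u, s) \<in> \<Union>C"
      then show "(- u, - s) \<in> \<Union>C" using g unfolding good_def by blast
    next
      fix k u s assume "(u, s) \<in> \<Union>C" "u \<in> E k"
      then show "s \<le> c * real k" using g unfolding good_def by blast
    qed
    then show "\<Union>C \<in> {D. good D}" by simp
  qed
  then obtain M where M: "good M" and max: "\<And>M1. good M1 \<Longrightarrow> M \<subseteq> M1 \<Longrightarrow> M1 = M" by blast
  have M_add: "(u + v, s + t) \<in> M" if "(u, s) \<in> M" "(v, t) \<in> M" for u s v t
    using M that unfolding good_def by blast
  have M_minus: "(- u, - s) \<in> M" if "(u, s) \<in> M" for u s
    using M that unfolding good_def by blast
  have M_dom: "s \<le> c * real k" if "(u, s) \<in> M" "u \<in> E k" for u s k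
    using M that unfolding good_def by blast
  have M_sub: "\<Gamma> \<subseteq> M" using M unfolding good_def by blast
  define mul :: "nat \<Rightarrow> 'v \<Rightarrow> 'v" where "mul n v = (\<Sum>i<n. v)" for n v
  have mul_simps: "mul 0 v = 0" "mul (Suc n) v = mul n v + v" for n v by (auto simp: mul_def)
  have mul_plus: "mul (m + n) v = mul m v + mul n v" for m n v
    by (induction n) (auto simp: mul_simps add_ac)
  have mul_mul: "mul m (mul n v) = mul (m * n) v" for m n v
    by (induction m) (auto simp: mul_simps mul_plus add.commute)
  have mul_dist: "mul n (u + v) = mul n u + mul n v" for n u v
    by (simp add: mul_def sum.distrib)
  have mul_minus: "mul n (- u) = - mul n u" for n u
    by (simp add: mul_def sum_negf)
  have M_mul: "(mul n u, real n * s) \<in> M" if "(u, s) \<in> M" for n u s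
  proof (induction n)
    case 0 show ?case using M_sub G_zero by (auto simp: mul_simps)
  next
    case (Suc n) with M_add[OF Suc that] show ?case by (simp add: mul_simps ring_distribs add_ac)
  qed
  have E_mul: "mul n u \<in> E (n * k)" if "u \<in> E k" for n u k
  proof (induction n)
    case 0 show ?case using E0 by (simp add: mul_simps)
  next
    case (Suc n) with E_add[OF Suc that] show ?case by (simp add: mul_simps add.commute)
  qed
  have total: "\<exists>s. (v, s) \<in> M" for v
  proof -
    \<comment> \<open>The value \<open>a\<close> to be given to \<open>v\<close> must satisfy t + j
      a \<le> c k whenever u + j v lies in \<open>E k\<close>; these conditions are the upper bounds
      \<open>U\<close>. Negative multiples of \<open>v\<close> become the lower bounds
      \<open>W\<close> after a change of sign. Some multiple of \<open>v\<close> may already lie in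
      the domain; this case is included.\<close>
    define U where "U = {(c * real k - t) / real j | j k u t. 0 < j \<and> (u, t) \<in> M \<and> u + mul j v \<in> E k}"
    define W where "W = {(- c * real k - t) / real j | j k u t. 0 < j \<and> (u, t) \<in> M \<and> u + mul j v \<in> E k}"
    have WU: "x \<le> y" if x: "x \<in> W" and y: "y \<in> U" for x y
    proof -
      obtain j k u t where 1: "0 < j" "(u, t) \<in> M" "u + mul j v \<in> E k" "x = (- c * real k - t) / real j"
        using x unfolding W_def by blast
      obtain j' k' u' t' where 2: "0 < j'" "(u', t') \<in> M" "u' + mul j' v \<in> E k'" "y = (c * real k' - t') / real j'"
        using y unfolding U_def by blast
      \<comment> \<open>Cross-multiplication cancels \<open>v\<close>, so that the domination
        already known on \<open>M\<close> compares the two bounds.\<close>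
      have "mul j (u' + mul j' v) + - mul j' (u + mul j v) \<in> E (j * k' + j' * k)"
        using E_add[OF E_mul[OF 2(3), of j] E_minus[OF E_mul[OF 1(3), of j']]] .
      moreover have "mul j (u' + mul j' v) + - mul j' (u + mul j v) = mul j u' + - mul j' u"
        by (simp add: mul_dist mul_mul mult.commute)
      moreover have "(mul j u' + - mul j' u, real j * t' + - (real j' * t)) \<in> M"
        by (intro M_add M_minus M_mul 1 2)
      ultimately have "real j * t' - real j' * t \<le> c * real (j * k' + j' * k)"
        using M_dom by fastforce
      then have "real j' * (- c * real k - t) \<le> real j * (c * real k' - t')"
        by (simp add: algebra_simps)
      then show ?thesis unfolding 1(4) 2(4) using 1(1) 2(1) by (simp add: divide_simps mult.commute)
    qed
    obtain a where a: "\<And>x. x \<in> W \<Longrightarrow> x \<le> a" "\<And>y. y \<in> U \<Longrightarrow> a \<le> y"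
    proof (cases "U = {}")
      \<comment> \<open>No bound restricts the value at \<open>v\<close>, and 0 is taken.\<close>
      case True
      then have "W = {}" unfolding U_def W_def by blast
      then show ?thesis using True that[of 0] by simp
    next
      case False
      then have ne: "W \<noteq> {}" unfolding U_def W_def by blast
      have "bdd_above W" using WU False unfolding bdd_above_def by blast
      then show ?thesis using that[of "Sup W"] cSup_upper[of _ W] cSup_least[OF ne] WU by blast
    qed
    define M1 where "M1 = {(u + mul j v, t + real j * a) | u t j. (u, t) \<in> M}
      \<union> {(u - mul j v, t - real j * a) | u t j. (u, t) \<in> M}"
    \<comment> \<open>\<open>mul\<close> only knows natural multiples. Writing integers as
      differences \<open>i - j\<close> makes closure under sums and negation componentwise, while
      the two-sided form of \<open>M1\<close> is the convenient one for domination.\<close>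
    have M1_iff: "p \<in> M1 \<longleftrightarrow> (\<exists>u t i j. (u, t) \<in> M \<and> p = (u + mul i v - mul j v, t + real i * a - real j * a))" for p
    proof
      assume "p \<in> M1"
      then consider (1) u t j where "(u, t) \<in> M" "p = (u + mul j v, t + real j * a)"
        | (2) u t j where "(u, t) \<in> M" "p = (u - mul j v, t - real j * a)"
        unfolding M1_def by blast
      then show "\<exists>u t i j. (u, t) \<in> M \<and> p = (u + mul i v - mul j v, t + real i * a - real j * a)"
      proof cases
        case 1
        then show ?thesis
          by (intro exI[of _ u] exI[of _ t] exI[of _ j] exI[of _ 0]) (simp add: mul_simps)
      next
        case 2
        then show ?thesis
          by (intro exI[of _ u] exI[of _ t] exI[of _ 0] exI[of _ j]) (simp add: mul_simps)
      qed
    next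
      assume "\<exists>u t i j. (u, t) \<in> M \<and> p = (u + mul i v - mul j v, t + real i * a - real j * a)"
      then obtain u t i j where p: "(u, t) \<in> M" "p = (u + mul i v - mul j v, t + real i * a - real j * a)"
        by blast
      show "p \<in> M1"
      proof (cases "j \<le> i")
        case True
        then obtain d where "i = j + d" using le_Suc_ex by blast
        then show ?thesis using p unfolding M1_def by (auto simp: mul_plus ring_distribs)
      next
        case False
        then obtain d where "j = i + d" using le_Suc_ex[of i j] by auto
        then show ?thesis using p unfolding M1_def
          by (intro UnI2) (auto simp: mul_plus ring_distribs intro!: exI[of _ u] exI[of _ t] exI[of _ d])
      qed
    qed
    have MM: "M \<subseteq> M1"
    proof (clarify)
      fix u t assume "(u, t) \<in> M"
      then show "(u, t) \<in> M1" unfolding M1_iff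
        by (intro exI[of _ u] exI[of _ t] exI[of _ 0]) (simp add: mul_simps)
    qed
    have "good M1"
      unfolding good_def
    proof (intro conjI allI impI)
      show "\<Gamma> \<subseteq> M1" using M_sub MM by simp
    next
      fix u s w t assume "(u, s) \<in> M1" "(w, t) \<in> M1"
      then obtain u1 t1 i1 j1 u2 t2 i2 j2 where
        "(u1, t1) \<in> M" "u = u1 + mul i1 v - mul j1 v" "s = t1 + real i1 * a - real j1 * a"
        "(u2, t2) \<in> M" "w = u2 + mul i2 v - mul j2 v" "t = t2 + real i2 * a - real j2 * a"
        unfolding M1_iff by auto
      then show "(u + w, s + t) \<in> M1" unfolding M1_iff
        by (intro exI[of _ "u1 + u2"] exI[of _ "t1 + t2"] exI[of _ "i1 + i2"] exI[of _ "j1 + j2"])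
          (auto simp: mul_plus ring_distribs M_add)
    next
      fix u s assume "(u, s) \<in> M1"
      then obtain u1 t1 i1 j1 where
        "(u1, t1) \<in> M" "u = u1 + mul i1 v - mul j1 v" "s = t1 + real i1 * a - real j1 * a"
        unfolding M1_iff by auto
      then show "(- u, - s) \<in> M1" unfolding M1_iff
        by (intro exI[of _ "- u1"] exI[of _ "- t1"] exI[of _ j1] exI[of _ i1])
          (auto simp: M_minus)
    next
      fix k u s assume us: "(u, s) \<in> M1" "u \<in> E k"
      then consider (1) w t j where "(w, t) \<in> M" "u = w + mul j v" "s = t + real j * a"
        | (2) w t j where "(w, t) \<in> M" "u = w - mul j v" "s = t - real j * a"
        unfolding M1_def by blast
      then show "s \<le> c * real k"
      proof cases
        case 1
        show ?thesis
        proof (cases "j = 0")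
          case True
          then show ?thesis using 1 us M_dom by (simp add: mul_simps)
        next
          case False
          have "(c * real k - t) / real j \<in> U" unfolding U_def using 1 us False by blast
          then have "a \<le> (c * real k - t) / real j" by (rule a)
          then show ?thesis using 1 False by (simp add: field_simps)
        qed
      next
        case 2
        show ?thesis
        proof (cases "j = 0")
          case True
          then show ?thesis using 2 us M_dom by (simp add: mul_simps)
        next
          case False
          have "- w + mul j v \<in> E k" using E_minus[OF us(2)] 2 by simp
          then have "(- c * real k - (- t)) / real j \<in> W"
            unfolding W_def using M_minus[OF 2(1)] False by blast
          then have "(- c * real k - (- t)) / real j \<le> a" by (rule a)
          then show ?thesis using 2 False by (simp add: field_simps)
        qed
      qed
    qed
    then have "M1 = M" using MM by (rule max)
    moreover have "(v, a) \<in> M1" unfolding M1_iff using M_sub G_zero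
      by (intro exI[of _ 0] exI[of _ 0] exI[of _ 1] exI[of _ 0]) (auto simp: mul_def)
    ultimately show ?thesis by blast
  qed
  \<comment> \<open>The difference of two values at \<open>u\<close> is a value at 0, which lies in
    \<open>E 0\<close> and is therefore at most \<open>c * 0\<close>.\<close>
  have uniq: "s = t" if "(u, s) \<in> M" "(u, t) \<in> M" for u s t
  proof -
    have "s - t \<le> 0" "t - s \<le> 0"
      using M_dom[OF M_add[OF that(1) M_minus[OF that(2)]], of 0]
        M_dom[OF M_add[OF that(2) M_minus[OF that(1)]], of 0] E0 by auto
    then show ?thesis by simp
  qed
  define F where "F u = (SOME s. (u, s) \<in> M)" for u
  have F: "(u, F u) \<in> M" for u unfolding F_def using someI_ex[OF total] .
  show thesis
  proof (rule that)
    show "F (u + v) = F u + F v" for u v using uniq[OF F M_add[OF F F]] .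
    show "F u = s" if "(u, s) \<in> \<Gamma>" for u s using uniq[OF F] M_sub that by blast
    show "\<bar>F u\<bar> \<le> c * real k" if "u \<in> E k" for u k
      using M_dom[OF F that] M_dom[OF M_minus[OF F] E_minus[OF that]] by simp
  qed
qed

section \<open>Asymptotic dimension of the integer lattices\<close>

text \<open>Testing with finite lower bounds treats finite and infinite dimension at once.\<close>

lemma enat_leI_finite: "(\<And>n. enat n \<le> w \<Longrightarrow> enat n \<le> s) \<Longrightarrow> w \<le> s"
proof (cases w)
  case infinity
  assume "\<And>n. enat n \<le> w \<Longrightarrow> enat n \<le> s"
  then have *: "enat n \<le> s" for n using infinity by simp
  show ?thesis
  proof (cases s)
    case (enat m)
    then show ?thesis using *[of "Suc m"] by simp
  qed simp
qed simp

text \<open>The preimages of a good cover form a good cover: control of \<open>f\<close> carries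
  disjointness back, properness carries boundedness back.\<close>

lemma asdim_le_pullback:
  fixes f :: "'x \<Rightarrow> 'y"
  assumes Y: "asdim_le Y dY n" and f: "f ` X1 \<subseteq> Y"
    and c: "controlled_on X1 dX dY f" and p: "coarsely_proper_on X1 dX dY f"
  shows "asdim_le X1 dX n"
  unfolding asdim_le_def
proof (intro allI impI)
  fix r :: real assume "r > 0"
  obtain T where T: "\<And>x y. x \<in> X1 \<Longrightarrow> y \<in> X1 \<Longrightarrow> dX x y \<le> r \<Longrightarrow> dY (f x) (f y) \<le> T"
    using c unfolding controlled_on_def by meson
  \<comment> \<open>Covers are only provided at positive scales, whereas the control constant
    \<open>T\<close> may have any sign.\<close>
  have pos: "max T 1 > 0" by simp
  obtain \<U> :: "nat \<Rightarrow> 'y set set" and B where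
    U: "\<forall>i\<le>n. \<forall>U\<in>\<U> i. U \<subseteq> Y" "\<forall>i\<le>n. \<forall>U\<in>\<U> i. \<forall>x\<in>U. \<forall>y\<in>U. dY x y \<le> B"
    "\<forall>i\<le>n. \<forall>U\<in>\<U> i. \<forall>U'\<in>\<U> i. U \<noteq> U' \<longrightarrow> (\<forall>x\<in>U. \<forall>y\<in>U'. max T 1 < dY x y)"
    "Y \<subseteq> (\<Union>i\<le>n. \<Union>(\<U> i))"
    using Y[unfolded asdim_le_def, THEN spec, THEN mp, OF pos] by (elim exE conjE) (rule that)
  obtain T' where T': "\<And>x y. x \<in> X1 \<Longrightarrow> y \<in> X1 \<Longrightarrow> dX x y > T' \<Longrightarrow> dY (f x) (f y) > B"
    using p unfolding coarsely_proper_on_def by meson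
  let ?V = "\<lambda>i. (\<lambda>U. f -` U \<inter> X1) ` \<U> i"
  show "\<exists>\<U> :: nat \<Rightarrow> 'x set set. (\<forall>i\<le>n. \<forall>U\<in>\<U> i. U \<subseteq> X1) \<and>
      (\<exists>B. \<forall>i\<le>n. \<forall>U\<in>\<U> i. \<forall>x\<in>U. \<forall>y\<in>U. dX x y \<le> B) \<and>
      (\<forall>i\<le>n. \<forall>U\<in>\<U> i. \<forall>U'\<in>\<U> i. U \<noteq> U' \<longrightarrow> (\<forall>x\<in>U. \<forall>y\<in>U'. r < dX x y)) \<and>
      X1 \<subseteq> (\<Union>i\<le>n. \<Union>(\<U> i))"
  proof (intro exI[of _ ?V] conjI)
    show "\<exists>B. \<forall>i\<le>n. \<forall>U\<in>?V i. \<forall>x\<in>U. \<forall>y\<in>U. dX x y \<le> B"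
    proof (intro exI[of _ T'] allI impI ballI)
      fix i V x y assume "i \<le> n" "V \<in> ?V i" "x \<in> V" "y \<in> V"
      then have "dY (f x) (f y) \<le> B" "x \<in> X1" "y \<in> X1" using U(2) by auto
      then show "dX x y \<le> T'" using T'[of x y] by force
    qed
    show "\<forall>i\<le>n. \<forall>U\<in>?V i. \<forall>U'\<in>?V i. U \<noteq> U' \<longrightarrow> (\<forall>x\<in>U. \<forall>y\<in>U'. r < dX x y)"
    proof (intro allI impI ballI)
      fix i V V' x y assume a: "i \<le> n" "V \<in> ?V i" "V' \<in> ?V i" "V \<noteq> V'" "x \<in> V" "y \<in> V'"
      then obtain U' U'' where "U' \<in> \<U> i" "U'' \<in> \<U> i" "U' \<noteq> U''" "f x \<in> U'" "f y \<in> U''" "x \<in> X1" "y \<in> X1"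
        by auto
      then have "T < dY (f x) (f y)" using U(3) a(1) by fastforce
      then show "r < dX x y" using T[of x y] \<open>x \<in> X1\<close> \<open>y \<in> X1\<close> by force
    qed
    show "X1 \<subseteq> (\<Union>i\<le>n. \<Union>(?V i))"
    proof
      fix x assume x: "x \<in> X1"
      then have "f x \<in> (\<Union>i\<le>n. \<Union>(\<U> i))" using U(4) f by blast
      then show "x \<in> (\<Union>i\<le>n. \<Union>(?V i))" using x by auto
    qed
  qed auto
qed

lemma asdim_lower:
  assumes "\<And>m. asdim_le Y d m \<Longrightarrow> n \<le> m"
  shows "enat n \<le> asdim Y d"
  unfolding asdim_def using assms by (intro Inf_greatest) auto

lemma asdim_upper: "asdim_le Y d n \<Longrightarrow> asdim Y d \<le> enat n"
  unfolding asdim_def by (intro Inf_lower) auto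

section \<open>Covering the integer lattices by n + 1 families\<close>

definition near_wall :: "int \<Rightarrow> int \<Rightarrow> int \<Rightarrow> bool" where
  "near_wall s t a \<longleftrightarrow> (a + t) mod s \<le> 2 * t"

text \<open>Near a wall, the shifted quotient is the index of that wall; elsewhere the quotient is
  the index of the interval between two walls. The Boolean keeps the two kinds of index
  apart.\<close>

definition wall_label :: "int \<Rightarrow> int \<Rightarrow> int \<Rightarrow> bool \<times> int" where
  "wall_label s t a = (if near_wall s t a then (True, (a + t) div s) else (False, a div s))"

lemma wall_label_close:
  assumes "0 < s" "2 * t < s" "wall_label s t a = wall_label s t b"
  shows "\<bar>a - b\<bar> < s"
proof -
  have *: "\<bar>x - y\<bar> < s" if "x div s = y div s" for x y
    using that assms(1) div_mult_mod_eq[of x s] div_mult_mod_eq[of y s]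
      pos_mod_bound[of s x] pos_mod_bound[of s y] pos_mod_sign[of s x] pos_mod_sign[of s y]
    by (smt (verit))
  show ?thesis
    using *[of "a + t" "b + t"] *[of a b] assms(3)
    by (auto simp: wall_label_def split: if_splits)
qed

lemma near_wall_iff:
  assumes "0 \<le> t" "2 * t < s"
  shows "near_wall s t a \<longleftrightarrow> (\<exists>k. \<bar>a - k * s\<bar> \<le> t)"
proof
  assume "near_wall s t a"
  then show "\<exists>k. \<bar>a - k * s\<bar> \<le> t"
    using div_mult_mod_eq[of "a + t" s] assms pos_mod_sign[of s "a + t"]
    by (intro exI[of _ "(a + t) div s"]) (simp only: near_wall_def, linarith)
next
  assume "\<exists>k. \<bar>a - k * s\<bar> \<le> t"
  then obtain k where "\<bar>a - k * s\<bar> \<le> t" by blast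
  then have "(a + t - k * s) mod s = a + t - k * s"
    using assms by (intro mod_pos_pos_trivial) auto
  then have "(a + t) mod s = a + t - k * s"
    by (simp add: mod_diff_eq[symmetric])
  then show "near_wall s t a" using \<open>\<bar>a - k * s\<bar> \<le> t\<close> by (simp add: near_wall_def)
qed

lemma wall_label_near:
  assumes "0 \<le> t" "0 < s" "2 * t + r < s" "near_wall s t a" "near_wall s t b" "\<bar>a - b\<bar> \<le> r"
  shows "wall_label s t a = wall_label s t b"
proof -
  have "\<bar>(a + t) div s - (b + t) div s\<bar> * s < s"
  proof -
    have "\<bar>(a + t) div s - (b + t) div s\<bar> * s = \<bar>(a + t) div s * s - (b + t) div s * s\<bar>"
      using assms(2) by (simp add: abs_mult left_diff_distrib[symmetric])
    also have "\<dots> < s"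
      using assms div_mult_mod_eq[of "a + t" s] div_mult_mod_eq[of "b + t" s]
        pos_mod_sign[of s "a + t"] pos_mod_sign[of s "b + t"] unfolding near_wall_def by (smt (verit))
    finally show ?thesis .
  qed
  then have "(a + t) div s = (b + t) div s" using assms(2) by (smt (verit) mult_less_cancel_right2)
  then show ?thesis using assms by (simp add: wall_label_def)
qed

lemma wall_label_far:
  assumes "0 \<le> t" "0 < s" "2 * t < s" "r \<le> t" "\<not> near_wall s t a" "\<not> near_wall s t b" "\<bar>a - b\<bar> \<le> r"
  shows "a div s = b div s"
proof -
  have *: "x div s = y div s" if "x \<le> y" "\<not> near_wall s t x" "y - x \<le> r" for x y
  proof (rule ccontr)
    assume "x div s \<noteq> y div s"
    then have "x div s < y div s" using zdiv_mono1[OF that(1) assms(2)] by simp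
    then have "(x div s + 1) * s \<le> y div s * s"
      using assms(2) by (intro mult_right_mono) auto
    then have "(x div s + 1) * s \<le> y"
      using div_mult_mod_eq[of y s] pos_mod_sign[of s y] assms(2) by linarith
    moreover have "x < (x div s + 1) * s"
      using div_mult_mod_eq[of x s] pos_mod_bound[OF assms(2), of x] by (simp only: ring_distribs)
    ultimately have "\<bar>x - (x div s + 1) * s\<bar> \<le> t" using that assms by auto
    then show False using that near_wall_iff[of t s x] assms by blast
  qed
  show ?thesis
  proof (cases "a \<le> b")
    case True
    then show ?thesis using *[of a b] assms(5,7) by simp
  next
    case False
    then show ?thesis using *[of b a] assms(6,7) by simp
  qed
qed

lemma near_wall_enlarge:
  assumes "0 \<le> t" "0 \<le> r" "2 * (t + r) < s" "near_wall s t a" "\<bar>a - b\<bar> \<le> r"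
  shows "near_wall s (t + r) b"
proof -
  obtain k where "\<bar>a - k * s\<bar> \<le> t" using near_wall_iff[of t s a] assms by auto
  then have "\<bar>b - k * s\<bar> \<le> t + r" using assms by linarith
  then show ?thesis using near_wall_iff[of "t + r" s b] assms by auto
qed

lemma d1_coord: "i < n \<Longrightarrow> real_of_int \<bar>v i - w i\<bar> \<le> d1 n v w"
  unfolding d1_def norm1_def of_int_le_iff
  using member_le_sum[of i "{..<n}" "\<lambda>i. \<bar>w i - v i\<bar>"] by (simp add: abs_minus_commute)

lemma d1_le: "(\<And>i. i < n \<Longrightarrow> \<bar>v i - w i\<bar> \<le> B) \<Longrightarrow> d1 n v w \<le> real_of_int (int n * B)"
  unfolding d1_def norm1_def of_int_le_iff
  using sum_bounded_above[of "{..<n}" "\<lambda>i. \<bar>w i - v i\<bar>" B] by (simp add: abs_minus_commute)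

text \<open>The pieces of the \<open>i\<close>-th family are neighbourhoods of the \<open>i\<close>-dimensional faces of a
  cubical grid, with the neighbourhoods of all lower dimensional faces, taken at larger radii, removed.\<close>
lemma asdim_le_Zvec: "asdim_le (Zvec n) (d1 n) n"
  unfolding asdim_le_def
proof (intro allI impI)
  fix r0 :: real assume "r0 > 0"
  define r where "r = \<lceil>r0\<rceil>"
  have r: "r > 0" "r0 \<le> real_of_int r" using \<open>r0 > 0\<close> by (auto simp: r_def)
  \<comment> \<open>The radii decrease in steps of \<open>r\<close> down to \<open>t n = r\<close>,
    so a point within \<open>r\<close> of one that is near a wall at radius \<open>t (Suc k)\<close>
    is near the same wall at radius \<open>t k\<close>. The mesh \<open>s\<close> keeps distinct
    walls apart even at radius \<open>t 0 + r\<close>.\<close>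
  define t where "t i = (int n - int i + 1) * r" for i :: nat
  define s where "s = 4 * (int n + 2) * r"
  have t: "0 \<le> t i" "r \<le> t i" "2 * (t i + r) < s" "2 * t i + r < s" "2 * t i < s" if "i \<le> n" for i
  proof -
    have "1 * r \<le> (int n - int i + 1) * r" using that r by (intro mult_right_mono) auto
    then show "0 \<le> t i" "r \<le> t i" using r by (auto simp: t_def)
    have "(int n - int i + 1) * r \<le> (int n + 1) * r" using r by (intro mult_right_mono) auto
    moreover have "0 \<le> int n * r" "0 \<le> int i * r" using r by simp_all
    ultimately show "2 * (t i + r) < s" "2 * t i + r < s" "2 * t i < s"
      using r unfolding t_def s_def by (simp_all only: ring_distribs)
  qed
  have s: "0 < s" using t(1,5)[of n] by simp
  have t_Suc: "t i = t (Suc i) + r" for i by (simp add: t_def ring_distribs)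
  define J where "J i x = {j. j < n \<and> near_wall s (t i) (x j)}" for i and x :: "nat \<Rightarrow> int"
  \<comment> \<open>Having \<open>n - i\<close> coordinates near walls means lying near an
    \<open>i\<close>-dimensional face; the least such \<open>i\<close> is taken, each dimension
    being tested at its own radius.\<close>
  define lev where "lev x = (LEAST i. n - i \<le> card (J i x))" for x
  have lev_ex: "n - n \<le> card (J n x)" for x by simp
  have lev: "n - lev x \<le> card (J (lev x) x)" "lev x \<le> n" for x
    unfolding lev_def
    by (rule LeastI[of "\<lambda>i. n - i \<le> card (J i x)", OF lev_ex],
        rule Least_le[of "\<lambda>i. n - i \<le> card (J i x)", OF lev_ex])
  have fin: "finite (J i x)" for i x by (simp add: J_def)
  define lab where "lab i x = (\<lambda>j. if j < n then wall_label s (t i) (x j) else (True, 0))"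
    for i and x :: "nat \<Rightarrow> int"
  define \<U> where "\<U> i = {{x \<in> Zvec n. lev x = i \<and> lab i x = c} | c. True}" for i
  \<comment> \<open>For \<open>i = Suc k\<close> both \<open>J i x\<close> and \<open>J i y\<close>
    are contained in \<open>J k y\<close>, whose radius is larger by \<open>r\<close>. Minimality of
    \<open>lev y\<close> leaves \<open>J k y\<close> at most \<open>n - i\<close> elements, so it
    coincides with \<open>J i y\<close>.\<close>
  have J_step: "J i x \<subseteq> J i y" if "lev x = i" "lev y = i" "d1 n x y \<le> r0" for i x y
  proof (cases i)
    case 0
    have "card (J 0 y) \<ge> n" using lev[of y] that 0 by simp
    moreover have "J 0 y \<subseteq> {..<n}" by (auto simp: J_def)
    ultimately have "J 0 y = {..<n}" by (intro card_seteq) auto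
    then show ?thesis using 0 by (auto simp: J_def)
  next
    case (Suc k)
    have close: "\<bar>x j - y j\<bar> \<le> r" if "j < n" for j
      using d1_coord[OF that, of x y] \<open>d1 n x y \<le> r0\<close> r by linarith
    have kn: "k < n" using lev[of y] that Suc by simp
    have sub: "J i x \<subseteq> J k y" "J i y \<subseteq> J k y"
      using near_wall_enlarge[of "t i" r s] t[of i] close kn r Suc t_Suc[of k]
      unfolding J_def by auto
    have "card (J k y) < n - k"
      using not_less_Least[of k "\<lambda>i. n - i \<le> card (J i y)"] that Suc by (simp add: lev_def)
    then have "card (J k y) \<le> card (J i y)" using lev[of y] that Suc by simp
    then have "J i y = J k y" using sub fin by (intro card_seteq) auto
    then show ?thesis using sub by simp
  qed
  show "\<exists>\<U> :: nat \<Rightarrow> (nat \<Rightarrow> int) set set. (\<forall>i\<le>n. \<forall>U\<in>\<U> i. U \<subseteq> Zvec n) \<and>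
      (\<exists>B. \<forall>i\<le>n. \<forall>U\<in>\<U> i. \<forall>x\<in>U. \<forall>y\<in>U. d1 n x y \<le> B) \<and>
      (\<forall>i\<le>n. \<forall>U\<in>\<U> i. \<forall>U'\<in>\<U> i. U \<noteq> U' \<longrightarrow> (\<forall>x\<in>U. \<forall>y\<in>U'. r0 < d1 n x y)) \<and>
      Zvec n \<subseteq> (\<Union>i\<le>n. \<Union>(\<U> i))"
  proof (intro exI[of _ \<U>] conjI)
    show "\<exists>B. \<forall>i\<le>n. \<forall>U\<in>\<U> i. \<forall>x\<in>U. \<forall>y\<in>U. d1 n x y \<le> B"
    proof (intro exI[of _ "real_of_int (int n * s)"] allI impI ballI)
      fix i U x y assume a: "i \<le> n" "U \<in> \<U> i" "x \<in> U" "y \<in> U"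
      then have l: "lab i x = lab i y" unfolding \<U>_def by auto
      have "\<bar>x j - y j\<bar> \<le> s" if "j < n" for j
        using wall_label_close[OF s t(5)[OF a(1)], of "x j" "y j"] fun_cong[OF l, of j] that
        by (auto simp: lab_def)
      then show "d1 n x y \<le> real_of_int (int n * s)" by (rule d1_le)
    qed
    show "\<forall>i\<le>n. \<forall>U\<in>\<U> i. \<forall>U'\<in>\<U> i. U \<noteq> U' \<longrightarrow> (\<forall>x\<in>U. \<forall>y\<in>U'. r0 < d1 n x y)"
    proof (intro allI impI ballI)
      fix i U U' x y assume a: "i \<le> n" "U \<in> \<U> i" "U' \<in> \<U> i" "U \<noteq> U'" "x \<in> U" "y \<in> U'"
      then have l: "lab i x \<noteq> lab i y" "lev x = i" "lev y = i" unfolding \<U>_def by auto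
      show "r0 < d1 n x y"
      proof (rule ccontr)
        assume "\<not> r0 < d1 n x y"
        then have d: "d1 n x y \<le> r0" by simp
        have dsym: "d1 n y x \<le> r0" using d by (simp add: d1_def norm1_def abs_minus_commute)
        have JJ: "J i x = J i y" using J_step[OF l(2,3) d] J_step[OF l(3,2) dsym] by blast
        have "wall_label s (t i) (x j) = wall_label s (t i) (y j)" if j: "j < n" for j
        proof -
          have c: "\<bar>x j - y j\<bar> \<le> r" using d1_coord[OF j, of x y] d r by linarith
          have n: "near_wall s (t i) (x j) \<longleftrightarrow> near_wall s (t i) (y j)"
            using JJ j unfolding J_def by blast
          show ?thesis
          proof (cases "near_wall s (t i) (x j)")
            case True
            with n have "near_wall s (t i) (y j)" by simp
            from wall_label_near[OF t(1)[OF a(1)] s t(4)[OF a(1)] True this c] show ?thesis .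
          next
            case False
            with n have F: "\<not> near_wall s (t i) (y j)" by simp
            from wall_label_far[OF t(1)[OF a(1)] s t(5)[OF a(1)] t(2)[OF a(1)] False F c]
            show ?thesis using False F by (simp add: wall_label_def)
          qed
        qed
        then have "lab i x = lab i y" by (auto simp: lab_def)
        then show False using l by simp
      qed
    qed
    show "Zvec n \<subseteq> (\<Union>i\<le>n. \<Union>(\<U> i))"
    proof
      fix x assume "x \<in> Zvec n"
      then have "x \<in> {y \<in> Zvec n. lev y = lev x \<and> lab (lev x) y = lab (lev x) x}" by simp
      then have "x \<in> \<Union>(\<U> (lev x))" unfolding \<U>_def by blast
      then show "x \<in> (\<Union>i\<le>n. \<Union>(\<U> i))" using lev by blast
    qed
  qed (auto simp: \<U>_def)
qed

text \<open>Kuhn's lemma: label a grid point in direction \<open>i\<close> by whether it lies near a member of the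
  \<open>i\<close>-th family that meets the far face. The small cube at which every label changes
  meets no member of any family.\<close>
lemma asdim_le_Zvec_lower:
  assumes "asdim_le (Zvec n) (d1 n) m"
  shows "n \<le> m"
proof (rule ccontr)
  assume "\<not> n \<le> m"
  then have mn: "m < n" by simp
  \<comment> \<open>The l1-diameter of a unit cube is n. At disjointness 2n, no grid point is within
    distance n of two members of one family.\<close>
  have "real (2 * n) > 0" using mn by simp
  from assms[unfolded asdim_le_def, rule_format, OF this]
  obtain \<U> :: "nat \<Rightarrow> (nat \<Rightarrow> int) set set" and B where
    U: "\<forall>i\<le>m. \<forall>U\<in>\<U> i. U \<subseteq> Zvec n" "\<forall>i\<le>m. \<forall>U\<in>\<U> i. \<forall>x\<in>U. \<forall>y\<in>U. d1 n x y \<le> B"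
    "\<forall>i\<le>m. \<forall>U\<in>\<U> i. \<forall>U'\<in>\<U> i. U \<noteq> U' \<longrightarrow> (\<forall>x\<in>U. \<forall>y\<in>U'. real (2 * n) < d1 n x y)"
    "Zvec n \<subseteq> (\<Union>i\<le>m. \<Union>(\<U> i))"
    by auto
  \<comment> \<open>The side of the grid exceeds the width B + 2n of a member thickened by n, which
    thus cannot reach from the face x i = 0 to the face x i = p.\<close>
  define p where "p = nat \<lceil>B\<rceil> + 2 * n + 1"
  have p: "real p > B + real (2 * n)" unfolding p_def by linarith
  define z where "z x = (\<lambda>i. if i < n then int (x i) else 0)" for x :: "nat \<Rightarrow> nat"
  have z: "z x \<in> Zvec n" for x by (simp add: z_def Zvec_def)
  define T where "T U = {x. \<exists>u\<in>U. d1 n u (z x) \<le> real n}" for U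
  \<comment> \<open>Directions beyond \<open>m\<close> have no family; there only the far face is
    labelled 1.\<close>
  define label where "label x i = (if x i = p \<or> (i \<le> m \<and> (\<exists>U\<in>\<U> i. x \<in> T U \<and> (\<exists>y\<in>T U. y i = p))) then 1 else 0::nat)"
    for x :: "nat \<Rightarrow> nat" and i
  have tri: "d1 n u w \<le> d1 n u v + d1 n v w" for u v w
  proof -
    have "(\<Sum>i<n. \<bar>w i - u i\<bar>) \<le> (\<Sum>i<n. \<bar>v i - u i\<bar> + \<bar>w i - v i\<bar>)"
      by (intro sum_mono) auto
    then show ?thesis
      unfolding d1_def norm1_def sum.distrib of_int_add[symmetric] of_int_le_iff .
  qed
  have sym: "d1 n u v = d1 n v u" for u v by (simp add: d1_def norm1_def abs_minus_commute)
  have width: "\<bar>real (x i) - real (y i)\<bar> \<le> B + real (2 * n)"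
    if T: "i \<le> m" "j < n" "U \<in> \<U> i" "x \<in> T U" "y \<in> T U" "i = j" for i j U and x y :: "nat \<Rightarrow> nat"
  proof -
    obtain u w where uw: "u \<in> U" "d1 n u (z x) \<le> real n" "w \<in> U" "d1 n w (z y) \<le> real n"
      using T unfolding T_def by blast
    have "d1 n u w \<le> B" using U(2) T uw by blast
    then have "d1 n (z x) (z y) \<le> B + real (2 * n)"
      using tri[of "z x" "z y" u] tri[of u "z y" w] uw sym[of u "z x"] by simp
    then show ?thesis using d1_coord[OF T(2), of "z x" "z y"] T by (simp add: z_def)
  qed
  have uniq: "U = U'" if T: "i \<le> m" "U \<in> \<U> i" "U' \<in> \<U> i" "x \<in> T U" "x \<in> T U'" for i U U' x
  proof (rule ccontr)
    assume "U \<noteq> U'"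
    obtain u w where uw: "u \<in> U" "d1 n u (z x) \<le> real n" "w \<in> U'" "d1 n w (z x) \<le> real n"
      using T unfolding T_def by blast
    then have "d1 n u w \<le> real (2 * n)" using tri[of u w "z x"] sym[of w "z x"] by simp
    then show False using U(3) T uw \<open>U \<noteq> U'\<close> by force
  qed
  obtain q where "\<forall>i<n. q i < p"
    and q: "\<forall>i<n. \<exists>r s. (\<forall>j<n. q j \<le> r j \<and> r j \<le> q j + 1) \<and>
      (\<forall>j<n. q j \<le> s j \<and> s j \<le> q j + 1) \<and> label r i \<noteq> label s i"
  proof (rule kuhn_lemma[of p n label])
    show "0 < p" by (simp add: p_def)
    show "\<forall>x. (\<forall>i<n. x i \<le> p) \<longrightarrow> (\<forall>i<n. label x i = 0 \<or> label x i = 1)"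
      by (auto simp: label_def)
    show "\<forall>x. (\<forall>i<n. x i \<le> p) \<longrightarrow> (\<forall>i<n. x i = p \<longrightarrow> label x i = 1)"
      by (auto simp: label_def)
    show "\<forall>x. (\<forall>i<n. x i \<le> p) \<longrightarrow> (\<forall>i<n. x i = 0 \<longrightarrow> label x i = 0)"
    proof (intro allI impI)
      fix x :: "nat \<Rightarrow> nat" and i assume xi: "i < n" "x i = 0"
      have False if "i \<le> m" "U \<in> \<U> i" "x \<in> T U" "y \<in> T U" "y i = p" for U y
        using width[OF that(1) xi(1) that(2,3,4)] that xi p by simp
      moreover have "0 \<noteq> p" by (simp add: p_def)
      ultimately show "label x i = 0" using xi by (auto simp: label_def)
    qed
  qed
  obtain i U1 where i: "i \<le> m" "U1 \<in> \<U> i" "z q \<in> U1" using U(4) z[of q] by blast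
  \<comment> \<open>Every vertex of the cube at \<open>q\<close> is within n of \<open>U1\<close>,
    and of no other member of the \<open>i\<close>-th family; so the label in direction
    \<open>i\<close> depends on \<open>U1\<close> alone and cannot change on the cube.\<close>
  have cube: "label r i = (if \<exists>y\<in>T U1. y i = p then 1 else 0)"
    if r: "\<forall>j<n. q j \<le> r j \<and> r j \<le> q j + 1" for r
  proof -
    have "d1 n (z q) (z r) \<le> real_of_int (int n * 1)"
      using r by (intro d1_le) (auto simp: z_def)
    then have rT: "r \<in> T U1" using i unfolding T_def by auto
    then show ?thesis using i uniq[OF i(1) i(2)] unfolding label_def by auto
  qed
  moreover have "i < n" using i mn by simp
  ultimately show False using q by metis
qed

lemma asdim_ge_of_coarse_embedding:
  assumes "f ` Zvec n \<subseteq> A" "controlled_on (Zvec n) (d1 n) d f" "coarsely_proper_on (Zvec n) (d1 n) d f"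
  shows "enat n \<le> asdim A d"
  using asdim_le_pullback[OF _ assms] asdim_le_Zvec_lower by (intro asdim_lower) blast

section \<open>Quasimorphisms and stable commutator length\<close>

definition hom_limit :: "(int \<Rightarrow> real) \<Rightarrow> real" where
  "hom_limit a = lim (\<lambda>n. a (int n) / real n)"

lemma hom_limit_eqI:
  assumes "\<And>n. \<bar>a n - of_int n * A\<bar> \<le> D"
  shows "hom_limit a = A"
proof -
  have "(\<lambda>n. a (int n) / real n) \<longlonglongrightarrow> A"
  proof (rule LIMSEQ_I)
    fix e :: real assume e: "e > 0"
    obtain k :: nat where k: "real k > \<bar>D\<bar> / e" using reals_Archimedean2 by blast
    show "\<exists>no. \<forall>n\<ge>no. norm (a (int n) / real n - A) < e"
    proof (intro exI[of _ "Suc k"] allI impI)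
      fix n assume n: "Suc k \<le> n"
      then have "\<bar>D\<bar> / e < real n" using k by linarith
      then have "\<bar>D\<bar> < real n * e" using e by (simp add: field_simps)
      then have "\<bar>a (int n) - real n * A\<bar> < real n * e" using assms[of "int n"] by simp
      moreover have "a (int n) / real n - A = (a (int n) - real n * A) / real n"
        using n by (simp add: field_simps)
      ultimately show "norm (a (int n) / real n - A) < e"
        using n by (simp add: abs_div pos_divide_less_eq mult.commute)
    qed
  qed
  then show ?thesis unfolding hom_limit_def by (rule limI)
qed

text \<open>The quotients at \<open>k * m\<close> and at \<open>m\<close> differ by at most D/m, so
  they form a Cauchy sequence, and letting \<open>k\<close> grow bounds the distance of the quotient
  at \<open>m\<close> to the limit. Negative arguments, which the limit does not see, need an extra
  argument to get the same constant.\<close>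

lemma hom_limit_close:
  assumes D: "\<And>m n. \<bar>a (m + n) - a m - a n\<bar> \<le> D"
  shows "\<bar>a n - of_int n * hom_limit a\<bar> \<le> D"
proof -
  have mul: "\<bar>a (int k * n) - real k * a n\<bar> \<le> real k * D" if "k > 0" for k n
    using that
  proof (induction k rule: nat_induct_non_zero)
    case 1
    then show ?case using D[of 0 0] by simp
  next
    case (Suc k)
    have "a (int (Suc k) * n) = a (int k * n + n)" by (simp add: algebra_simps)
    then show ?case using D[of "int k * n" n] Suc by (simp add: algebra_simps)
  qed
  let ?s = "\<lambda>n. a (int n) / real n"
  have D0: "0 \<le> D" using D[of 0 0] by linarith
  have diff: "\<bar>?s (k * m) - ?s m\<bar> \<le> D / real m" if "k > 0" "m > 0" for k m
  proof -
    have "?s (k * m) - ?s m = (a (int k * int m) - real k * a (int m)) / (real k * real m)"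
      using that by (simp add: field_simps)
    then show ?thesis using mul[OF that(1), of "int m"] that
      by (simp add: abs_div field_simps)
  qed
  have "Cauchy ?s"
  proof (rule metric_CauchyI)
    fix e :: real assume e: "e > 0"
    obtain k :: nat where k: "real k > 2 * D / e" using reals_Archimedean2 by blast
    have small: "D / real m < e / 2" if "m \<ge> Suc k" for m
    proof -
      have "2 * D / e < real m" using k that by linarith
      then show ?thesis using e that by (simp add: field_simps)
    qed
    show "\<exists>M. \<forall>m\<ge>M. \<forall>n\<ge>M. dist (?s m) (?s n) < e"
    proof (intro exI[of _ "Suc k"] allI impI)
      fix m n assume mn: "Suc k \<le> m" "Suc k \<le> n"
      then have "\<bar>?s (n * m) - ?s m\<bar> \<le> D / real m" "\<bar>?s (m * n) - ?s n\<bar> \<le> D / real n"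
        by (intro diff; simp)+
      then have "\<bar>?s m - ?s n\<bar> \<le> D / real m + D / real n"
        by (simp only: mult.commute[of n m])
      then show "dist (?s m) (?s n) < e"
        using small[OF mn(1)] small[OF mn(2)] unfolding dist_real_def by linarith
    qed
  qed
  then have lim: "?s \<longlonglongrightarrow> hom_limit a"
    unfolding hom_limit_def by (simp add: Cauchy_convergent_iff convergent_LIMSEQ_iff)
  have pos: "\<bar>a (int m) - real m * hom_limit a\<bar> \<le> D" if m: "m > 0" for m
  proof -
    have "(\<lambda>k. ?s (k * m)) \<longlonglongrightarrow> hom_limit a"
      using LIMSEQ_subseq_LIMSEQ[OF lim, of "\<lambda>k. k * m"] m by (simp add: strict_mono_def o_def)
    then have "(\<lambda>k. \<bar>?s (k * m) - ?s m\<bar>) \<longlonglongrightarrow> \<bar>hom_limit a - ?s m\<bar>"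
      by (intro tendsto_intros)
    then have "\<bar>hom_limit a - ?s m\<bar> \<le> D / real m"
      by (rule LIMSEQ_le_const2) (use diff m in \<open>auto intro!: exI[of _ 1]\<close>)
    then have "real m * \<bar>hom_limit a - ?s m\<bar> \<le> D" using m by (simp add: field_simps)
    moreover have "real m * \<bar>hom_limit a - ?s m\<bar> = \<bar>real m * (hom_limit a - ?s m)\<bar>"
      by (simp add: abs_mult)
    moreover have "real m * (hom_limit a - ?s m) = real m * hom_limit a - a (int m)"
      using m by (simp add: field_simps)
    ultimately show ?thesis by (simp add: abs_minus_commute)
  qed
  have pos2: "\<bar>a (int m) - real m * hom_limit a\<bar> \<le> D" for m
    using pos[of m] D[of 0 0] by (cases "m = 0") auto
  \<comment> \<open>For negative \<open>m\<close> three errors add up: the defect of m + (-m), the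
    value at 0, and the bound at -m.\<close>
  have crude: "\<bar>a m - of_int m * hom_limit a\<bar> \<le> 3 * D" for m
  proof (cases "m \<ge> 0")
    case True
    then show ?thesis using pos2[of "nat m"] D0 by simp
  next
    case False
    then show ?thesis using D[of m "- m"] D[of 0 0] pos2[of "nat (- m)"] by simp
  qed
  \<comment> \<open>Applied at \<open>k * n\<close>, the error 3D is fixed while the deviation
    \<open>b\<close> is multiplied by \<open>k\<close>; for large \<open>k\<close> only the constant
    D survives.\<close>
  show ?thesis
  proof (rule ccontr)
    define b where "b = a n - of_int n * hom_limit a"
    assume "\<not> ?thesis"
    then have e: "\<bar>b\<bar> - D > 0" by (simp add: b_def)
    obtain k where k: "real k > 3 * D / (\<bar>b\<bar> - D)" using reals_Archimedean2 by blast
    then have *: "3 * D < real k * (\<bar>b\<bar> - D)" using e by (simp add: field_simps)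
    have "3 * D / (\<bar>b\<bar> - D) \<ge> 0" using D0 e by simp
    then have k0: "k > 0" using k by (cases k) auto
    have "real k * b = real k * a n - of_int (int k * n) * hom_limit a"
      unfolding b_def by (simp add: algebra_simps)
    then have "\<bar>real k * b\<bar> \<le> real k * D + 3 * D"
      using mul[OF k0, of n] crude[of "int k * n"] by linarith
    moreover have "real k * \<bar>b\<bar> = \<bar>real k * b\<bar>" by (simp add: abs_mult)
    ultimately show False using * by (simp add: right_diff_distrib)
  qed
qed

text \<open>Fekete's lemma: the limit is the infimum of the quotients, which gives both its
  existence and the bound by every single quotient.\<close>

lemma subadditive_limit:
  fixes a :: "nat \<Rightarrow> real"
  assumes sub: "\<And>m n. a (m + n) \<le> a m + a n" and nonneg: "\<And>n. 0 \<le> a n"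
  shows "convergent (\<lambda>n. a n / real n)" "0 < n \<Longrightarrow> lim (\<lambda>n. a n / real n) \<le> a n / real n"
proof -
  define W where "W = {a n / real n | n. 0 < n}"
  have W: "W \<noteq> {}" "bdd_below W"
    unfolding W_def by (auto intro!: bdd_belowI[of _ 0] simp: nonneg)
  have low: "Inf W \<le> a n / real n" if "0 < n" for n
    using W that by (intro cInf_lower) (auto simp: W_def)
  have mul: "a (q * m) \<le> real q * a m" if "q > 0" for q m
    using that
  proof (induction q rule: nat_induct_non_zero)
    case (Suc q)
    have "a (Suc q * m) = a (q * m + m)" by (simp add: add.commute)
    then show ?case using sub[of "q * m" m] Suc by (simp add: algebra_simps)
  qed simp
  have "(\<lambda>n. a n / real n) \<longlonglongrightarrow> Inf W"
  proof (rule LIMSEQ_I)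
    fix e :: real assume e: "e > 0"
    then obtain w where "w \<in> W" "w < Inf W + e / 2"
      using cInf_lessD[OF W(1), of "Inf W + e / 2"] by auto
    then obtain m where m: "0 < m" "a m / real m < Inf W + e / 2" unfolding W_def by blast
    \<comment> \<open>A common bound for the values at all remainders modulo \<open>m\<close>,
      including 0.\<close>
    define C where "C = (\<Sum>r<m. a r) + a m"
    have C: "a r \<le> C" if "r < m" for r
      using member_le_sum[of r "{..<m}" a] that nonneg unfolding C_def
      by (simp add: add_increasing2)
    have C0: "0 \<le> C" unfolding C_def by (simp add: sum_nonneg nonneg)
    obtain k :: nat where k: "real k > 2 * C / e" using reals_Archimedean2 by blast
    show "\<exists>no. \<forall>n\<ge>no. norm (a n / real n - Inf W) < e"
    proof (intro exI[of _ "Suc k + m"] allI impI)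
      fix n assume n: "Suc k + m \<le> n"
      define q where "q = n div m"
      define r where "r = n mod m"
      have qr: "n = q * m + r" "r < m" "q > 0"
        using m n by (auto simp: q_def r_def div_greater_zero_iff)
      have "a n \<le> real q * a m + C"
        using sub[of "q * m" r] mul[OF qr(3), of m] C[OF qr(2)] qr(1) by simp
      moreover have "real q * real m \<le> real n"
        using qr(1) by (metis le_add1 of_nat_le_iff of_nat_mult)
      then have "real q * a m \<le> real n * (a m / real m)"
        using m nonneg[of m] mult_right_mono[of "real q * real m" "real n" "a m / real m"]
        by (simp add: field_simps)
      ultimately have "a n \<le> real n * (a m / real m) + C" by linarith
      moreover have "2 * C / e < real n" using k n by linarith
      then have "C < real n * (e / 2)" using e by (simp add: field_simps)
      moreover have "real n * (a m / real m) < real n * (Inf W + e / 2)"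
        using m n by (intro mult_strict_left_mono) auto
      ultimately have "a n < real n * (Inf W + e)" by (simp add: algebra_simps)
      then have "a n / real n < Inf W + e" using n by (simp add: field_simps)
      moreover have "Inf W \<le> a n / real n" using low n by simp
      ultimately show "norm (a n / real n - Inf W) < e" by simp
    qed
  qed
  note lim = this
  show "convergent (\<lambda>n. a n / real n)" using lim by (auto simp: convergent_def)
  show "0 < n \<Longrightarrow> lim (\<lambda>n. a n / real n) \<le> a n / real n" using low limI[OF lim] by simp
qed

text \<open>\<open>D\<close> is some upper bound of the defect, not the supremum; keeping it
  explicit makes the later estimates uniform.\<close>

definition qmorph :: "('a,'b) monoid_scheme \<Rightarrow> 'a set \<Rightarrow> real \<Rightarrow> ('a \<Rightarrow> real) \<Rightarrow> bool" where
  "qmorph G M D \<phi> \<longleftrightarrow> \<phi> \<in> inv_hqm G M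
     \<and> (\<forall>x\<in>M. \<forall>y\<in>M. \<bar>\<phi> (x \<otimes>\<^bsub>G\<^esub> y) - \<phi> x - \<phi> y\<bar> \<le> D)"

lemma qmorph_ex: "\<phi> \<in> inv_hqm G M \<Longrightarrow> \<exists>D. qmorph G M D \<phi>"
  unfolding qmorph_def inv_hqm_def by auto

lemma qmorph_add:
  assumes "qmorph G M D \<phi>" "qmorph G M D' \<psi>"
  shows "qmorph G M (D + \<bar>c\<bar> * D') (\<lambda>x. \<phi> x + c * \<psi> x)"
proof -
  have *: "\<bar>(\<phi> (x \<otimes>\<^bsub>G\<^esub> y) + c * \<psi> (x \<otimes>\<^bsub>G\<^esub> y)) - (\<phi> x + c * \<psi> x) - (\<phi> y + c * \<psi> y)\<bar> \<le> D + \<bar>c\<bar> * D'"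
    if "x \<in> M" "y \<in> M" for x y
  proof -
    have "\<bar>c * (\<psi> (x \<otimes>\<^bsub>G\<^esub> y) - \<psi> x - \<psi> y)\<bar> \<le> \<bar>c\<bar> * D'"
      using assms that unfolding qmorph_def abs_mult by (intro mult_left_mono) auto
    moreover have "\<bar>\<phi> (x \<otimes>\<^bsub>G\<^esub> y) - \<phi> x - \<phi> y\<bar> \<le> D" using assms that unfolding qmorph_def by blast
    ultimately show ?thesis unfolding right_diff_distrib by linarith
  qed
  then show ?thesis
    using assms unfolding qmorph_def inv_hqm_def by (auto simp: algebra_simps)
qed

lemma qmorph_zero: "qmorph G M 0 (\<lambda>x. 0)"
  by (auto simp: qmorph_def inv_hqm_def intro: exI[of _ 0])

lemma qmorph_sum:
  assumes "finite I" "\<And>j. j \<in> I \<Longrightarrow> qmorph G M (D j) (\<nu> j)"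
  shows "qmorph G M (\<Sum>j\<in>I. \<bar>c j\<bar> * D j) (\<lambda>x. \<Sum>j\<in>I. c j * \<nu> j x)"
  using assms
proof (induction I rule: finite_induct)
  case (insert i I)
  then have "qmorph G M ((\<Sum>j\<in>I. \<bar>c j\<bar> * D j) + \<bar>c i\<bar> * D i)
      (\<lambda>x. (\<Sum>j\<in>I. c j * \<nu> j x) + c i * \<nu> i x)"
    by (intro qmorph_add) auto
  then show ?case using insert by (simp add: add.commute)
qed (simp add: qmorph_zero)

text \<open>The ball of radius \<open>k\<close> in the free abelian group on \<open>M\<close>.
  Letters are charged besides the commutators of the product because a class determines a word only
  up to reordering, and that may cost one commutator per letter.\<close>

definition comm_words :: "('a,'b) monoid_scheme \<Rightarrow> 'a set \<Rightarrow> nat \<Rightarrow> ('a \<Rightarrow>\<^sub>0 int) set" where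
  "comm_words G M k = {word_count u | u c.
     fst ` set u \<subseteq> M \<and> word_prod G u \<in> comm_prods G M c \<and> length u + c \<le> k}"

section \<open>Quasimorphisms against stable commutator length\<close>

context normal
begin

lemma cl_pow_subadditive:
  assumes "y \<in> comm_sub G H"
  shows "real (cl G H (y [^] (m + n :: nat))) \<le> real (cl G H (y [^] m)) + real (cl G H (y [^] n))"
proof -
  have "y [^] (m + n) = y [^] m \<otimes> y [^] n" using assms by (simp add: nat_pow_mult)
  then have "cl G H (y [^] (m + n)) \<le> cl G H (y [^] m) + cl G H (y [^] n)"
    using cl_le[OF comm_prods_add[OF cl_mem cl_mem]] assms by simp
  then show ?thesis by simp
qed

lemma scl_le:
  assumes "y \<in> comm_sub G H" "0 < n"
  shows "real n * scl G H y \<le> real (cl G H (y [^] n))"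
  using subadditive_limit(2)[OF cl_pow_subadditive[OF assms(1)], of n] assms(2)
  unfolding scl_def by (simp add: field_simps)

lemma scl_le_cl: "y \<in> comm_sub G H \<Longrightarrow> scl G H y \<le> real (cl G H y)"
  using scl_le[of y 1] by simp

lemma scl_lim:
  assumes "y \<in> comm_sub G H"
  shows "(\<lambda>n. real (cl G H (y [^] n)) / real n) \<longlonglongrightarrow> scl G H y"
  using subadditive_limit(1)[OF cl_pow_subadditive[OF assms]]
  unfolding scl_def by (simp add: convergent_LIMSEQ_iff)

lemma scl_nonneg: "y \<in> comm_sub G H \<Longrightarrow> 0 \<le> scl G H y"
  using LIMSEQ_le_const[OF scl_lim, of y 0] by auto

lemma qmorph_defect:
  "qmorph G H D \<phi> \<Longrightarrow> x \<in> H \<Longrightarrow> y \<in> H \<Longrightarrow> \<bar>\<phi> (x \<otimes> y) - \<phi> x - \<phi> y\<bar> \<le> D"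
  unfolding qmorph_def by blast

lemma qmorph_defect_nonneg: "qmorph G H D \<phi> \<Longrightarrow> 0 \<le> D"
  using qmorph_defect[of D \<phi> \<one> \<one>] by simp

lemma qmorph_int_pow: "qmorph G H D \<phi> \<Longrightarrow> x \<in> H \<Longrightarrow> \<phi> (x [^] (n::int)) = of_int n * \<phi> x"
  unfolding qmorph_def inv_hqm_def by blast

lemma qmorph_pow: "qmorph G H D \<phi> \<Longrightarrow> x \<in> H \<Longrightarrow> \<phi> (x [^] (n::nat)) = real n * \<phi> x"
  using qmorph_int_pow[of D \<phi> x "int n"] by (simp add: int_pow_int)

lemma qmorph_one: "qmorph G H D \<phi> \<Longrightarrow> \<phi> \<one> = 0"
  using qmorph_int_pow[of D \<phi> \<one> 0] by simp

lemma qmorph_inv: "qmorph G H D \<phi> \<Longrightarrow> x \<in> H \<Longrightarrow> \<phi> (inv x) = - \<phi> x"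
  using qmorph_int_pow[of D \<phi> x "-1"] by (simp add: int_pow_neg)

lemma qmorph_conj: "qmorph G H D \<phi> \<Longrightarrow> g \<in> carrier G \<Longrightarrow> x \<in> H \<Longrightarrow> \<phi> (g \<otimes> x \<otimes> inv g) = \<phi> x"
  unfolding qmorph_def inv_hqm_def by blast

lemma qmorph_simple_comms:
  assumes "qmorph G H D \<phi>" "c \<in> simple_comms G H"
  shows "\<bar>\<phi> c\<bar> \<le> D"
proof -
  obtain g x where "g \<in> carrier G" "x \<in> H" "c = (g \<otimes> x \<otimes> inv g) \<otimes> inv x"
    using assms(2) unfolding simple_comms_def commutator_def by auto
  then show ?thesis
    using qmorph_defect[OF assms(1), of "g \<otimes> x \<otimes> inv g" "inv x"]
      qmorph_conj[OF assms(1)] qmorph_inv[OF assms(1)] by simp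
qed

lemma qmorph_comm_prods:
  assumes "qmorph G H D \<phi>" "y \<in> comm_prods G H k"
  shows "\<bar>\<phi> y\<bar> \<le> 2 * real k * D"
  using assms(2)
proof (induction k arbitrary: y)
  case 0
  then show ?case using qmorph_one[OF assms(1)] by (simp add: comm_prods_0)
next
  case (Suc k)
  obtain c z where cz: "c \<in> simple_comms G H" "z \<in> comm_prods G H k" "y = c \<otimes> z"
    using comm_prods_Suc[OF Suc.prems] by blast
  have "\<bar>\<phi> (c \<otimes> z) - \<phi> c - \<phi> z\<bar> \<le> D"
    using cz simple_comms_subset comm_prods_subset by (intro qmorph_defect[OF assms(1)]) auto
  then show ?case
    using qmorph_simple_comms[OF assms(1) cz(1)] Suc.IH[OF cz(2)] cz(3)
    by (simp add: algebra_simps)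
qed

text \<open>The easy half of Bavard's duality: a product of \<open>k\<close> simple commutators has
  value at most 2kD, one D for each commutator and one for each multiplication. Applied to powers of
  \<open>y\<close>, this turns into \<open>scl\<close> by homogeneity.\<close>

lemma qmorph_scl:
  assumes "qmorph G H D \<phi>" "y \<in> comm_sub G H"
  shows "\<bar>\<phi> y\<bar> \<le> 2 * D * scl G H y"
proof (rule LIMSEQ_le_const)
  show "(\<lambda>n. 2 * D * (real (cl G H (y [^] n)) / real n)) \<longlonglongrightarrow> 2 * D * scl G H y"
    using scl_lim[OF assms(2)] by (intro tendsto_intros)
  show "\<exists>N. \<forall>n\<ge>N. \<bar>\<phi> y\<bar> \<le> 2 * D * (real (cl G H (y [^] n)) / real n)"
  proof (intro exI[of _ 1] allI impI)
    fix n :: nat assume n: "1 \<le> n"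
    have "\<bar>\<phi> (y [^] n)\<bar> \<le> 2 * real (cl G H (y [^] n)) * D"
      using assms by (intro qmorph_comm_prods cl_mem) auto
    moreover have "\<phi> (y [^] n) = real n * \<phi> y"
      using assms comm_sub_subset by (intro qmorph_pow) auto
    ultimately show "\<bar>\<phi> y\<bar> \<le> 2 * D * (real (cl G H (y [^] n)) / real n)"
      using n by (simp add: abs_mult field_simps)
  qed
qed

text \<open>Homogeneity makes powers free of error, so the error depends on the number of letters
  and not on the exponents.\<close>

lemma qmorph_word:
  assumes "qmorph G H D \<phi>" "word_over H w"
  shows "\<bar>\<phi> (word_prod G w) - word_val \<phi> w\<bar> \<le> D * real (length w)"
  using assms(2)
proof (induction w rule: word_count.induct)
  case 1
  then show ?case using qmorph_one[OF assms(1)] by (simp add: word_val_Nil)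
next
  case (2 x n w)
  then have "\<bar>\<phi> (x [^] n \<otimes> word_prod G w) - \<phi> (x [^] n) - \<phi> (word_prod G w)\<bar> \<le> D"
    by (intro qmorph_defect[OF assms(1)]) (auto simp: word_prod_mem)
  then show ?case using 2 qmorph_int_pow[OF assms(1), of x n]
    by (simp add: word_val_Cons ring_distribs)
qed

text \<open>Stabilization moves each value by at most D, whence the defect D + 3D. The last
  conclusion is what makes extensions exact and not just approximate: where \<open>\<psi>\<close> is
  already homogeneous, nothing changes.\<close>

lemma homogenization:
  assumes D1: "\<And>x y. x \<in> H \<Longrightarrow> y \<in> H \<Longrightarrow> \<bar>\<psi> (x \<otimes> y) - \<psi> x - \<psi> y\<bar> \<le> D"
    and D2: "\<And>g x. g \<in> carrier G \<Longrightarrow> x \<in> H \<Longrightarrow> \<bar>\<psi> (g \<otimes> x \<otimes> inv g) - \<psi> x\<bar> \<le> D"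
  obtains \<phi> where "qmorph G H (4 * D) \<phi>" "\<And>x. x \<in> H \<Longrightarrow> \<bar>\<phi> x - \<psi> x\<bar> \<le> D"
    "\<And>x. x \<in> H \<Longrightarrow> (\<And>n::int. \<psi> (x [^] n) = of_int n * \<psi> x) \<Longrightarrow> \<phi> x = \<psi> x"
proof -
  define \<phi> where "\<phi> x = (if x \<in> H then hom_limit (\<lambda>n. \<psi> (x [^] n)) else 0)" for x
  have close: "\<bar>\<psi> (x [^] n) - of_int n * \<phi> x\<bar> \<le> D" if "x \<in> H" for x and n :: int
    using hom_limit_close[of "\<lambda>n. \<psi> (x [^] n)" D n] D1 that
    by (simp add: \<phi>_def int_pow_mult)
  have close1: "\<bar>\<phi> x - \<psi> x\<bar> \<le> D" if "x \<in> H" for x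
    using close[OF that, of 1] that by (simp add: abs_minus_commute)
  have pow: "\<phi> (x [^] k) = of_int k * \<phi> x" if "x \<in> H" for x and k :: int
  proof -
    have "hom_limit (\<lambda>n. \<psi> ((x [^] k) [^] n)) = of_int k * \<phi> x"
    proof (rule hom_limit_eqI)
      fix n
      show "\<bar>\<psi> ((x [^] k) [^] n) - of_int n * (of_int k * \<phi> x)\<bar> \<le> D"
        using close[OF that, of "k * n"] that by (simp add: int_pow_pow mult_ac)
    qed
    then show ?thesis using that by (simp add: \<phi>_def)
  qed
  have conj_pow: "(g \<otimes> x \<otimes> inv g) [^] n = g \<otimes> x [^] n \<otimes> inv g"
    if "g \<in> carrier G" "x \<in> H" for g x and n :: int
  proof -
    have "(\<lambda>x. g \<otimes> x \<otimes> inv g) \<in> hom G G"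
      using that by (auto simp: hom_def m_assoc)
    then show ?thesis using hom_int_pow[of "\<lambda>x. g \<otimes> x \<otimes> inv g" G G x n] that is_group by simp
  qed
  have conj: "\<phi> (g \<otimes> x \<otimes> inv g) = \<phi> x" if "g \<in> carrier G" "x \<in> H" for g x
  proof -
    have "hom_limit (\<lambda>n. \<psi> ((g \<otimes> x \<otimes> inv g) [^] n)) = \<phi> x"
    proof (rule hom_limit_eqI)
      fix n
      show "\<bar>\<psi> ((g \<otimes> x \<otimes> inv g) [^] n) - of_int n * \<phi> x\<bar> \<le> 2 * D"
        using close[OF that(2), of n] D2[OF that(1), of "x [^] n"] that by (simp add: conj_pow)
    qed
    then show ?thesis using that by (simp add: \<phi>_def)
  qed
  have defect: "\<bar>\<phi> (x \<otimes> y) - \<phi> x - \<phi> y\<bar> \<le> 4 * D" if "x \<in> H" "y \<in> H" for x y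
    using close1[of "x \<otimes> y"] close1[of x] close1[of y] D1[of x y] that m_closed by fastforce
  have zero: "\<phi> x = 0" if "x \<notin> H" for x using that by (simp add: \<phi>_def)
  have "qmorph G H (4 * D) \<phi>"
    unfolding qmorph_def inv_hqm_def using pow conj defect zero by blast
  moreover have "\<phi> x = \<psi> x" if "x \<in> H" "\<And>n::int. \<psi> (x [^] n) = of_int n * \<psi> x" for x
  proof -
    have "hom_limit (\<lambda>n. \<psi> (x [^] n)) = \<psi> x" by (rule hom_limit_eqI[where D=0]) (simp add: that)
    then show ?thesis using that by (simp add: \<phi>_def)
  qed
  ultimately show thesis using that close1 by blast
qed

lemma comm_wordsI:
  "word_over H u \<Longrightarrow> word_prod G u \<in> comm_prods G H c \<Longrightarrow> length u + c \<le> k \<Longrightarrow>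
    word_count u \<in> comm_words G H k"
  unfolding comm_words_def by blast

lemma zero_comm_words: "0 \<in> comm_words G H 0"
  using comm_wordsI[of "[]" 0 0] by (simp add: comm_prods_0)

lemma comm_words_add:
  assumes "v \<in> comm_words G H i" "w \<in> comm_words G H j"
  shows "v + w \<in> comm_words G H (i + j)"
proof -
  obtain u c u' c' where
    "word_over H u" "word_prod G u \<in> comm_prods G H c" "length u + c \<le> i" "v = word_count u"
    "word_over H u'" "word_prod G u' \<in> comm_prods G H c'" "length u' + c' \<le> j" "w = word_count u'"
    using assms unfolding comm_words_def by blast
  then show ?thesis
    using comm_wordsI[of "u @ u'" "c + c'" "i + j"] comm_prods_add
    by (simp add: word_count_append word_prod_append word_over_carrier image_Un)
qed

lemma comm_words_minus:
  assumes "v \<in> comm_words G H i"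
  shows "- v \<in> comm_words G H i"
proof -
  obtain u c where
    "word_over H u" "word_prod G u \<in> comm_prods G H c" "length u + c \<le> i" "v = word_count u"
    using assms unfolding comm_words_def by blast
  then show ?thesis
    using comm_wordsI[of "word_inv u" c i] comm_prods_inv
    by (simp add: word_count_inv word_prod_inv word_over_carrier)
qed

lemma comm_words_mult_relator:
  assumes "x \<in> H" "y \<in> H"
  shows "Poly_Mapping.single (x \<otimes> y) 1 - Poly_Mapping.single x 1 - Poly_Mapping.single y 1
    \<in> comm_words G H 3"
  using comm_wordsI[of "[(x \<otimes> y, 1), (y, -1), (x, -1)]" 0 3] assms
  by (simp add: m_closed m_assoc int_pow_neg comm_prods_0 single_uminus algebra_simps)

lemma comm_words_conj_relator:
  assumes "g \<in> carrier G" "x \<in> H"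
  shows "Poly_Mapping.single (g \<otimes> x \<otimes> inv g) 1 - Poly_Mapping.single x 1 \<in> comm_words G H 3"
proof -
  have "word_prod G [(g \<otimes> x \<otimes> inv g, 1), (x, -1)] = commutator G g x"
    using assms by (simp add: commutator_def int_pow_neg)
  then show ?thesis
    using comm_wordsI[of "[(g \<otimes> x \<otimes> inv g, 1), (x, -1)]" 1 3] assms
      comm_prods_1[OF simple_commsI[OF assms]]
    by (simp add: single_uminus)
qed

text \<open>With \<open>u\<close> a representative of radius \<open>k\<close>, \<open>m\<close>
  copies of \<open>u\<close> have the class of the \<open>m\<close>-th multiple of \<open>w\<close>.
  The copies account for \<open>m * k\<close>, reordering of the multiple of \<open>w\<close> for
  \<open>length w\<close> only, which is negligible as \<open>m\<close> grows.\<close>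

lemma comm_words_near_pow:
  assumes "word_count w \<in> comm_words G H k" "word_over H w"
  shows "word_prod G (word_scale (int m) w) \<in> comm_prods G H (m * k + length w)"
proof -
  obtain u c where u: "word_over H u" "word_prod G u \<in> comm_prods G H c" "length u + c \<le> k"
    "word_count w = word_count u"
    using assms(1) unfolding comm_words_def by blast
  let ?u = "concat (replicate m u)" and ?w = "word_scale (int m) w"
  have "near G H (length ?u + length ?w) (word_prod G ?u) (word_prod G ?w)"
    using u assms word_over_scale[of "int m" w H]
    by (intro word_prod_near word_over_replicate) (simp_all add: word_count_replicate word_count_scale)
  moreover have "word_prod G ?u \<in> comm_prods G H (m * c)"
    using u comm_prods_pow by (simp add: word_prod_replicate word_over_carrier)
  ultimately have "word_prod G ?w \<in> comm_prods G H (m * length u + length w + m * c)"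
    using near_comm_prods assms(2) word_over_scale[of "int m" w H]
    by (simp add: length_concat_replicate word_over_carrier)
  moreover have "m * length u + length w + m * c \<le> m * k + length w"
    using mult_le_mono2[OF u(3), of m] by (simp add: algebra_simps)
  ultimately show ?thesis by (rule comm_prods_mono[rotated])
qed

text \<open>On single letters \<open>F\<close> has defect and conjugation error at most 3c, since
  the corresponding relators have radius 3; homogenization multiplies the defect by 4.\<close>

lemma additive_homogenization:
  fixes F :: "('a \<Rightarrow>\<^sub>0 int) \<Rightarrow> real"
  assumes add: "\<And>u v. F (u + v) = F u + F v"
    and bound: "\<And>k u. u \<in> comm_words G H k \<Longrightarrow> \<bar>F u\<bar> \<le> c * real k"
  shows "\<exists>\<phi>. qmorph G H (12 * c) \<phi>
    \<and> (\<forall>x\<in>H. \<bar>\<phi> x - F (Poly_Mapping.single x 1)\<bar> \<le> 3 * c)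
    \<and> (\<forall>x\<in>H. (\<forall>n::int. F (Poly_Mapping.single (x [^] n) 1) = of_int n * F (Poly_Mapping.single x 1))
        \<longrightarrow> \<phi> x = F (Poly_Mapping.single x 1))"
proof -
  have diff: "F (u - v) = F u - F v" for u v using add[of "u - v" v] by simp
  obtain \<phi> where "qmorph G H (4 * (c * real 3)) \<phi>"
    "\<And>x. x \<in> H \<Longrightarrow> \<bar>\<phi> x - F (Poly_Mapping.single x 1)\<bar> \<le> c * real 3"
    "\<And>x. x \<in> H \<Longrightarrow> (\<And>n::int. F (Poly_Mapping.single (x [^] n) 1) = of_int n * F (Poly_Mapping.single x 1))
      \<Longrightarrow> \<phi> x = F (Poly_Mapping.single x 1)"
  proof (rule homogenization[of "\<lambda>x. F (Poly_Mapping.single x 1)" "c * real 3"])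
    fix x y assume "x \<in> H" "y \<in> H"
    from bound[OF comm_words_mult_relator[OF this]]
    show "\<bar>F (Poly_Mapping.single (x \<otimes> y) 1) - F (Poly_Mapping.single x 1)
        - F (Poly_Mapping.single y 1)\<bar> \<le> c * real 3" by (simp add: diff)
  next
    fix g x assume "g \<in> carrier G" "x \<in> H"
    from bound[OF comm_words_conj_relator[OF this]]
    show "\<bar>F (Poly_Mapping.single (g \<otimes> x \<otimes> inv g) 1) - F (Poly_Mapping.single x 1)\<bar> \<le> c * real 3"
      by (simp add: diff)
  qed blast
  then show ?thesis by (intro exI[of _ \<phi>]) (simp add: mult.commute)
qed

text \<open>The nontrivial half of Bavard's duality, up to constants.\<close>
lemma scl_dual:
  assumes y: "y \<in> comm_sub G H"
  obtains \<phi> where "qmorph G H 12 \<phi>" "scl G H y \<le> \<phi> y + 3"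
proof -
  have yH: "y \<in> H" using y comm_sub_subset by blast
  define \<Gamma> where "\<Gamma> = {(word_count [(y, n)], of_int n * scl G H y) | n. True}"
  obtain F where F: "\<And>u v. F (u + v) = F u + F v" "\<And>u s. (u, s) \<in> \<Gamma> \<Longrightarrow> F u = s"
    "\<And>k u. u \<in> comm_words G H k \<Longrightarrow> \<bar>F u\<bar> \<le> 1 * real k"
  proof (rule dominated_additive_extension[of "comm_words G H" \<Gamma> 1])
    show "(0, 0) \<in> \<Gamma>" unfolding \<Gamma>_def by (auto intro!: exI[of _ 0])
    show "(u + v, s + t) \<in> \<Gamma>" if uv: "(u, s) \<in> \<Gamma>" "(v, t) \<in> \<Gamma>" for u s v t
    proof -
      obtain n m where "u = word_count [(y, n)]" "s = of_int n * scl G H y"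
        "v = word_count [(y, m)]" "t = of_int m * scl G H y" using uv unfolding \<Gamma>_def by blast
      then show ?thesis unfolding \<Gamma>_def
        by (auto intro!: exI[of _ "n + m"] simp: single_add ring_distribs)
    qed
    show "(- u, - s) \<in> \<Gamma>" if us: "(u, s) \<in> \<Gamma>" for u s
    proof -
      obtain n where "u = word_count [(y, n)]" "s = of_int n * scl G H y"
        using us unfolding \<Gamma>_def by blast
      then show ?thesis unfolding \<Gamma>_def
        by (auto intro!: exI[of _ "- n"] simp: single_uminus)
    qed
    show "s \<le> 1 * real k" if us: "(u, s) \<in> \<Gamma>" "u \<in> comm_words G H k" for k u s
    proof -
      obtain n where n: "u = word_count [(y, n)]" "s = of_int n * scl G H y"
        using us unfolding \<Gamma>_def by blast
      show ?thesis
      proof (cases "n \<le> 0")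
        case True
        then have "s \<le> 0" using n scl_nonneg[OF y] by (simp add: mult_nonpos_nonneg)
        then show ?thesis by simp
      next
        case False
        \<comment> \<open>The power of \<open>y\<close> with exponent \<open>m * nat n\<close> is a
          product of \<open>m * k + 1\<close> simple commutators, the 1 being the length of the
          one-letter word. Letting \<open>m\<close> grow gives domination.\<close>
        have *: "real m * s \<le> real m * real k + 1" if "0 < m" for m
        proof -
          have "word_prod G (word_scale (int m) [(y, n)]) \<in> comm_prods G H (m * k + 1)"
            using comm_words_near_pow[of "[(y, n)]" k m] us n yH by simp
          moreover have eq: "int m * n = int (m * nat n)" using False by simp
          have "word_prod G (word_scale (int m) [(y, n)]) = y [^] (int m * n)"
            using yH by (simp add: word_scale_def)
          then have "word_prod G (word_scale (int m) [(y, n)]) = y [^] (m * nat n)"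
            unfolding eq int_pow_int .
          ultimately have "cl G H (y [^] (m * nat n)) \<le> m * k + 1" using cl_le by simp
          moreover have "real (m * nat n) * scl G H y \<le> real (cl G H (y [^] (m * nat n)))"
            using that False by (intro scl_le[OF y]) auto
          moreover have "real (m * nat n) * scl G H y = real m * s" using False n by simp
          ultimately show ?thesis
            by (smt (verit) of_nat_1 of_nat_add of_nat_le_iff of_nat_mult)
        qed
        show ?thesis
        proof (rule ccontr)
          assume "\<not> ?thesis"
          then have e: "s - real k > 0" by simp
          obtain m :: nat where m: "real m > 1 / (s - real k)" using reals_Archimedean2 by blast
          then have "real m * (s - real k) > 1" using e by (simp add: field_simps)
          moreover have "0 < 1 / (s - real k)" using e by simp
          then have "0 < m" using m by (cases m) auto
          ultimately show False using *[of m] by (simp add: right_diff_distrib)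
        qed
      qed
    qed
  qed (use zero_comm_words comm_words_add comm_words_minus in blast)+
  have Fy: "F (Poly_Mapping.single y 1) = scl G H y"
  proof (rule F(2))
    show "(Poly_Mapping.single y 1, scl G H y) \<in> \<Gamma>"
      unfolding \<Gamma>_def by (auto intro!: exI[of _ 1])
  qed
  obtain \<phi> where \<phi>: "qmorph G H (12 * 1) \<phi>"
    "\<forall>x\<in>H. \<bar>\<phi> x - F (Poly_Mapping.single x 1)\<bar> \<le> 3 * 1"
    using additive_homogenization[of F 1, OF F(1) F(3)] by blast
  \<comment> \<open>Homogenization moves the value at \<open>y\<close>, which is its
    \<open>scl\<close>, by at most 3.\<close>
  have "scl G H y \<le> \<phi> y + 3" using bspec[OF \<phi>(2) yH] Fy by linarith
  then show thesis using that \<phi>(1) by simp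
qed

end

section \<open>The commutator pairing of a quasimorphism\<close>

text \<open>The index of a triple selects the coordinate of \<open>v\<close> used as exponent.
  Constant vectors give the powers of one family; general vectors let several families share one
  word.\<close>

fun comm_word :: "('a,'b) monoid_scheme \<Rightarrow> (nat \<Rightarrow> int) \<Rightarrow> (nat \<times> 'a \<times> 'a) list \<Rightarrow> 'a" where
  "comm_word G v [] = \<one>\<^bsub>G\<^esub>"
| "comm_word G v ((i, g, l) # ps) = commutator G (g [^]\<^bsub>G\<^esub> v i) l \<otimes>\<^bsub>G\<^esub> comm_word G v ps"

text \<open>Stabilizing in \<open>g\<close> replaces a quantity that is linear only up to defect by
  one that is exactly homogeneous in \<open>g\<close> and linear in \<open>\<phi>\<close>, so that
  linear algebra applies.\<close>

definition pairing :: "('a,'b) monoid_scheme \<Rightarrow> ('a \<Rightarrow> real) \<Rightarrow> 'a \<Rightarrow> 'a \<Rightarrow> real" where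
  "pairing G \<phi> g l = hom_limit (\<lambda>n. \<phi> (commutator G (g [^]\<^bsub>G\<^esub> n) l))"

definition pairing_sum :: "('a,'b) monoid_scheme \<Rightarrow> ('a \<Rightarrow> real) \<Rightarrow> (nat \<Rightarrow> int) \<Rightarrow> (nat \<times> 'a \<times> 'a) list \<Rightarrow> real" where
  "pairing_sum G \<phi> v ps = (\<Sum>(i, g, l)\<leftarrow>ps. of_int (v i) * pairing G \<phi> g l)"

lemma pairing_sum_simps:
  "pairing_sum G \<phi> v [] = 0"
  "pairing_sum G \<phi> v ((i, g, l) # ps) = of_int (v i) * pairing G \<phi> g l + pairing_sum G \<phi> v ps"
  by (simp_all add: pairing_sum_def)

lemma (in group) commutator_mult_left:
  assumes "g \<in> carrier G" "g' \<in> carrier G" "l \<in> carrier G"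
  shows "commutator G (g \<otimes> g') l = g \<otimes> commutator G g' l \<otimes> inv g \<otimes> commutator G g l"
  using assms by (simp add: commutator_def m_assoc inv_mult_group)

lemma (in group) commutator_closed [simp]:
  "g \<in> carrier G \<Longrightarrow> l \<in> carrier G \<Longrightarrow> commutator G g l \<in> carrier G"
  by (simp add: commutator_def)

context normal
begin

lemma inv_hom_qmorph:
  assumes "h \<in> inv_hom G H"
  shows "qmorph G H 0 h"
proof -
  have add: "h (x \<otimes> y) = h x + h y" if "x \<in> H" "y \<in> H" for x y
    using assms that unfolding inv_hom_def by blast
  have one: "h \<one> = 0" using add[of \<one> \<one>] by simp
  have inv: "h (inv x) = - h x" if "x \<in> H" for x using add[of x "inv x"] one that by simp
  have nat: "h (x [^] n) = real n * h x" if "x \<in> H" for x and n :: nat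
  proof (induction n)
    case (Suc n)
    have "x [^] n \<in> H" using int_pow_mem[OF that, of "int n"] by (simp add: int_pow_int)
    then show ?case using add[of "x [^] n" x] Suc that by (simp add: algebra_simps)
  qed (simp add: one)
  have pow: "h (x [^] n) = of_int n * h x" if "x \<in> H" for x and n :: int
  proof (cases n rule: int_cases2)
    case (nonneg m)
    then show ?thesis using nat[OF that] by (simp add: int_pow_int)
  next
    case (nonpos m)
    have "x [^] m \<in> H" using int_pow_mem[OF that, of "int m"] unfolding int_pow_int .
    then show ?thesis using nonpos nat[OF that] inv that by (simp add: int_pow_neg_int)
  qed
  show ?thesis
    using assms add pow unfolding qmorph_def inv_hqm_def inv_hom_def by (auto intro!: exI[of _ 0])
qed

lemma inv_hom_comm_sub:
  assumes "h \<in> inv_hom G H" "y \<in> comm_sub G H"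
  shows "h y = 0"
  using qmorph_comm_prods[OF inv_hom_qmorph[OF assms(1)]] assms(2) unfolding comm_sub_iff by auto

end

text \<open>The containment of [G,L] in \<open>N\<close> allows quasimorphisms on \<open>N\<close>
  to be evaluated at (G,L)-commutators, and makes reordering these cost only
  (G,N)-commutators.\<close>

locale mixed_pair = group G + N: normal N G + L: normal L G
  for G (structure) and N L +
  assumes N_subset_L: "N \<subseteq> L"
    and commutator_N: "g \<in> carrier G \<Longrightarrow> l \<in> L \<Longrightarrow> commutator G g l \<in> N"
begin

abbreviation pairs_over :: "(nat \<times> 'a \<times> 'a) list \<Rightarrow> bool" where
  "pairs_over ps \<equiv> snd ` set ps \<subseteq> carrier G \<times> L"

lemma simple_comms_L: "simple_comms G L \<subseteq> N"
  unfolding simple_comms_def using commutator_N by blast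

lemma comm_prods_L: "y \<in> comm_prods G L k \<Longrightarrow> y \<in> N"
  by (induction k arbitrary: y)
    (use simple_comms_L in \<open>auto simp: L.comm_prods_0 elim!: L.comm_prods_Suc intro!: N.m_closed\<close>)

lemma simple_comms_mono: "simple_comms G N \<subseteq> simple_comms G L"
  unfolding simple_comms_def using N_subset_L by blast

lemma comm_sub_mono: "comm_sub G N \<subseteq> comm_sub G L"
  unfolding comm_sub_def using simple_comms_mono by (rule mono_generate)

lemma comm_word_mem: "pairs_over ps \<Longrightarrow> comm_word G v ps \<in> N"
  by (induction ps) (auto intro!: N.m_closed commutator_N)

lemma comm_word_cl: "pairs_over ps \<Longrightarrow> comm_word G v ps \<in> comm_prods G L (length ps)"
proof (induction ps)
  case Nil
  then show ?case by (simp add: L.comm_prods_0)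
next
  case (Cons p ps)
  obtain i g l where p: "p = (i, g, l)" by (metis prod_cases3)
  have "commutator G (g [^] v i) l \<in> comm_prods G L 1"
    using Cons.prems p by (intro L.comm_prods_1 L.simple_commsI) auto
  from L.comm_prods_add[OF this Cons.IH] show ?case using Cons.prems p by simp
qed

text \<open>In [gg',l] = g[g',l]g^-1 [g,l] both commutators lie in \<open>N\<close>: one
  (G,N)-commutator removes the conjugation, another one interchanges the factors.\<close>

lemma commutator_near:
  assumes "g \<in> carrier G" "g' \<in> carrier G" "l \<in> L"
  shows "near G N 2 (commutator G g l \<otimes> commutator G g' l) (commutator G (g \<otimes> g') l)"
proof -
  let ?c = "commutator G g l" and ?c' = "commutator G g' l"
  have c: "?c \<in> N" "?c' \<in> N" using assms commutator_N by auto
  have "near G N 1 (?c \<otimes> ?c') (?c' \<otimes> ?c)"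
    using N.near_commute[of ?c' ?c] c by simp
  moreover have "near G N (1 + 0) (?c' \<otimes> ?c) ((g \<otimes> ?c' \<otimes> inv g) \<otimes> ?c)"
    using c assms by (intro N.near_mult N.near_conj N.near_refl) auto
  ultimately have "near G N (1 + (1 + 0)) (?c \<otimes> ?c') ((g \<otimes> ?c' \<otimes> inv g) \<otimes> ?c)"
    by (rule N.near_trans) (use c assms in auto)
  then show ?thesis using assms by (simp add: commutator_mult_left numeral_2_eq_2)
qed

text \<open>Each pair costs two commutators for additivity in \<open>g\<close> and one for moving it
  into place. The bound does not involve \<open>v\<close> and \<open>w\<close>: the word is a coarse
  homomorphism in its exponents.\<close>

lemma comm_word_near:
  assumes "pairs_over ps"
  shows "near G N (3 * length ps) (comm_word G v ps \<otimes> comm_word G w ps) (comm_word G (\<lambda>i. v i + w i) ps)"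
  using assms
proof (induction ps)
  case Nil
  then show ?case by (simp add: N.near_refl)
next
  case (Cons p ps)
  obtain i g l where p: "p = (i, g, l)" by (metis prod_cases3)
  have gl: "g \<in> carrier G" "l \<in> L" and ps: "pairs_over ps" using Cons.prems p by auto
  let ?a = "commutator G (g [^] v i) l" and ?b = "commutator G (g [^] w i) l"
    and ?A = "comm_word G v ps" and ?B = "comm_word G w ps" and ?C = "comm_word G (\<lambda>i. v i + w i) ps"
    and ?c = "commutator G (g [^] (v i + w i)) l"
  have mem: "?a \<in> N" "?b \<in> N" "?c \<in> N" "?A \<in> N" "?B \<in> N" "?C \<in> N"
    using gl ps by (auto intro!: commutator_N comm_word_mem)
  have c: "near G N 2 (?a \<otimes> ?b) ?c"
    using commutator_near[of "g [^] v i" "g [^] w i" l] gl by (simp add: int_pow_mult)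
  have 1: "near G N (0 + (1 + 0)) (?a \<otimes> ((?A \<otimes> ?b) \<otimes> ?B)) (?a \<otimes> ((?b \<otimes> ?A) \<otimes> ?B))"
    using mem N.near_commute[of ?b ?A]
    by (intro N.near_mult[OF N.near_refl N.near_mult[OF _ N.near_refl]]) auto
  have 2: "near G N (2 + 3 * length ps) ((?a \<otimes> ?b) \<otimes> (?A \<otimes> ?B)) (?c \<otimes> ?C)"
    using mem c Cons.IH[OF ps] by (intro N.near_mult) auto
  have "near G N ((0 + (1 + 0)) + (2 + 3 * length ps)) (?a \<otimes> ((?A \<otimes> ?b) \<otimes> ?B)) (?c \<otimes> ?C)"
    using 1 2 mem by (intro N.near_trans[OF 1]) (auto simp: m_assoc)
  then show ?case using p mem by (simp add: m_assoc numeral_3_eq_3)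
qed

lemma comm_word_zero: "pairs_over ps \<Longrightarrow> comm_word G (\<lambda>_. 0) ps = \<one>"
  by (induction ps) (auto simp: commutator_def)

text \<open>Modulo [G,N] the word is additive in \<open>m\<close>, so its value at 1
  decides.\<close>

lemma comm_word_comm_sub:
  assumes ps: "pairs_over ps" and 1: "comm_word G (\<lambda>_. 1) ps \<in> comm_sub G N"
  shows "comm_word G (\<lambda>_. m) ps \<in> comm_sub G N"
proof (induction m rule: int_induct[where k = 0])
  case base
  then show ?case using comm_word_zero[OF ps] by simp
next
  case (step1 i)
  have "comm_word G (\<lambda>_. i) ps \<otimes> comm_word G (\<lambda>_. 1) ps \<in> comm_sub G N" using step1 1 by simp
  from N.near_comm_sub[OF comm_word_near[OF ps, of "\<lambda>_. i" "\<lambda>_. 1"] this]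
  show ?case using comm_word_mem[OF ps] by simp
next
  case (step2 i)
  let ?a = "comm_word G (\<lambda>_. i - 1) ps" and ?b = "comm_word G (\<lambda>_. 1) ps"
  have mem: "?a \<in> N" "?b \<in> N" "comm_word G (\<lambda>_. i) ps \<in> N" using comm_word_mem[OF ps] by auto
  have "near G N (3 * length ps) (comm_word G (\<lambda>_. i) ps) (?a \<otimes> ?b)"
    by (rule N.near_sym) (use comm_word_near[OF ps, of "\<lambda>_. i - 1" "\<lambda>_. 1"] mem in auto)
  from N.near_comm_sub[OF this step2(2)] have "?a \<otimes> ?b \<in> comm_sub G N" using mem by simp
  from N.comm_sub_mult[OF this N.comm_sub_inv[OF 1]]
  show ?case using mem by (simp add: m_assoc)
qed

text \<open>Here the number \<open>k\<close> may depend on \<open>n\<close>; the lemma serves to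
  compare classes modulo [G,N], not to estimate.\<close>

lemma commutator_pow_near:
  fixes n :: int
  assumes "g \<in> carrier G" "l \<in> L"
  shows "\<exists>k. near G N k (commutator G g l [^] n) (commutator G (g [^] n) l)"
proof (induction n rule: int_induct[where k = 0])
  case base
  then show ?case using assms by (auto simp: commutator_def intro!: N.near_refl)
next
  let ?c = "\<lambda>n::int. commutator G (g [^] n) l"
  have mem: "?c n \<in> N" for n using assms by (intro commutator_N) auto
  have mem1: "commutator G g l \<in> N" using mem[of 1] assms by simp
  have st: "near G N 2 (?c n \<otimes> commutator G g l) (?c (n + 1))" for n
    using commutator_near[of "g [^] n" g l] assms by (simp add: int_pow_mult)
  {
    case (step1 i)
    then obtain k where k: "near G N k (commutator G g l [^] i) (?c i)" by blast
    have "near G N (k + 0) (commutator G g l [^] i \<otimes> commutator G g l) (?c i \<otimes> commutator G g l)"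
      using k mem mem1 by (intro N.near_mult N.near_refl) auto
    from N.near_trans[OF this st] show ?case
      using mem mem1 by (auto simp: int_pow_mult)
  next
    case (step2 i)
    then obtain k where k: "near G N k (commutator G g l [^] i) (?c i)" by blast
    have "near G N 2 (?c i) (?c (i - 1) \<otimes> commutator G g l)"
      by (rule N.near_sym) (use st[of "i - 1"] mem mem1 in auto)
    from N.near_trans[OF k this]
    have "near G N (k + 2) (commutator G g l [^] i) (?c (i - 1) \<otimes> commutator G g l)"
      using mem mem1 by auto
    then have "near G N (k + 2 + 0) (commutator G g l [^] i \<otimes> inv (commutator G g l))
        ((?c (i - 1) \<otimes> commutator G g l) \<otimes> inv (commutator G g l))"
      using mem mem1 by (intro N.near_mult N.near_refl) auto
    then show ?case using mem mem1
      by (auto simp: int_pow_diff m_assoc)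
  }
qed

text \<open>In the expansion of [g^(m+n), l] the conjugation is invisible to the invariant
  \<open>\<phi>\<close>, so the sequence is additive up to D.\<close>

lemma pairing_close:
  assumes "qmorph G N D \<phi>" "g \<in> carrier G" "l \<in> L"
  shows "\<bar>\<phi> (commutator G (g [^] n) l) - of_int n * pairing G \<phi> g l\<bar> \<le> D"
  unfolding pairing_def
proof (rule hom_limit_close)
  fix m n :: int
  let ?x = "g [^] m \<otimes> commutator G (g [^] n) l \<otimes> inv (g [^] m)"
  have "commutator G (g [^] (m + n)) l = ?x \<otimes> commutator G (g [^] m) l"
    using assms by (simp add: int_pow_mult commutator_mult_left)
  moreover have "\<phi> ?x = \<phi> (commutator G (g [^] n) l)"
    using assms commutator_N by (intro N.qmorph_conj) auto
  moreover have "\<bar>\<phi> (?x \<otimes> commutator G (g [^] m) l) - \<phi> ?x - \<phi> (commutator G (g [^] m) l)\<bar> \<le> D"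
    using assms commutator_N by (intro N.qmorph_defect[OF assms(1)]) auto
  ultimately show "\<bar>\<phi> (commutator G (g [^] (m + n)) l) - \<phi> (commutator G (g [^] m) l)
      - \<phi> (commutator G (g [^] n) l)\<bar> \<le> D" by simp
qed

lemma pairing_pow:
  fixes k :: int
  assumes "qmorph G N D \<phi>" "g \<in> carrier G" "l \<in> L"
  shows "pairing G \<phi> (g [^] k) l = of_int k * pairing G \<phi> g l"
  unfolding pairing_def[of G \<phi> "g [^] k"]
proof (rule hom_limit_eqI)
  fix n :: int
  show "\<bar>\<phi> (commutator G ((g [^] k) [^] n) l) - of_int n * (of_int k * pairing G \<phi> g l)\<bar> \<le> D"
    using pairing_close[OF assms, of "k * n"] assms by (simp add: int_pow_pow mult_ac)
qed

lemma pairing_add: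
  assumes "qmorph G N D \<phi>" "qmorph G N D' \<psi>" "g \<in> carrier G" "l \<in> L"
  shows "pairing G (\<lambda>x. \<phi> x + c * \<psi> x) g l = pairing G \<phi> g l + c * pairing G \<psi> g l"
  unfolding pairing_def[of G "\<lambda>x. \<phi> x + c * \<psi> x"]
proof (rule hom_limit_eqI)
  fix n :: int
  let ?x = "commutator G (g [^] n) l"
  have "\<bar>c * (\<psi> ?x - of_int n * pairing G \<psi> g l)\<bar> \<le> \<bar>c\<bar> * D'"
    unfolding abs_mult using pairing_close[OF assms(2-4)] by (intro mult_left_mono) auto
  moreover have "\<phi> ?x + c * \<psi> ?x - of_int n * (pairing G \<phi> g l + c * pairing G \<psi> g l)
      = (\<phi> ?x - of_int n * pairing G \<phi> g l) + c * (\<psi> ?x - of_int n * pairing G \<psi> g l)"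
    by (simp add: algebra_simps)
  ultimately show "\<bar>\<phi> ?x + c * \<psi> ?x - of_int n * (pairing G \<phi> g l + c * pairing G \<psi> g l)\<bar> \<le> D + \<bar>c\<bar> * D'"
    using pairing_close[OF assms(1,3,4), of n] by linarith
qed

lemma pairing_sum_add:
  assumes "qmorph G N D \<phi>" "qmorph G N D' \<psi>" "pairs_over ps"
  shows "pairing_sum G (\<lambda>x. \<phi> x + c * \<psi> x) v ps = pairing_sum G \<phi> v ps + c * pairing_sum G \<psi> v ps"
  using assms(3)
proof (induction ps)
  case (Cons p ps)
  obtain i g l where p: "p = (i, g, l)" by (metis prod_cases3)
  then show ?case using Cons pairing_add[OF assms(1,2), of g l c]
    by (simp add: pairing_sum_simps algebra_simps)
qed (simp add: pairing_sum_simps)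

lemma pairing_sum_zero: "pairs_over ps \<Longrightarrow> pairing_sum G (\<lambda>x. 0) v ps = 0"
  using pairing_sum_add[OF qmorph_zero qmorph_zero, of ps 1 v] by simp

lemma pairing_sum_sum:
  assumes "finite I" "\<And>j. j \<in> I \<Longrightarrow> qmorph G N (D j) (\<nu> j)" "pairs_over ps"
  shows "pairing_sum G (\<lambda>x. \<Sum>j\<in>I. c j * \<nu> j x) v ps = (\<Sum>j\<in>I. c j * pairing_sum G (\<nu> j) v ps)"
  using assms(1,2)
proof (induction I rule: finite_induct)
  case empty
  then show ?case using pairing_sum_zero[OF assms(3)] by simp
next
  case (insert i I)
  have "pairing_sum G (\<lambda>x. (\<Sum>j\<in>I. c j * \<nu> j x) + c i * \<nu> i x) v ps
      = pairing_sum G (\<lambda>x. \<Sum>j\<in>I. c j * \<nu> j x) v ps + c i * pairing_sum G (\<nu> i) v ps"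
    using insert by (intro pairing_sum_add[OF qmorph_sum _ assms(3)]) auto
  then show ?case using insert by (simp add: add.commute)
qed

text \<open>Each pair contributes D for splitting the product and D for replacing a commutator by
  its pairing; no exponent enters the bound.\<close>

lemma comm_word_value:
  assumes "qmorph G N D \<phi>" "pairs_over ps"
  shows "\<bar>\<phi> (comm_word G v ps) - pairing_sum G \<phi> v ps\<bar> \<le> 2 * D * real (length ps)"
  using assms(2)
proof (induction ps)
  case Nil
  then show ?case using N.qmorph_one[OF assms(1)] by (simp add: pairing_sum_simps)
next
  case (Cons p ps)
  obtain i g l where p: "p = (i, g, l)" by (metis prod_cases3)
  have gl: "g \<in> carrier G" "l \<in> L" and ps: "pairs_over ps" using Cons.prems p by auto
  let ?x = "commutator G (g [^] v i) l"
  have "\<bar>\<phi> (?x \<otimes> comm_word G v ps) - \<phi> ?x - \<phi> (comm_word G v ps)\<bar> \<le> D"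
    using gl ps by (intro N.qmorph_defect[OF assms(1)] commutator_N comm_word_mem) auto
  then show ?case
    using pairing_close[OF assms(1) gl, of "v i"] Cons.IH[OF ps] p
    by (simp add: pairing_sum_simps algebra_simps)
qed

section \<open>Trivial pairings and the extension from N to L\<close>

definition pairing_trivial :: "('a \<Rightarrow> real) \<Rightarrow> bool" where
  "pairing_trivial \<phi> \<longleftrightarrow> (\<forall>ps. pairs_over ps \<longrightarrow> comm_word G (\<lambda>_. 1) ps \<in> comm_sub G N
    \<longrightarrow> pairing_sum G \<phi> (\<lambda>_. 1) ps = 0)"

text \<open>Triviality says that the values \<open>pairing G \<phi> g l\<close> define a
  homomorphism on the image of [G,L] in the abelian group N/[G,N]; real homomorphisms extend from
  subgroups. The extension is the case of norm 0 and constant balls in the Hahn-Banach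
  theorem.\<close>

lemma pairing_trivial_hom:
  assumes \<phi>: "qmorph G N D \<phi>" and triv: "pairing_trivial \<phi>"
  shows "\<exists>h\<in>inv_hom G N. \<forall>g\<in>carrier G. \<forall>l\<in>L. h (commutator G g l) = pairing G \<phi> g l"
proof -
  \<comment> \<open>The kernel of the map from the free abelian group on \<open>N\<close> onto
    N/[G,N].\<close>
  define E where "E = {word_count u | u. word_over N u \<and> word_prod G u \<in> comm_sub G N}"
  define cw where "cw ts = map (\<lambda>(n, g, l). (commutator G g l, n)) ts" for ts :: "(int \<times> 'a \<times> 'a) list"
  define val where "val ts = (\<Sum>(n, g, l)\<leftarrow>ts. of_int n * pairing G \<phi> g l)"
    for ts :: "(int \<times> 'a \<times> 'a) list"
  define good where "good ts \<longleftrightarrow> snd ` set ts \<subseteq> carrier G \<times> L" for ts :: "(int \<times> 'a \<times> 'a) list"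
  define \<Gamma> where "\<Gamma> = {(word_count (cw ts), val ts) | ts. good ts}"
  have cw_over: "word_over N (cw ts)" if "good ts" for ts
    using that commutator_N unfolding good_def cw_def by (force simp: image_subset_iff)
  have E_words: "comm_words G N k \<subseteq> E" for k
    unfolding E_def comm_words_def using N.comm_prods_comm_sub by blast
  \<comment> \<open>A coefficient \<open>n\<close> is absorbed as [g^n, l], which brings integer
    combinations of commutators into the form that \<open>pairing_trivial\<close> speaks
    about.\<close>
  have near_ts: "\<exists>k. near G N k (word_prod G (cw ts))
      (comm_word G (\<lambda>_. 1) (map (\<lambda>(n, g, l). (0, g [^] n, l)) ts))" if "good ts" for ts
    using that
  proof (induction ts)
    case Nil
    then show ?case by (auto simp: cw_def intro!: N.near_refl)
  next
    case (Cons t ts)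
    obtain n g l where t: "t = (n, g, l)" by (metis prod_cases3)
    have gl: "g \<in> carrier G" "l \<in> L" and ts: "good ts" using Cons.prems t by (auto simp: good_def)
    have ps: "pairs_over (map (\<lambda>(n, g, l). (0, g [^] n, l)) ts)"
      using ts unfolding good_def by (force simp: image_subset_iff)
    obtain k k' where
      k: "near G N k (commutator G g l [^] n) (commutator G (g [^] n) l)"
        "near G N k' (word_prod G (cw ts)) (comm_word G (\<lambda>_. 1) (map (\<lambda>(n, g, l). (0, g [^] n, l)) ts))"
      using commutator_pow_near[OF gl] Cons.IH[OF ts] by blast
    have "near G N (k + k') (commutator G g l [^] n \<otimes> word_prod G (cw ts))
      (commutator G (g [^] n) l \<otimes> comm_word G (\<lambda>_. 1) (map (\<lambda>(n, g, l). (0, g [^] n, l)) ts))"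
      using k gl ps commutator_N comm_word_mem[OF ps] N.word_prod_mem[OF cw_over[OF ts]]
      by (intro N.near_mult) auto
    then show ?case using t gl by (auto simp: cw_def)
  qed
  have val_ts: "pairing_sum G \<phi> (\<lambda>_. 1) (map (\<lambda>(n, g, l). (0, g [^] n, l)) ts) = val ts"
    if "good ts" for ts
    using that
    by (induction ts) (auto simp: good_def val_def pairing_sum_simps pairing_pow[OF \<phi>])
  obtain F where F: "\<And>u v. F (u + v) = F u + F v" "\<And>u s. (u, s) \<in> \<Gamma> \<Longrightarrow> F u = s"
    "\<And>k u. u \<in> E \<Longrightarrow> \<bar>F u\<bar> \<le> 0 * real k"
  proof (rule dominated_additive_extension[of "\<lambda>k::nat. E" \<Gamma> 0])
    show "0 \<in> E" unfolding E_def by (auto intro!: exI[of _ "[]"])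
    show "u + v \<in> E" if uv: "u \<in> E" "v \<in> E" for u v
    proof -
      obtain a b where "word_over N a" "word_prod G a \<in> comm_sub G N" "u = word_count a"
        "word_over N b" "word_prod G b \<in> comm_sub G N" "v = word_count b"
        using uv unfolding E_def by blast
      then show ?thesis unfolding E_def
        by (intro CollectI exI[of _ "a @ b"])
          (simp add: word_count_append word_prod_append N.word_over_carrier image_Un)
    qed
    show "- u \<in> E" if u: "u \<in> E" for u
    proof -
      obtain a where "word_over N a" "word_prod G a \<in> comm_sub G N" "u = word_count a"
        using u unfolding E_def by blast
      then show ?thesis unfolding E_def
        by (intro CollectI exI[of _ "word_inv a"])
          (simp add: word_count_inv word_prod_inv N.word_over_carrier)
    qed
    show "(0, 0) \<in> \<Gamma>" unfolding \<Gamma>_def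
      by (auto simp: good_def cw_def val_def intro!: exI[of _ "[]"])
    show "(u + v, s + t) \<in> \<Gamma>" if uv: "(u, s) \<in> \<Gamma>" "(v, t) \<in> \<Gamma>" for u s v t
    proof -
      obtain a b where "good a" "u = word_count (cw a)" "s = val a"
        "good b" "v = word_count (cw b)" "t = val b" using uv unfolding \<Gamma>_def by blast
      then show ?thesis unfolding \<Gamma>_def
        by (intro CollectI exI[of _ "a @ b"])
          (auto simp: cw_def val_def good_def word_count_append)
    qed
    show "(- u, - s) \<in> \<Gamma>" if u: "(u, s) \<in> \<Gamma>" for u s
    proof -
      obtain a where a: "good a" "u = word_count (cw a)" "s = val a" using u unfolding \<Gamma>_def by blast
      define b where "b = map (\<lambda>(n, g, l). (- n, g, l)) a"
      have "good b" using a(1) unfolding good_def b_def by (force simp: image_subset_iff)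
      moreover have "word_count (cw b) = - word_count (cw a)"
        unfolding b_def cw_def by (induction a) (auto simp: single_uminus)
      moreover have "val b = - val a"
        unfolding b_def val_def by (induction a) auto
      ultimately show ?thesis unfolding \<Gamma>_def using a by (intro CollectI exI[of _ b]) simp
    qed
    \<comment> \<open>With constant 0, domination means that prescribed values vanish on
      \<open>E\<close>, and this is triviality of the pairing.\<close>
    show "s \<le> 0 * real k" if us: "(u, s) \<in> \<Gamma>" "u \<in> E" for k u s
    proof -
      obtain ts where ts: "good ts" "u = word_count (cw ts)" "s = val ts"
        using us(1) unfolding \<Gamma>_def by blast
      obtain a where a: "word_over N a" "word_prod G a \<in> comm_sub G N" "u = word_count a"
        using us(2) unfolding E_def by blast
      let ?ps = "map (\<lambda>(n, g, l). (0, g [^] n, l)) ts"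
      have ps: "pairs_over ?ps" using ts unfolding good_def by (force simp: image_subset_iff)
      have "word_prod G (cw ts) \<in> comm_sub G N"
        using N.near_comm_sub[OF N.word_prod_near[OF a(1) cw_over[OF ts(1)]] a(2)]
          ts a N.word_prod_mem[OF cw_over[OF ts(1)]] by simp
      then have "comm_word G (\<lambda>_. 1) ?ps \<in> comm_sub G N"
        using near_ts[OF ts(1)] N.near_comm_sub comm_word_mem[OF ps] by (metis N.mem_carrier')
      then have "pairing_sum G \<phi> (\<lambda>_. 1) ?ps = 0"
        using triv ps unfolding pairing_trivial_def by blast
      then show ?thesis using val_ts[OF ts(1)] ts by simp
    qed
  qed blast
  have FE: "F u = 0" if "u \<in> E" for u using F(3)[OF that] by simp
  have diff: "F (u - v) = F u - F v" for u v using F(1)[of "u - v" v] by simp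
  define h where "h x = (if x \<in> N then F (Poly_Mapping.single x 1) else 0)" for x
  have "h \<in> inv_hom G N"
    unfolding inv_hom_def
  proof (intro CollectI conjI ballI allI impI)
    fix x y assume xy: "x \<in> N" "y \<in> N"
    show "h (x \<otimes> y) = h x + h y"
      using FE[OF subsetD[OF E_words N.comm_words_mult_relator[OF xy]]] xy
      by (simp add: h_def diff N.m_closed)
  next
    fix g x assume gx: "g \<in> carrier G" "x \<in> N"
    show "h (g \<otimes> x \<otimes> inv g) = h x"
      using FE[OF subsetD[OF E_words N.comm_words_conj_relator[OF gx]]] gx by (simp add: h_def diff)
  qed (simp add: h_def)
  moreover have "h (commutator G g l) = pairing G \<phi> g l" if gl: "g \<in> carrier G" "l \<in> L" for g l
  proof -
    have "(Poly_Mapping.single (commutator G g l) 1, pairing G \<phi> g l) \<in> \<Gamma>"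
      unfolding \<Gamma>_def using gl
      by (intro CollectI exI[of _ "[(1, g, l)]"]) (simp add: cw_def val_def good_def)
    then show ?thesis using F(2) commutator_N[OF gl] by (simp add: h_def)
  qed
  ultimately show ?thesis by blast
qed

text \<open>\<open>\<theta>\<close> is prescribed on words over \<open>N\<close> and dominated by
  the balls of \<open>L\<close>, since a product of \<open>k\<close> simple (G,L)-commutators has
  value at most 2kD. Homogeneity of \<open>\<theta>\<close> then ensures that the final
  homogenization leaves it unchanged on \<open>N\<close>. The factor 24 is 12 times the norm
  2.\<close>

lemma qmorph_extension:
  assumes \<theta>: "qmorph G N D \<theta>" and bound: "\<And>g l. g \<in> carrier G \<Longrightarrow> l \<in> L \<Longrightarrow> \<bar>\<theta> (commutator G g l)\<bar> \<le> D"
  shows "\<exists>\<psi>. qmorph G L (24 * D) \<psi> \<and> (\<forall>x\<in>N. \<psi> x = \<theta> x)"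
proof -
  have D0: "0 \<le> D" using N.qmorph_defect_nonneg[OF \<theta>] .
  have cp: "\<bar>\<theta> y\<bar> \<le> 2 * real k * D" if "y \<in> comm_prods G L k" for y k
    using that
  proof (induction k arbitrary: y)
    case 0
    then show ?case using N.qmorph_one[OF \<theta>] by (simp add: L.comm_prods_0)
  next
    case (Suc k)
    obtain c z where cz: "c \<in> simple_comms G L" "z \<in> comm_prods G L k" "y = c \<otimes> z"
      using L.comm_prods_Suc[OF Suc.prems] by blast
    have "\<bar>\<theta> (c \<otimes> z) - \<theta> c - \<theta> z\<bar> \<le> D"
      using cz simple_comms_L comm_prods_L by (intro N.qmorph_defect[OF \<theta>]) auto
    moreover have "\<bar>\<theta> c\<bar> \<le> D" using cz(1) bound unfolding simple_comms_def by auto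
    ultimately show ?case using Suc.IH[OF cz(2)] cz(3) by (simp add: algebra_simps)
  qed
  define \<Gamma> where "\<Gamma> = {(word_count w, word_val \<theta> w) | w. word_over N w}"
  obtain F where F: "\<And>u v. F (u + v) = F u + F v" "\<And>u s. (u, s) \<in> \<Gamma> \<Longrightarrow> F u = s"
    "\<And>k u. u \<in> comm_words G L k \<Longrightarrow> \<bar>F u\<bar> \<le> (2 * D) * real k"
  proof (rule dominated_additive_extension[of "comm_words G L" \<Gamma> "2 * D"])
    show "(0, 0) \<in> \<Gamma>" unfolding \<Gamma>_def
      by (auto simp: word_val_Nil intro!: exI[of _ "[]"])
    show "(u + v, s + t) \<in> \<Gamma>" if uv: "(u, s) \<in> \<Gamma>" "(v, t) \<in> \<Gamma>" for u s v t
    proof -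
      obtain a b where "word_over N a" "u = word_count a" "s = word_val \<theta> a"
        "word_over N b" "v = word_count b" "t = word_val \<theta> b" using uv unfolding \<Gamma>_def by blast
      then show ?thesis unfolding \<Gamma>_def
        by (intro CollectI exI[of _ "a @ b"]) (simp add: word_val_append word_count_append image_Un)
    qed
    show "(- u, - s) \<in> \<Gamma>" if u: "(u, s) \<in> \<Gamma>" for u s
    proof -
      obtain a where "word_over N a" "u = word_count a" "s = word_val \<theta> a"
        using u unfolding \<Gamma>_def by blast
      then show ?thesis unfolding \<Gamma>_def
        by (intro CollectI exI[of _ "word_inv a"]) (simp add: word_val_inv word_count_inv)
    qed
    show "s \<le> (2 * D) * real k" if us: "(u, s) \<in> \<Gamma>" "u \<in> comm_words G L k" for k u s
    proof -
      obtain w where w: "word_over N w" "u = word_count w" "s = word_val \<theta> w"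
        using us(1) unfolding \<Gamma>_def by blast
      have wL: "word_over L w" using w N_subset_L by blast
      \<comment> \<open>For the \<open>m\<close>-th multiple of \<open>w\<close> the product needs
        \<open>m * k + length w\<close> commutators and the linear value is off by D per letter;
        both terms with \<open>length w\<close> are independent of \<open>m\<close>.\<close>
      have *: "real m * s \<le> 2 * D * (real m * real k) + 3 * D * real (length w)" for m
      proof -
        let ?w = "word_scale (int m) w"
        have "\<bar>\<theta> (word_prod G ?w) - word_val \<theta> ?w\<bar> \<le> D * real (length ?w)"
          using w by (intro N.qmorph_word[OF \<theta>]) simp
        moreover have "\<bar>\<theta> (word_prod G ?w)\<bar> \<le> 2 * real (m * k + length w) * D"
          using L.comm_words_near_pow[OF _ wL, of k m] us w by (intro cp) simp
        ultimately have "word_val \<theta> ?w \<le> 2 * real (m * k + length w) * D + D * real (length w)"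
          by simp
        then show ?thesis using w by (simp add: word_val_scale algebra_simps)
      qed
      show ?thesis
      proof (rule ccontr)
        assume "\<not> ?thesis"
        then have e: "s - 2 * D * real k > 0" by simp
        obtain m :: nat where "real m > (3 * D * real (length w)) / (s - 2 * D * real k)"
          using reals_Archimedean2 by blast
        then have "real m * (s - 2 * D * real k) > 3 * D * real (length w)"
          using e by (simp add: pos_divide_less_eq)
        then show False using *[of m] by (simp add: algebra_simps)
      qed
    qed
  qed (use L.zero_comm_words L.comm_words_add L.comm_words_minus in blast)+
  have F1: "F (Poly_Mapping.single x 1) = \<theta> x" if "x \<in> N" for x
  proof (rule F(2))
    show "(Poly_Mapping.single x 1, \<theta> x) \<in> \<Gamma>"
      unfolding \<Gamma>_def using that
      by (intro CollectI exI[of _ "[(x, 1)]"]) (simp add: word_val_Cons word_val_Nil)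
  qed
  obtain \<psi> where \<psi>: "qmorph G L (12 * (2 * D)) \<psi>"
    "\<forall>x\<in>L. (\<forall>n::int. F (Poly_Mapping.single (x [^] n) 1) = of_int n * F (Poly_Mapping.single x 1))
      \<longrightarrow> \<psi> x = F (Poly_Mapping.single x 1)"
    using L.additive_homogenization[of F "2 * D", OF F(1) F(3)] by blast
  have "\<psi> x = \<theta> x" if "x \<in> N" for x
    using bspec[OF \<psi>(2), of x] that N_subset_L N.qmorph_int_pow[OF \<theta> that] F1 by auto
  then show ?thesis using \<psi>(1) by (intro exI[of _ \<psi>]) simp
qed

text \<open>After subtracting \<open>h\<close>, the value at [g,l] is the difference between
  \<open>\<phi>\<close> and its stabilization, at most D, so the rest extends to
  \<open>L\<close>.\<close>

lemma pairing_trivial_decomp: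
  assumes \<phi>: "qmorph G N D \<phi>" and triv: "pairing_trivial \<phi>"
  shows "\<exists>h\<in>inv_hom G N. \<exists>\<psi>. qmorph G L (24 * D) \<psi> \<and> (\<forall>x\<in>N. \<phi> x = h x + \<psi> x)"
proof -
  obtain h where h: "h \<in> inv_hom G N"
    "\<forall>g\<in>carrier G. \<forall>l\<in>L. h (commutator G g l) = pairing G \<phi> g l"
    using pairing_trivial_hom[OF assms] by blast
  let ?\<theta> = "\<lambda>x. \<phi> x + (- 1) * h x"
  have "qmorph G N D ?\<theta>" using qmorph_add[OF \<phi> N.inv_hom_qmorph[OF h(1)], of "- 1"] by simp
  moreover have "\<bar>?\<theta> (commutator G g l)\<bar> \<le> D" if "g \<in> carrier G" "l \<in> L" for g l
    using pairing_close[OF \<phi> that, of 1] h(2) that by simp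
  ultimately obtain \<psi> where "qmorph G L (24 * D) \<psi>" "\<forall>x\<in>N. \<psi> x = ?\<theta> x"
    using qmorph_extension[of D ?\<theta>] by blast
  then show ?thesis using h(1) by (intro bexI[of _ h] exI[of _ \<psi>]) simp_all
qed

text \<open>Along the words with constant exponent \<open>m\<close> the homomorphism vanishes and
  \<open>\<psi>\<close> is bounded, since the number of (G,L)-commutators is fixed. But
  \<open>\<phi>\<close> grows there like \<open>m\<close> times the pairing sum.\<close>

lemma decomp_pairing_trivial:
  assumes \<phi>: "qmorph G N D \<phi>" and h: "h \<in> inv_hom G N" and \<psi>: "qmorph G L D' \<psi>"
    and eq: "\<And>x. x \<in> N \<Longrightarrow> \<phi> x = h x + \<psi> x"
  shows "pairing_trivial \<phi>"
  unfolding pairing_trivial_def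
proof (intro allI impI)
  fix ps assume ps: "pairs_over ps" "comm_word G (\<lambda>_. 1) ps \<in> comm_sub G N"
  have "pairing_sum G \<phi> (\<lambda>_. m) ps = of_int m * pairing_sum G \<phi> (\<lambda>_. 1) ps" for m
    by (induction ps) (auto simp: pairing_sum_def algebra_simps)
  moreover have "\<bar>\<phi> (comm_word G (\<lambda>_. m) ps)\<bar> \<le> 2 * real (length ps) * D'" for m
    using eq[OF comm_word_mem[OF ps(1)]] N.inv_hom_comm_sub[OF h comm_word_comm_sub[OF ps]]
      L.qmorph_comm_prods[OF \<psi> comm_word_cl[OF ps(1)]] by simp
  moreover have "\<bar>\<phi> (comm_word G (\<lambda>_. m) ps) - pairing_sum G \<phi> (\<lambda>_. m) ps\<bar> \<le> 2 * D * real (length ps)" for m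
    using comm_word_value[OF \<phi> ps(1)] .
  ultimately have "\<bar>0 - of_int m * pairing_sum G \<phi> (\<lambda>_. 1) ps\<bar> \<le> 2 * real (length ps) * D' + 2 * D * real (length ps)"
    for m by (smt (verit))
  then have "hom_limit (\<lambda>_. 0) = pairing_sum G \<phi> (\<lambda>_. 1) ps" by (rule hom_limit_eqI)
  moreover have "hom_limit (\<lambda>_. 0) = 0" by (rule hom_limit_eqI[where D=0]) simp
  ultimately show "pairing_sum G \<phi> (\<lambda>_. 1) ps = 0" by simp
qed

text \<open>On [G,N] only the extension to \<open>L\<close> survives; 48 is twice its defect factor
  24.\<close>

lemma pairing_trivial_bound:
  assumes \<phi>: "qmorph G N D \<phi>" and triv: "pairing_trivial \<phi>" and y: "y \<in> comm_sub G N"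
  shows "\<bar>\<phi> y\<bar> \<le> 48 * D * scl G L y"
proof -
  obtain h \<psi> where h: "h \<in> inv_hom G N" "qmorph G L (24 * D) \<psi>" "\<forall>x\<in>N. \<phi> x = h x + \<psi> x"
    using pairing_trivial_decomp[OF \<phi> triv] by blast
  then show ?thesis
    using N.inv_hom_comm_sub[OF h(1) y] y N.comm_sub_subset L.qmorph_scl[OF h(2), of y] comm_sub_mono
    by (auto simp: subset_iff)
qed

end

section \<open>Dual systems and coarse embeddings\<close>

lemma qmorph_mono: "qmorph G M D \<phi> \<Longrightarrow> D \<le> D' \<Longrightarrow> qmorph G M D' \<phi>"
  unfolding qmorph_def by fastforce

lemma finite_Zvec_ball: "finite {u \<in> Zvec n. norm1 n u \<le> S}"
proof (rule finite_subset)
  show "{u \<in> Zvec n. norm1 n u \<le> S}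
    \<subseteq> {u. \<forall>i. (i \<in> {..<n} \<longrightarrow> u i \<in> {- \<lfloor>S\<rfloor>..\<lfloor>S\<rfloor>}) \<and> (i \<notin> {..<n} \<longrightarrow> u i = 0)}"
  proof (rule subsetI, intro CollectI allI conjI impI)
    fix u i assume u: "u \<in> {u \<in> Zvec n. norm1 n u \<le> S}" and i: "i \<in> {..<n}"
    have "real_of_int \<bar>u i\<bar> \<le> S"
      using d1_coord[of i n u "\<lambda>_. 0"] u i by (simp add: d1_def norm1_def)
    then have "\<bar>u i\<bar> \<le> \<lfloor>S\<rfloor>" by (simp add: le_floor_iff)
    then show "u i \<in> {- \<lfloor>S\<rfloor>..\<lfloor>S\<rfloor>}" by auto
  qed (auto simp: Zvec_def)
  show "finite {u. \<forall>i. (i \<in> {..<n} \<longrightarrow> u i \<in> {- \<lfloor>S\<rfloor>..\<lfloor>S\<rfloor>}) \<and> (i \<notin> {..<n} \<longrightarrow> u i = (0::int))}"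
    by (rule finite_set_of_finite_funs) auto
qed

context normal
begin

lemma qmorph_diff:
  assumes "qmorph G H D \<phi>" "y \<in> comm_sub G H" "z \<in> comm_sub G H"
  shows "\<bar>\<phi> (inv y \<otimes> z) - (\<phi> z - \<phi> y)\<bar> \<le> D"
    "\<bar>\<phi> z - \<phi> y\<bar> \<le> 2 * D * d_scl G H y z + D"
proof -
  have yz: "y \<in> H" "z \<in> H" using assms comm_sub_subset by auto
  show 1: "\<bar>\<phi> (inv y \<otimes> z) - (\<phi> z - \<phi> y)\<bar> \<le> D"
    using qmorph_defect[OF assms(1), of "inv y" z] qmorph_inv[OF assms(1) yz(1)] yz by simp
  show "\<bar>\<phi> z - \<phi> y\<bar> \<le> 2 * D * d_scl G H y z + D"
    using 1 qmorph_scl[OF assms(1), of "inv y \<otimes> z"] assms unfolding d_scl_def by simp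
qed

lemma d_scl_le_d_cl: "y \<in> comm_sub G H \<Longrightarrow> z \<in> comm_sub G H \<Longrightarrow> d_scl G H y z \<le> d_cl G H y z"
  unfolding d_scl_def d_cl_def by (intro scl_le_cl) auto

lemma d_cl_near: "near G H k y z \<Longrightarrow> d_cl G H y z \<le> real k"
  unfolding near_def d_cl_def using cl_le by simp

end

section \<open>Biorthogonal systems and the dimension of W\<close>

context mixed_pair
begin

definition kernel_words :: "(nat \<times> 'a \<times> 'a) list set" where
  "kernel_words = {ps. pairs_over ps \<and> comm_word G (\<lambda>_. 1) ps \<in> comm_sub G N}"

definition dual_system :: "nat \<Rightarrow> (nat \<Rightarrow> 'a \<Rightarrow> real) \<Rightarrow> (nat \<Rightarrow> (nat \<times> 'a \<times> 'a) list) \<Rightarrow> bool" where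
  "dual_system n \<nu> ks \<longleftrightarrow> (\<forall>j<n. \<nu> j \<in> inv_hqm G N \<and> ks j \<in> kernel_words)
     \<and> (\<forall>i<n. \<forall>j<n. pairing_sum G (\<nu> j) (\<lambda>_. 1) (ks i) = (if i = j then 1 else 0))"

definition trivial_part :: "('a \<Rightarrow> real) set" where
  "trivial_part = {(\<lambda>x. h x + k x) | h k. h \<in> inv_hom G N \<and> k \<in> restr_to N ` inv_hqm G L}"

lemma pairing_trivial_iff:
  "pairing_trivial \<phi> \<longleftrightarrow> (\<forall>ps\<in>kernel_words. pairing_sum G \<phi> (\<lambda>_. 1) ps = 0)"
  by (auto simp: pairing_trivial_def kernel_words_def)

lemma kernel_words_over: "ps \<in> kernel_words \<Longrightarrow> pairs_over ps"
  by (simp add: kernel_words_def)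

lemma trivial_part_iff:
  assumes "\<phi> \<in> inv_hqm G N"
  shows "\<phi> \<in> trivial_part \<longleftrightarrow> pairing_trivial \<phi>"
proof -
  obtain D where D: "qmorph G N D \<phi>" using qmorph_ex[OF assms] by blast
  show ?thesis
  proof
    assume "\<phi> \<in> trivial_part"
    then obtain h \<psi> where h: "h \<in> inv_hom G N" "\<psi> \<in> inv_hqm G L" "\<phi> = (\<lambda>x. h x + restr_to N \<psi> x)"
      unfolding trivial_part_def by blast
    obtain D' where "qmorph G L D' \<psi>" using qmorph_ex[OF h(2)] by blast
    then show "pairing_trivial \<phi>"
      using decomp_pairing_trivial[OF D h(1)] h(3) by (simp add: restr_to_def)
  next
    assume "pairing_trivial \<phi>"
    then obtain h \<psi> where h: "h \<in> inv_hom G N" "qmorph G L (24 * D) \<psi>" "\<forall>x\<in>N. \<phi> x = h x + \<psi> x"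
      using pairing_trivial_decomp[OF D] by blast
    have "\<phi> x = 0" "h x = 0" if "x \<notin> N" for x
      using assms h(1) that unfolding inv_hqm_def inv_hom_def by auto
    then have "\<phi> = (\<lambda>x. h x + restr_to N \<psi> x)" using h(3) by (auto simp: restr_to_def)
    moreover have "\<psi> \<in> inv_hqm G L" using h(2) by (simp add: qmorph_def)
    ultimately show "\<phi> \<in> trivial_part" unfolding trivial_part_def using h(1) by blast
  qed
qed

lemma hqm_add:
  assumes "\<phi> \<in> inv_hqm G N" "\<psi> \<in> inv_hqm G N"
  shows "(\<lambda>x. \<phi> x + c * \<psi> x) \<in> inv_hqm G N"
  using qmorph_ex[OF assms(1)] qmorph_ex[OF assms(2)] qmorph_add[of G N _ \<phi> _ \<psi> c]
  unfolding qmorph_def by blast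

lemma hqm_zero: "(\<lambda>x. 0) \<in> inv_hqm G N"
  using qmorph_zero unfolding qmorph_def by blast

lemma hqm_sum:
  assumes "finite I" "\<And>j. j \<in> I \<Longrightarrow> \<nu> j \<in> inv_hqm G N"
  shows "(\<lambda>x. \<Sum>j\<in>I. c j * \<nu> j x) \<in> inv_hqm G N"
proof -
  have "\<forall>j\<in>I. \<exists>D. qmorph G N D (\<nu> j)" using qmorph_ex assms(2) by blast
  then obtain D where "\<And>j. j \<in> I \<Longrightarrow> qmorph G N (D j) (\<nu> j)" by metis
  from qmorph_sum[of I G N D \<nu> c, OF assms(1) this] show ?thesis unfolding qmorph_def by blast
qed

lemma hqm_pairing_add:
  assumes "\<phi> \<in> inv_hqm G N" "\<psi> \<in> inv_hqm G N" "ps \<in> kernel_words"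
  shows "pairing_sum G (\<lambda>x. \<phi> x + c * \<psi> x) v ps = pairing_sum G \<phi> v ps + c * pairing_sum G \<psi> v ps"
  using qmorph_ex[OF assms(1)] qmorph_ex[OF assms(2)] pairing_sum_add kernel_words_over[OF assms(3)]
  by blast

lemma hqm_pairing_sum:
  assumes "finite I" "\<And>j. j \<in> I \<Longrightarrow> \<nu> j \<in> inv_hqm G N" "ps \<in> kernel_words"
  shows "pairing_sum G (\<lambda>x. \<Sum>j\<in>I. c j * \<nu> j x) v ps = (\<Sum>j\<in>I. c j * pairing_sum G (\<nu> j) v ps)"
proof -
  have "\<forall>j\<in>I. \<exists>D. qmorph G N D (\<nu> j)" using qmorph_ex assms(2) by blast
  then obtain D where "\<And>j. j \<in> I \<Longrightarrow> qmorph G N (D j) (\<nu> j)" by metis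
  from pairing_sum_sum[of I D \<nu> ps c v, OF assms(1) this kernel_words_over[OF assms(3)]]
  show ?thesis .
qed

lemma dual_systemD:
  assumes "dual_system n \<nu> ks"
  shows "j < n \<Longrightarrow> \<nu> j \<in> inv_hqm G N" "j < n \<Longrightarrow> ks j \<in> kernel_words"
    "i < n \<Longrightarrow> j < n \<Longrightarrow> pairing_sum G (\<nu> j) (\<lambda>_. 1) (ks i) = (if i = j then 1 else 0)"
  using assms unfolding dual_system_def by blast+

text \<open>Removes the components along the system. The remainder either enlarges the system or, if
  the system is maximal, has trivial pairing.\<close>

lemma dual_system_reduce:
  assumes ds: "dual_system n \<nu> ks" and \<phi>: "\<phi> \<in> inv_hqm G N"
    and \<phi>': "\<phi>' = (\<lambda>x. \<phi> x + (- 1) * (\<Sum>j<n. pairing_sum G \<phi> (\<lambda>_. 1) (ks j) * \<nu> j x))"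
  shows "\<phi>' \<in> inv_hqm G N" "i < n \<Longrightarrow> pairing_sum G \<phi>' (\<lambda>_. 1) (ks i) = 0"
proof -
  let ?c = "\<lambda>j. pairing_sum G \<phi> (\<lambda>_. 1) (ks j)"
  have s: "(\<lambda>x. \<Sum>j<n. ?c j * \<nu> j x) \<in> inv_hqm G N"
    using dual_systemD(1)[OF ds] by (intro hqm_sum) auto
  show "\<phi>' \<in> inv_hqm G N" unfolding \<phi>' by (rule hqm_add[OF \<phi> s])
  assume i: "i < n"
  have "pairing_sum G \<phi>' (\<lambda>_. 1) (ks i)
      = ?c i + (- 1) * pairing_sum G (\<lambda>x. \<Sum>j<n. ?c j * \<nu> j x) (\<lambda>_. 1) (ks i)"
    unfolding \<phi>' by (rule hqm_pairing_add[OF \<phi> s dual_systemD(2)[OF ds i]])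
  also have "pairing_sum G (\<lambda>x. \<Sum>j<n. ?c j * \<nu> j x) (\<lambda>_. 1) (ks i)
      = (\<Sum>j<n. ?c j * pairing_sum G (\<nu> j) (\<lambda>_. 1) (ks i))"
    using dual_systemD(1)[OF ds] by (intro hqm_pairing_sum dual_systemD(2)[OF ds i]) auto
  also have "\<dots> = (\<Sum>j<n. if j = i then ?c j else 0)"
    using dual_systemD(3)[OF ds i] by (intro sum.cong) auto
  also have "\<dots> = ?c i" using i by simp
  finally show "pairing_sum G \<phi>' (\<lambda>_. 1) (ks i) = 0" by simp
qed

text \<open>The form of the new functionals is recorded because the induction over an independent
  set must keep them in its span.\<close>

lemma dual_system_extend:
  assumes ds: "dual_system n \<nu> ks" and \<phi>: "\<phi> \<in> inv_hqm G N"
    and zero: "\<And>i. i < n \<Longrightarrow> pairing_sum G \<phi> (\<lambda>_. 1) (ks i) = 0"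
    and nontriv: "\<not> pairing_trivial \<phi>"
  shows "\<exists>\<nu>' ks'. dual_system (Suc n) \<nu>' ks'
    \<and> (\<forall>j<Suc n. \<exists>c. \<nu>' j = (\<lambda>x. (if j < n then \<nu> j x else 0) + c * \<phi> x))"
proof -
  obtain ps where ps: "ps \<in> kernel_words" "pairing_sum G \<phi> (\<lambda>_. 1) ps \<noteq> 0"
    using nontriv unfolding pairing_trivial_iff by blast
  define a where "a = pairing_sum G \<phi> (\<lambda>_. 1) ps"
  \<comment> \<open>Old functionals are made to vanish on the new word \<open>ps\<close>; their
    pairings with the old words do not change, because \<open>\<phi>\<close> vanishes there. The
    rescaled \<open>\<phi>\<close> becomes the last functional.\<close>
  define c where "c j = (if j < n then - pairing_sum G (\<nu> j) (\<lambda>_. 1) ps / a else 1 / a)" for j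
  define \<nu>0 where "\<nu>0 j = (if j < n then \<nu> j else (\<lambda>x. 0))" for j
  define \<nu>' where "\<nu>' j = (\<lambda>x. \<nu>0 j x + c j * \<phi> x)" for j
  define ks' where "ks' = ks(n := ps)"
  have a: "a \<noteq> 0" using ps by (simp add: a_def)
  have \<nu>0: "\<nu>0 j \<in> inv_hqm G N" for j
    using dual_systemD(1)[OF ds] hqm_zero by (simp add: \<nu>0_def)
  have ks': "ks' i \<in> kernel_words" if "i < Suc n" for i
    using that dual_systemD(2)[OF ds] ps by (auto simp: ks'_def less_Suc_eq)
  have p0: "pairing_sum G (\<lambda>x. 0) v qs = 0" if "qs \<in> kernel_words" for v qs
    using pairing_sum_zero kernel_words_over that by blast
  have "dual_system (Suc n) \<nu>' ks'"
    unfolding dual_system_def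
  proof (intro conjI allI impI)
    show "\<nu>' j \<in> inv_hqm G N" for j unfolding \<nu>'_def by (rule hqm_add[OF \<nu>0 \<phi>])
    show "ks' j \<in> kernel_words" if "j < Suc n" for j using ks'[OF that] .
    fix i j assume i: "i < Suc n" and j: "j < Suc n"
    have eq: "pairing_sum G (\<nu>' j) (\<lambda>_. 1) (ks' i)
        = pairing_sum G (\<nu>0 j) (\<lambda>_. 1) (ks' i) + c j * pairing_sum G \<phi> (\<lambda>_. 1) (ks' i)"
      unfolding \<nu>'_def by (rule hqm_pairing_add[OF \<nu>0 \<phi> ks'[OF i]])
    show "pairing_sum G (\<nu>' j) (\<lambda>_. 1) (ks' i) = (if i = j then 1 else 0)"
    proof (cases "i < n")
      case True
      then show ?thesis using eq zero[OF True] j dual_systemD(3)[OF ds True] p0[OF dual_systemD(2)[OF ds True]]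
        by (auto simp: ks'_def \<nu>0_def)
    next
      case False
      then have "i = n" using i by simp
      then show ?thesis using eq j p0[OF ps(1)] a
        by (auto simp: ks'_def \<nu>0_def c_def a_def[symmetric])
    qed
  qed
  moreover have "\<nu>' j = (\<lambda>x. (if j < n then \<nu> j x else 0) + c j * \<phi> x)" for j
    by (auto simp: \<nu>'_def \<nu>0_def)
  ultimately show ?thesis by blast
qed

text \<open>Since the system stays in the span of \<open>S\<close>, reducing the new
  \<open>s\<close> gives a combination with coefficient 1 at \<open>s\<close>. Independence makes it
  nontrivial, so the system can be enlarged.\<close>

lemma dual_system_of_independent:
  assumes "finite S" "S \<subseteq> inv_hqm G N"
    "\<And>c. (\<lambda>x. \<Sum>s\<in>S. c s * s x) \<in> trivial_part \<Longrightarrow> \<forall>s\<in>S. c s = 0"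
  shows "\<exists>\<nu> ks. dual_system (card S) \<nu> ks \<and> (\<forall>j<card S. \<exists>c. \<nu> j = (\<lambda>x. \<Sum>s\<in>S. c s * s x))"
  using assms
proof (induction S rule: finite_induct)
  case empty
  then show ?case by (auto simp: dual_system_def)
next
  case (insert s S)
  have sum_upd: "(\<Sum>t\<in>insert s S. (c(s := a)) t * t x) = a * s x + (\<Sum>t\<in>S. c t * t x)" for c a and x :: 'a
  proof -
    have "(\<Sum>t\<in>S. (c(s := a)) t * t x) = (\<Sum>t\<in>S. c t * t x)"
      using insert(2) by (intro sum.cong) auto
    then show ?thesis using insert(1,2) by simp
  qed
  have "\<forall>t\<in>S. c t = 0" if "(\<lambda>x. \<Sum>t\<in>S. c t * t x) \<in> trivial_part" for c
  proof -
    have "(\<lambda>x. \<Sum>t\<in>insert s S. (c(s := 0)) t * t x) \<in> trivial_part"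
      unfolding sum_upd using that by simp
    from insert.prems(2)[OF this] show ?thesis using insert(2) by (metis fun_upd_other insertCI)
  qed
  then obtain \<nu> ks where ds: "dual_system (card S) \<nu> ks"
    and sp: "\<forall>j<card S. \<exists>c. \<nu> j = (\<lambda>x. \<Sum>t\<in>S. c t * t x)"
    using insert.IH insert.prems(1) by blast
  let ?n = "card S"
  define \<phi> where "\<phi> = (\<lambda>x. s x + (- 1) * (\<Sum>j<?n. pairing_sum G s (\<lambda>_. 1) (ks j) * \<nu> j x))"
  have s: "s \<in> inv_hqm G N" using insert.prems(1) by simp
  note \<phi> = dual_system_reduce[OF ds s \<phi>_def]
  obtain C where C: "\<And>j. j < ?n \<Longrightarrow> \<nu> j = (\<lambda>x. \<Sum>t\<in>S. C j t * t x)" using sp by metis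
  define d where "d t = - (\<Sum>j<?n. pairing_sum G s (\<lambda>_. 1) (ks j) * C j t)" for t
  have \<phi>_eq: "\<phi> = (\<lambda>x. \<Sum>t\<in>insert s S. (d(s := 1)) t * t x)"
  proof
    fix x
    have "(\<Sum>j<?n. pairing_sum G s (\<lambda>_. 1) (ks j) * \<nu> j x)
        = (\<Sum>j<?n. \<Sum>t\<in>S. pairing_sum G s (\<lambda>_. 1) (ks j) * C j t * t x)"
      using C by (intro sum.cong) (auto simp: sum_distrib_left mult.assoc)
    also have "\<dots> = (\<Sum>t\<in>S. - d t * t x)"
      unfolding d_def minus_minus sum_distrib_right by (rule sum.swap)
    finally have "(\<Sum>j<?n. pairing_sum G s (\<lambda>_. 1) (ks j) * \<nu> j x) = - (\<Sum>t\<in>S. d t * t x)"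
      by (simp add: sum_negf)
    then show "\<phi> x = (\<Sum>t\<in>insert s S. (d(s := 1)) t * t x)"
      unfolding sum_upd by (simp add: \<phi>_def)
  qed
  have "\<not> pairing_trivial \<phi>"
  proof
    assume "pairing_trivial \<phi>"
    then have "\<phi> \<in> trivial_part" using trivial_part_iff[OF \<phi>(1)] by simp
    from insert.prems(2)[OF this[unfolded \<phi>_eq]] show False by auto
  qed
  then obtain \<nu>' ks' where ds': "dual_system (Suc ?n) \<nu>' ks'"
    and \<nu>': "\<forall>j<Suc ?n. \<exists>c. \<nu>' j = (\<lambda>x. (if j < ?n then \<nu> j x else 0) + c * \<phi> x)"
    using dual_system_extend[OF ds \<phi>(1) \<phi>(2)] by blast
  have "\<exists>c. \<nu>' j = (\<lambda>x. \<Sum>t\<in>insert s S. c t * t x)" if j: "j < Suc ?n" for j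
  proof -
    obtain a where a: "\<nu>' j = (\<lambda>x. (if j < ?n then \<nu> j x else 0) + a * \<phi> x)" using \<nu>' j by blast
    define e where "e t = (if j < ?n then C j t else 0)" for t
    have e: "(if j < ?n then \<nu> j x else 0) = (\<Sum>t\<in>insert s S. (e(s := 0)) t * t x)" for x
      unfolding sum_upd using C by (auto simp: e_def)
    have "\<nu>' j = (\<lambda>x. \<Sum>t\<in>insert s S. ((e(s := 0)) t + a * (d(s := 1)) t) * t x)"
      unfolding a e \<phi>_eq by (simp only: sum_distrib_left distrib_right sum.distrib mult.assoc)
    then show ?thesis by (rule exI[of _ "\<lambda>t. (e(s := 0)) t + a * (d(s := 1)) t"])
  qed
  then show ?case using ds' insert(1,2) by (intro exI[of _ \<nu>'] exI[of _ ks']) simp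
qed

lemma dimW_eq: "dimW G L N = quot_dim (inv_hqm G N) trivial_part"
  unfolding dimW_def trivial_part_def ..

text \<open>For infinite dimension the supremum is not attained, so an independent set with at least
  \<open>n\<close> elements is used and its system truncated.\<close>

lemma dual_system_of_le_dimW:
  assumes "enat n \<le> dimW G L N"
  shows "\<exists>\<nu> ks. dual_system n \<nu> ks"
proof (cases "n = 0")
  case True
  then show ?thesis by (auto simp: dual_system_def)
next
  case False
  let ?X = "{enat (card S) | S. finite S \<and> S \<subseteq> inv_hqm G N \<and>
      (\<forall>c. (\<lambda>x. \<Sum>s\<in>S. c s * s x) \<in> trivial_part \<longrightarrow> (\<forall>s\<in>S. c s = 0))}"
  have "\<exists>e\<in>?X. enat n \<le> e"
  proof (rule ccontr)
    assume "\<not> ?thesis"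
    then have lt: "e < enat n" if "e \<in> ?X" for e using that not_le by blast
    have "Sup ?X \<le> enat (n - 1)"
    proof (rule Sup_least)
      fix e assume "e \<in> ?X"
      from lt[OF this] show "e \<le> enat (n - 1)" by (cases e) auto
    qed
    with assms[unfolded dimW_eq quot_dim_def] have "enat n \<le> enat (n - 1)" by (rule order_trans)
    then show False using False by simp
  qed
  then obtain S where S: "finite S" "S \<subseteq> inv_hqm G N" "n \<le> card S"
    "\<And>c. (\<lambda>x. \<Sum>s\<in>S. c s * s x) \<in> trivial_part \<Longrightarrow> \<forall>s\<in>S. c s = 0" by auto
  then obtain \<nu> ks where "dual_system (card S) \<nu> ks"
    using dual_system_of_independent[OF S(1,2,4)] by blast
  then have "dual_system n \<nu> ks" using S(3) unfolding dual_system_def by auto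
  then show ?thesis by blast
qed

text \<open>Pairing a combination with \<open>ks i\<close> isolates the coefficient at
  \<open>\<nu> i\<close>, which must vanish if the combination is trivial.\<close>

lemma le_dimW_of_dual_system:
  assumes ds: "dual_system n \<nu> ks"
  shows "enat n \<le> dimW G L N"
proof -
  let ?S = "\<nu> ` {..<n}"
  have inj: "inj_on \<nu> {..<n}"
  proof (rule inj_onI)
    fix i j assume "i \<in> {..<n}" "j \<in> {..<n}" "\<nu> i = \<nu> j"
    then show "i = j" using dual_systemD(3)[OF ds, of i i] dual_systemD(3)[OF ds, of i j]
      by (auto split: if_splits)
  qed
  have S: "?S \<subseteq> inv_hqm G N" using dual_systemD(1)[OF ds] by auto
  have "c s = 0" if c: "(\<lambda>x. \<Sum>s\<in>?S. c s * s x) \<in> trivial_part" and s: "s \<in> ?S" for c s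
  proof -
    obtain i where i: "i < n" "s = \<nu> i" using s by auto
    let ?\<phi> = "\<lambda>x. \<Sum>j<n. c (\<nu> j) * \<nu> j x"
    have "(\<lambda>x. \<Sum>s\<in>?S. c s * s x) = ?\<phi>" using inj by (simp add: sum.reindex)
    moreover have "?\<phi> \<in> inv_hqm G N" using dual_systemD(1)[OF ds] by (intro hqm_sum) auto
    ultimately have "pairing_trivial ?\<phi>" using trivial_part_iff c by simp
    then have "0 = pairing_sum G ?\<phi> (\<lambda>_. 1) (ks i)"
      using dual_systemD(2)[OF ds i(1)] unfolding pairing_trivial_iff by simp
    also have "\<dots> = (\<Sum>j<n. c (\<nu> j) * pairing_sum G (\<nu> j) (\<lambda>_. 1) (ks i))"
      using dual_systemD(1)[OF ds] by (intro hqm_pairing_sum dual_systemD(2)[OF ds i(1)]) auto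
    also have "\<dots> = (\<Sum>j<n. if j = i then c (\<nu> j) else 0)"
      using dual_systemD(3)[OF ds i(1)] by (intro sum.cong) auto
    also have "\<dots> = c s" using i by simp
    finally show ?thesis by simp
  qed
  then have "enat (card ?S) \<le> quot_dim (inv_hqm G N) trivial_part"
    unfolding quot_dim_def using S by (intro Sup_upper CollectI exI[of _ ?S]) auto
  then show ?thesis using inj by (simp add: card_image dimW_eq)
qed

section \<open>Coarse embeddings of Z^n\<close>

lemma comm_word_append:
  "pairs_over ps \<Longrightarrow> pairs_over qs \<Longrightarrow> comm_word G v (ps @ qs) = comm_word G v ps \<otimes> comm_word G v qs"
proof (induction ps)
  case (Cons p ps)
  obtain i g l where p: "p = (i, g, l)" by (metis prod_cases3)
  then show ?case using Cons comm_word_mem[of ps v] comm_word_mem[of qs v] commutator_N[of "g [^] v i" l]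
    by (simp add: m_assoc)
qed (use comm_word_mem[of qs v] in simp)

text \<open>Relabelling sends the exponent \<open>v i\<close> to every pair of the
  \<open>i\<close>-th word, so that one \<open>comm_word\<close> carries all coordinates.\<close>

definition combined :: "(nat \<Rightarrow> (nat \<times> 'a \<times> 'a) list) \<Rightarrow> nat list \<Rightarrow> (nat \<times> 'a \<times> 'a) list" where
  "combined ks is = concat (map (\<lambda>i. map (\<lambda>p. (i, snd p)) (ks i)) is)"

lemma pairs_over_relabel: "pairs_over ps \<Longrightarrow> pairs_over (map (\<lambda>p. (i, snd p)) ps)"
  by (force simp: image_subset_iff)

lemma combined_over:
  "(\<And>i. i \<in> set is \<Longrightarrow> ks i \<in> kernel_words) \<Longrightarrow> pairs_over (combined ks is)"
  unfolding combined_def using kernel_words_over by (force simp: image_subset_iff)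

lemma comm_word_relabel:
  "comm_word G v (map (\<lambda>p. (i, snd p)) ps) = comm_word G (\<lambda>_. v i) ps"
  by (induction ps) auto

lemma combined_comm_sub:
  "(\<And>i. i \<in> set is \<Longrightarrow> ks i \<in> kernel_words) \<Longrightarrow> comm_word G v (combined ks is) \<in> comm_sub G N"
proof (induction "is")
  case (Cons i "is")
  have "comm_word G (\<lambda>_. v i) (ks i) \<in> comm_sub G N"
    using comm_word_comm_sub Cons.prems[of i] by (simp add: kernel_words_def)
  moreover have "comm_word G v (combined ks (i # is))
      = comm_word G (\<lambda>_. v i) (ks i) \<otimes> comm_word G v (combined ks is)"
    using comm_word_append[OF pairs_over_relabel combined_over, of "ks i" "is" ks v i]
      kernel_words_over Cons.prems
    by (simp add: combined_def comm_word_relabel)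
  ultimately show ?case using Cons by simp
qed (simp add: combined_def)

lemma pairing_sum_combined:
  "pairing_sum G \<phi> v (combined ks is) = (\<Sum>i\<leftarrow>is. of_int (v i) * pairing_sum G \<phi> (\<lambda>_. 1) (ks i))"
proof (induction "is")
  case (Cons i "is")
  have "pairing_sum G \<phi> v (map (\<lambda>p. (i, snd p)) ps) = of_int (v i) * pairing_sum G \<phi> (\<lambda>_. 1) ps" for ps
    by (induction ps) (auto simp: pairing_sum_simps algebra_simps)
  then show ?case using Cons by (simp add: combined_def pairing_sum_def)
qed (simp add: combined_def pairing_sum_simps)

lemma common_defect:
  assumes "dual_system n \<nu> ks"
  shows "\<exists>D. \<forall>j<n. qmorph G N D (\<nu> j)"
proof -
  have "\<forall>j\<in>{..<n}. \<exists>D. qmorph G N D (\<nu> j)" using qmorph_ex dual_systemD(1)[OF assms] by auto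
  then obtain D where D: "\<And>j. j < n \<Longrightarrow> qmorph G N (D j) (\<nu> j)" by (metis lessThan_iff)
  have "qmorph G N (\<Sum>j<n. D j) (\<nu> j)" if "j < n" for j
    using N.qmorph_defect_nonneg[OF D] that by (intro qmorph_mono[OF D[OF that]] member_le_sum) auto
  then show ?thesis by blast
qed

text \<open>One map serves both distances: control and boundedness are shown for \<open>d_cl\<close>
  and pass to the smaller \<open>d_scl\<close>; properness is shown for \<open>d_scl\<close> and
  passes to \<open>d_cl\<close>.\<close>

lemma coarse_hom_from_Z_of_dual_system:
  assumes ds: "dual_system n \<nu> ks"
  shows "\<exists>\<alpha>. coarse_hom_from_Z G (comm_sub G N) (d_scl G N) (d_scl G L) n \<alpha>
    \<and> coarse_hom_from_Z G (comm_sub G N) (d_cl G N) (d_cl G L) n \<alpha>"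
proof -
  define T where "T = combined ks [0..<n]"
  define \<alpha> where "\<alpha> v = comm_word G v T" for v
  have T: "pairs_over T" unfolding T_def using dual_systemD(2)[OF ds] by (intro combined_over) auto
  have mem: "\<alpha> v \<in> comm_sub G N" for v
    unfolding \<alpha>_def T_def using dual_systemD(2)[OF ds] by (intro combined_comm_sub) auto
  have memL: "\<alpha> v \<in> comm_sub G L" for v using mem comm_sub_mono by blast
  have near_add: "near G N (3 * length T) (\<alpha> v \<otimes> \<alpha> w) (\<alpha> (\<lambda>i. v i + w i))" for v w
    unfolding \<alpha>_def by (rule comm_word_near[OF T])
  have hom: "d_cl G N (\<alpha> (\<lambda>i. v i + w i)) (\<alpha> v \<otimes> \<alpha> w) \<le> real (3 * length T)" for v w
    by (intro N.d_cl_near N.near_sym[OF near_add]) (simp_all add: mem)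
  have scl_le: "d_scl G N (\<alpha> v) (\<alpha> w) \<le> d_cl G N (\<alpha> v) (\<alpha> w)" for v w
    using N.d_scl_le_d_cl mem by blast
  \<comment> \<open>Each value is a product of \<open>length T\<close> simple (G,L)-commutators,
    whatever the exponents.\<close>
  have bdL: "d_cl G L (\<alpha> v) (\<alpha> w) \<le> real (2 * length T)" for v w
    using L.d_cl_near[unfolded near_def, OF L.comm_prods_add[OF L.comm_prods_inv
          [OF comm_word_cl[OF T]] comm_word_cl[OF T]], of v w]
    by (simp add: \<alpha>_def)
  \<comment> \<open>By near additivity only the difference of the arguments matters; it ranges over
    a finite ball, on which \<open>cl\<close> is bounded.\<close>
  have ctrl: "\<exists>B. \<forall>v\<in>Zvec n. \<forall>w\<in>Zvec n. d1 n v w \<le> S \<longrightarrow> d_cl G N (\<alpha> v) (\<alpha> w) \<le> B" for S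
  proof -
    have "finite ((\<lambda>u. cl G N (\<alpha> u)) ` {u \<in> Zvec n. norm1 n u \<le> S})"
      by (intro finite_imageI finite_Zvec_ball)
    then obtain b where b: "\<And>u. u \<in> Zvec n \<Longrightarrow> norm1 n u \<le> S \<Longrightarrow> cl G N (\<alpha> u) \<le> b"
      unfolding finite_nat_set_iff_bounded_le by blast
    have "d_cl G N (\<alpha> v) (\<alpha> w) \<le> real (b + 3 * length T)"
      if vw: "v \<in> Zvec n" "w \<in> Zvec n" "d1 n v w \<le> S" for v w
    proof -
      define u where "u i = w i - v i" for i
      have u: "u \<in> Zvec n" "norm1 n u \<le> S" using vw by (auto simp: u_def[abs_def] Zvec_def d1_def)
      have "near G N b (\<alpha> v) (\<alpha> v \<otimes> \<alpha> u)"
        unfolding near_def using N.comm_prods_mono[OF b[OF u] N.cl_mem[OF mem]] mem by simp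
      moreover have "(\<lambda>i. v i + u i) = w" by (simp add: u_def)
      ultimately have "near G N (b + 3 * length T) (\<alpha> v) (\<alpha> w)"
        using N.near_trans[OF _ near_add[of v u]] mem by simp
      then show ?thesis by (rule N.d_cl_near)
    qed
    then show ?thesis by blast
  qed
  obtain D where D: "\<And>j. j < n \<Longrightarrow> qmorph G N D (\<nu> j)" using common_defect[OF ds] by blast
  have val: "\<bar>\<nu> j (\<alpha> v) - of_int (v j)\<bar> \<le> 2 * D * real (length T)" if j: "j < n" for j v
  proof -
    have "pairing_sum G (\<nu> j) v T = (\<Sum>i<n. of_int (v i) * pairing_sum G (\<nu> j) (\<lambda>_. 1) (ks i))"
      unfolding T_def pairing_sum_combined interv_sum_list_conv_sum_set_nat
      by (simp add: atLeast0LessThan)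
    also have "\<dots> = (\<Sum>i<n. if i = j then of_int (v i) else 0)"
      using dual_systemD(3)[OF ds _ j] by (intro sum.cong) auto
    also have "\<dots> = of_int (v j)" using j by simp
    finally show ?thesis using comm_word_value[OF D[OF j] T, of v] by (simp add: \<alpha>_def)
  qed
  have proper: "\<exists>B. \<forall>v\<in>Zvec n. \<forall>w\<in>Zvec n. d1 n v w > B \<longrightarrow> d_scl G N (\<alpha> v) (\<alpha> w) > S" for S
  proof -
    \<comment> \<open>2DS + D bounds the variation of \<open>\<nu> j\<close> at \<open>d_scl\<close>
      distance S; the last term is twice the error in reading off a coordinate.\<close>
    define M where "M = 2 * D * S + D + 4 * D * real (length T)"
    have "d1 n v w \<le> real_of_int (int n * \<lceil>M\<rceil>)" if le: "d_scl G N (\<alpha> v) (\<alpha> w) \<le> S" for v w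
    proof (rule d1_le)
      fix j assume j: "j < n"
      have "0 \<le> D" using N.qmorph_defect_nonneg[OF D[OF j]] .
      then have "2 * D * d_scl G N (\<alpha> v) (\<alpha> w) \<le> 2 * D * S" using le by (intro mult_left_mono) auto
      then have "\<bar>real_of_int (v j) - real_of_int (w j)\<bar> \<le> M"
        using N.qmorph_diff(2)[OF D[OF j] mem[of v] mem[of w]] val[OF j, of v] val[OF j, of w]
        unfolding M_def by linarith
      then show "\<bar>v j - w j\<bar> \<le> \<lceil>M\<rceil>" by linarith
    qed
    then show ?thesis by (meson not_le)
  qed
  have "coarse_hom_from_Z G (comm_sub G N) (d_cl G N) (d_cl G L) n \<alpha>"
    unfolding coarse_hom_from_Z_def controlled_on_def coarsely_proper_on_def d_bounded_def
  proof (intro conjI)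
    show "\<forall>S. \<exists>B. \<forall>v\<in>Zvec n. \<forall>w\<in>Zvec n. d1 n v w > B \<longrightarrow> d_cl G N (\<alpha> v) (\<alpha> w) > S"
      using proper scl_le by (meson less_le_trans)
  qed (use mem hom ctrl bdL in blast)+
  moreover have "coarse_hom_from_Z G (comm_sub G N) (d_scl G N) (d_scl G L) n \<alpha>"
    unfolding coarse_hom_from_Z_def controlled_on_def coarsely_proper_on_def d_bounded_def
  proof (intro conjI)
    have "d_scl G N (\<alpha> (\<lambda>i. v i + w i)) (\<alpha> v \<otimes> \<alpha> w) \<le> real (3 * length T)" for v w
      using N.d_scl_le_d_cl[of "\<alpha> (\<lambda>i. v i + w i)" "\<alpha> v \<otimes> \<alpha> w"] hom[of v w] mem by simp
    then show "\<exists>D. \<forall>v\<in>Zvec n. \<forall>w\<in>Zvec n. d_scl G N (\<alpha> (\<lambda>i. v i + w i)) (\<alpha> v \<otimes> \<alpha> w) \<le> D" by blast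
    show "\<forall>S. \<exists>B. \<forall>v\<in>Zvec n. \<forall>w\<in>Zvec n. d1 n v w \<le> S \<longrightarrow> d_scl G N (\<alpha> v) (\<alpha> w) \<le> B"
      using ctrl scl_le by (meson order_trans)
    have "d_scl G L (\<alpha> v) (\<alpha> w) \<le> real (2 * length T)" for v w
      using L.d_scl_le_d_cl[OF memL memL, of v w] bdL[of v w] by simp
    then show "\<exists>B. \<forall>x\<in>\<alpha> ` Zvec n. \<forall>y\<in>\<alpha> ` Zvec n. d_scl G L x y \<le> B" by blast
  qed (use mem proper in blast)+
  ultimately show ?thesis by blast
qed

text \<open>The coordinates are the rounded functionals. For properness, the quasimorphism dual to a
  given element is reduced by the system; maximality makes the remainder trivial, hence bounded by
  \<open>scl\<close> over \<open>L\<close>, and the removed part is bounded by the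
  coordinates.\<close>

lemma coarse_hom_to_Z_of_maximal:
  assumes ds: "dual_system n \<nu> ks" and max: "\<And>\<nu>' ks'. \<not> dual_system (Suc n) \<nu>' ks'"
    and A: "A \<subseteq> comm_sub G N" "d_bounded (d_scl G L) A"
  shows "\<exists>\<beta>. coarse_hom_to_Z G (comm_sub G N) (d_scl G N) A n \<beta>"
proof -
  define \<beta> where "\<beta> y = (\<lambda>j. if j < n then \<lfloor>\<nu> j y\<rfloor> else 0)" for y
  obtain D where D: "\<And>j. j < n \<Longrightarrow> qmorph G N D (\<nu> j)" using common_defect[OF ds] by blast
  obtain B where B: "\<And>x y. x \<in> A \<Longrightarrow> y \<in> A \<Longrightarrow> d_scl G L x y \<le> B"
    using A(2) unfolding d_bounded_def by blast
  have range: "\<beta> ` comm_sub G N \<subseteq> Zvec n" by (auto simp: \<beta>_def Zvec_def)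
  have hom: "d1 n (\<beta> (g \<otimes> h)) (\<lambda>i. \<beta> g i + \<beta> h i) \<le> real_of_int (int n * (\<lceil>D\<rceil> + 3))"
    if gh: "g \<in> comm_sub G N" "h \<in> comm_sub G N" for g h
  proof (rule d1_le)
    fix j assume j: "j < n"
    have "\<bar>\<nu> j (g \<otimes> h) - \<nu> j g - \<nu> j h\<bar> \<le> D"
      using gh N.comm_sub_subset by (intro N.qmorph_defect[OF D[OF j]]) auto
    then show "\<bar>\<beta> (g \<otimes> h) j - (\<beta> g j + \<beta> h j)\<bar> \<le> \<lceil>D\<rceil> + 3" using j unfolding \<beta>_def by simp linarith
  qed
  have ctrl: "d1 n (\<beta> x) (\<beta> y) \<le> real_of_int (int n * (\<lceil>2 * D * S + D\<rceil> + 1))"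
    if xy: "x \<in> A" "y \<in> A" "d_scl G N x y \<le> S" for x y S
  proof (rule d1_le)
    fix j assume j: "j < n"
    have "0 \<le> D" using N.qmorph_defect_nonneg[OF D[OF j]] .
    then have "2 * D * d_scl G N x y \<le> 2 * D * S" using xy by (intro mult_left_mono) auto
    moreover have "\<bar>\<nu> j y - \<nu> j x\<bar> \<le> 2 * D * d_scl G N x y + D"
      using xy A by (intro N.qmorph_diff(2)[OF D[OF j]]) auto
    ultimately have "\<bar>\<nu> j y - \<nu> j x\<bar> \<le> 2 * D * S + D" by linarith
    then show "\<bar>\<beta> x j - \<beta> y j\<bar> \<le> \<lceil>2 * D * S + D\<rceil> + 1" using j unfolding \<beta>_def by simp linarith
  qed
  \<comment> \<open>Bounds the pairing of any quasimorphism of defect 12 with \<open>ks j\<close>: 2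
    * 12 per commutator of the word and 2 * 12 per pair.\<close>
  define C where "C j = 24 * real (cl G N (comm_word G (\<lambda>_. 1) (ks j))) + 24 * real (length (ks j))" for j
  \<comment> \<open>Defect of the reduced quasimorphism: 12 from the dual one, the rest from the
    combination subtracted. It does not depend on the element tested.\<close>
  define D' where "D' = 12 + (\<Sum>j<n. C j * D)"
  have C0: "0 \<le> C j" for j by (simp add: C_def)
  have proper: "d_scl G N x y \<le> 48 * D' * B + (\<Sum>j<n. C j * (S + 1 + D)) + 3"
    if xy: "x \<in> A" "y \<in> A" "d1 n (\<beta> x) (\<beta> y) \<le> S" for x y S
  proof -
    define z where "z = inv x \<otimes> y"
    have xyN: "x \<in> comm_sub G N" "y \<in> comm_sub G N" using xy A by auto
    then have z: "z \<in> comm_sub G N" by (simp add: z_def)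
    have \<nu>z: "\<bar>\<nu> j z\<bar> \<le> S + 1 + D" if j: "j < n" for j
    proof -
      have "real_of_int \<bar>\<beta> x j - \<beta> y j\<bar> \<le> S" using d1_coord[OF j, of "\<beta> x" "\<beta> y"] xy by linarith
      then have "\<bar>\<nu> j x - \<nu> j y\<bar> \<le> S + 1" using j unfolding \<beta>_def by simp linarith
      then show ?thesis using N.qmorph_diff(1)[OF D[OF j] xyN] unfolding z_def by linarith
    qed
    obtain \<phi> where \<phi>: "qmorph G N 12 \<phi>" "scl G N z \<le> \<phi> z + 3" using N.scl_dual[OF z] .
    define c where "c j = pairing_sum G \<phi> (\<lambda>_. 1) (ks j)" for j
    have c: "\<bar>c j\<bar> \<le> C j" if j: "j < n" for j
    proof -
      have k: "pairs_over (ks j)" "comm_word G (\<lambda>_. 1) (ks j) \<in> comm_sub G N"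
        using dual_systemD(2)[OF ds j] by (auto simp: kernel_words_def)
      show ?thesis
        using comm_word_value[OF \<phi>(1) k(1), of "\<lambda>_. 1"] N.qmorph_comm_prods[OF \<phi>(1) N.cl_mem[OF k(2)]]
        unfolding C_def c_def by linarith
    qed
    define \<phi>' where "\<phi>' = (\<lambda>x. \<phi> x + (- 1) * (\<Sum>j<n. c j * \<nu> j x))"
    have "\<phi> \<in> inv_hqm G N" using \<phi>(1) by (simp add: qmorph_def)
    note \<phi>'0 = dual_system_reduce[OF ds this \<phi>'_def[unfolded c_def]]
    have "qmorph G N (12 + \<bar>- 1\<bar> * (\<Sum>j<n. \<bar>c j\<bar> * D)) \<phi>'"
      unfolding \<phi>'_def using D by (intro qmorph_add[OF \<phi>(1) qmorph_sum]) auto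
    moreover have "(\<Sum>j<n. \<bar>c j\<bar> * D) \<le> (\<Sum>j<n. C j * D)"
      using c N.qmorph_defect_nonneg[OF D] by (intro sum_mono mult_right_mono) auto
    ultimately have \<phi>': "qmorph G N D' \<phi>'" unfolding D'_def by (elim qmorph_mono) simp
    have "pairing_trivial \<phi>'"
      using dual_system_extend[OF ds \<phi>'0(1) \<phi>'0(2)] max by blast
    then have "\<bar>\<phi>' z\<bar> \<le> 48 * D' * scl G L z" using pairing_trivial_bound[OF \<phi>' _ z] by blast
    also have "\<dots> \<le> 48 * D' * B"
      using B[OF xy(1,2)] N.qmorph_defect_nonneg[OF \<phi>'] unfolding d_scl_def z_def
      by (intro mult_left_mono) auto
    finally have "\<bar>\<phi>' z\<bar> \<le> 48 * D' * B" .
    moreover have "(\<Sum>j<n. c j * \<nu> j z) \<le> (\<Sum>j<n. C j * (S + 1 + D))"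
    proof (rule sum_mono)
      fix j assume "j \<in> {..<n}"
      then have j: "j < n" by simp
      have "c j * \<nu> j z \<le> \<bar>c j\<bar> * \<bar>\<nu> j z\<bar>" by (simp add: abs_mult[symmetric])
      also have "\<dots> \<le> C j * (S + 1 + D)" using c[OF j] \<nu>z[OF j] C0 by (intro mult_mono) auto
      finally show "c j * \<nu> j z \<le> C j * (S + 1 + D)" .
    qed
    ultimately show ?thesis using \<phi>(2) unfolding d_scl_def z_def[symmetric] \<phi>'_def by linarith
  qed
  have "coarse_hom_to_Z G (comm_sub G N) (d_scl G N) A n \<beta>"
    unfolding coarse_hom_to_Z_def controlled_on_def coarsely_proper_on_def
  proof (intro conjI)
    show "\<forall>S. \<exists>T. \<forall>x\<in>A. \<forall>y\<in>A. d_scl G N x y > T \<longrightarrow> d1 n (\<beta> x) (\<beta> y) > S"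
    proof
      fix S
      show "\<exists>T. \<forall>x\<in>A. \<forall>y\<in>A. d_scl G N x y > T \<longrightarrow> d1 n (\<beta> x) (\<beta> y) > S"
        using proper[of _ _ S] by (intro exI[of _ "48 * D' * B + (\<Sum>j<n. C j * (S + 1 + D)) + 3"]) force
    qed
  qed (use range hom ctrl in blast)+
  then show ?thesis by blast
qed

text \<open>Dual systems embed Z^n for every finite n up to the dimension; the asymptotic dimension
  of the image is then at least n. In finite dimension a maximal system gives the maps to Z^n, which
  bound the asymptotic dimension from above.\<close>

theorem dimW_characterization:
  shows "dimW G L N = Sup {enat l | l. \<exists>\<alpha>.
            coarse_hom_from_Z G (comm_sub G N) (d_scl G N) (d_scl G L) l \<alpha>}
     \<and> dimW G L N = Inf {enat l | l. \<forall>A. A \<subseteq> comm_sub G N \<and> d_bounded (d_scl G L) A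
            \<longrightarrow> (\<exists>\<beta>. coarse_hom_to_Z G (comm_sub G N) (d_scl G N) A l \<beta>)}
     \<and> dimW G L N \<le> Sup {enat l | l. \<exists>\<alpha>.
            coarse_hom_from_Z G (comm_sub G N) (d_cl G N) (d_cl G L) l \<alpha>}
     \<and> dimW G L N = Sup {asdim A (d_scl G N) | A.
            A \<subseteq> comm_sub G N \<and> d_bounded (d_scl G L) A}
     \<and> dimW G L N \<le> Sup {asdim A (d_cl G N) | A.
            A \<subseteq> comm_sub G N \<and> d_bounded (d_cl G L) A}"
proof -
  let ?w = "dimW G L N" and ?T = "comm_sub G N"
  have lower: "\<exists>\<alpha>. coarse_hom_from_Z G ?T (d_scl G N) (d_scl G L) n \<alpha>
      \<and> coarse_hom_from_Z G ?T (d_cl G N) (d_cl G L) n \<alpha>" if "enat n \<le> ?w" for n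
    using dual_system_of_le_dimW[OF that] coarse_hom_from_Z_of_dual_system by blast
  have upper: "\<exists>\<beta>. coarse_hom_to_Z G ?T (d_scl G N) A n \<beta>"
    if n: "?w = enat n" and A: "A \<subseteq> ?T" "d_bounded (d_scl G L) A" for n A
  proof -
    obtain \<nu> ks where ds: "dual_system n \<nu> ks" using dual_system_of_le_dimW[of n] n by auto
    have "\<not> dual_system (Suc n) \<nu>' ks'" for \<nu>' ks'
      using le_dimW_of_dual_system[of "Suc n" \<nu>' ks'] n by auto
    from coarse_hom_to_Z_of_maximal[OF ds this A] show ?thesis .
  qed
  have asdim_lower: "enat n \<le> asdim (\<alpha> ` Zvec n) d"
    if "coarse_hom_from_Z G ?T d d' n \<alpha>" for \<alpha> d d' n
    using that asdim_ge_of_coarse_embedding[of \<alpha> n "\<alpha> ` Zvec n" d]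
    unfolding coarse_hom_from_Z_def by blast
  have asdim_upper': "asdim A (d_scl G N) \<le> enat n"
    if \<beta>: "coarse_hom_to_Z G ?T (d_scl G N) A n \<beta>" and A: "A \<subseteq> ?T" for A n \<beta>
  proof (rule asdim_upper[OF asdim_le_pullback[OF asdim_le_Zvec]])
    show "\<beta> ` A \<subseteq> Zvec n" using \<beta> A unfolding coarse_hom_to_Z_def by blast
  qed (use \<beta> in \<open>auto simp: coarse_hom_to_Z_def\<close>)
  have img: "\<alpha> ` Zvec n \<subseteq> ?T" "d_bounded d' (\<alpha> ` Zvec n)"
    if "coarse_hom_from_Z G ?T d d' n \<alpha>" for \<alpha> d d' n
    using that unfolding coarse_hom_from_Z_def by blast+
  have asdim_w: "asdim A (d_scl G N) \<le> ?w" if A: "A \<subseteq> ?T" "d_bounded (d_scl G L) A" for A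
  proof (cases ?w)
    case (enat n)
    then show ?thesis using upper[OF enat A] asdim_upper'[OF _ A(1)] by auto
  qed simp
  have w_le: "enat n \<le> ?w" if "coarse_hom_from_Z G ?T (d_scl G N) (d_scl G L) n \<alpha>" for n \<alpha>
    using asdim_lower[OF that] asdim_w[OF img[OF that]] by (rule order_trans)
  have "?w = Sup {enat l | l. \<exists>\<alpha>. coarse_hom_from_Z G ?T (d_scl G N) (d_scl G L) l \<alpha>}"
  proof (rule antisym)
    show "?w \<le> Sup {enat l | l. \<exists>\<alpha>. coarse_hom_from_Z G ?T (d_scl G N) (d_scl G L) l \<alpha>}"
      by (rule enat_leI_finite, rule Sup_upper) (use lower in blast)
  qed (use w_le in \<open>auto intro!: Sup_least\<close>)
  moreover have "?w = Inf {enat l | l. \<forall>A. A \<subseteq> ?T \<and> d_bounded (d_scl G L) A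
      \<longrightarrow> (\<exists>\<beta>. coarse_hom_to_Z G ?T (d_scl G N) A l \<beta>)}" (is "_ = Inf ?I")
  proof (rule antisym)
    show "?w \<le> Inf ?I"
    proof (rule Inf_greatest, rule enat_leI_finite)
      fix e n assume e: "e \<in> ?I" and n: "enat n \<le> ?w"
      \<comment> \<open>The image of Z^n is the test set: a coarsely proper map from it to Z^l
        forces n \<le> l by asymptotic dimension.\<close>
      obtain \<alpha> where \<alpha>: "coarse_hom_from_Z G ?T (d_scl G N) (d_scl G L) n \<alpha>" using lower[OF n] by blast
      obtain l \<beta> where "e = enat l" "coarse_hom_to_Z G ?T (d_scl G N) (\<alpha> ` Zvec n) l \<beta>"
        using e img[OF \<alpha>] by blast
      then have "asdim (\<alpha> ` Zvec n) (d_scl G N) \<le> e" using asdim_upper'[OF _ img(1)[OF \<alpha>]] by simp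
      with asdim_lower[OF \<alpha>] show "enat n \<le> e" by (rule order_trans)
    qed
    show "Inf ?I \<le> ?w"
    proof (cases ?w)
      case (enat n)
      then show ?thesis using upper[OF enat] by (auto intro!: Inf_lower)
    qed simp
  qed
  moreover have "?w \<le> Sup {enat l | l. \<exists>\<alpha>. coarse_hom_from_Z G ?T (d_cl G N) (d_cl G L) l \<alpha>}"
    by (rule enat_leI_finite, rule Sup_upper) (use lower in blast)
  moreover have "?w = Sup {asdim A (d_scl G N) | A. A \<subseteq> ?T \<and> d_bounded (d_scl G L) A}"
  proof (rule antisym)
    show "?w \<le> Sup {asdim A (d_scl G N) | A. A \<subseteq> ?T \<and> d_bounded (d_scl G L) A}"
    proof (rule enat_leI_finite)
      fix n assume "enat n \<le> ?w"
      then obtain \<alpha> where \<alpha>: "coarse_hom_from_Z G ?T (d_scl G N) (d_scl G L) n \<alpha>" using lower by blast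
      show "enat n \<le> Sup {asdim A (d_scl G N) | A. A \<subseteq> ?T \<and> d_bounded (d_scl G L) A}"
        using asdim_lower[OF \<alpha>] img[OF \<alpha>] by (intro Sup_upper2) auto
    qed
  qed (use asdim_w in \<open>auto intro!: Sup_least\<close>)
  moreover have "?w \<le> Sup {asdim A (d_cl G N) | A. A \<subseteq> ?T \<and> d_bounded (d_cl G L) A}"
  proof (rule enat_leI_finite)
    fix n assume "enat n \<le> ?w"
    then obtain \<alpha> where \<alpha>: "coarse_hom_from_Z G ?T (d_cl G N) (d_cl G L) n \<alpha>" using lower by blast
    show "enat n \<le> Sup {asdim A (d_cl G N) | A. A \<subseteq> ?T \<and> d_bounded (d_cl G L) A}"
      using asdim_lower[OF \<alpha>] img[OF \<alpha>] by (intro Sup_upper2) auto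
  qed
  ultimately show ?thesis by blast
qed

end

section \<open>Lower central series\<close>

lemma (in group) lcs_carrier: "lcs G k \<subseteq> carrier G"
proof (induction k)
  case (Suc k)
  show ?case
  proof (cases k)
    case (Suc k')
    then have "simple_comms G (lcs G k) \<subseteq> carrier G"
      using Suc.IH unfolding simple_comms_def by (auto simp: subset_iff)
    then show ?thesis using Suc generate_incl by (simp add: comm_sub_def)
  qed simp
qed simp

text \<open>For l = ax with \<open>a\<close> in the (q-1)-st term of the series and \<open>x\<close>
  in \<open>N\<close>, the identity [g,ax] = [g,a] a[g,x]a^-1 splits [g,l] into an element of the
  q-th term and one of [G,N].\<close>

lemma (in group) mixed_pair_of_lcs:
  assumes "N \<lhd> G" "L \<lhd> G" "N \<subseteq> L" "q \<ge> 2"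
    and "lcs G q \<subseteq> N" "L \<subseteq> lcs G (q - 1) <#> N"
  shows "mixed_pair G N L"
proof -
  interpret N: normal N G by fact
  obtain k where q: "q = Suc (Suc k)" using \<open>q \<ge> 2\<close> by (metis add_2_eq_Suc le_Suc_ex)
  have lcs_comm: "commutator G g l \<in> lcs G q" if "g \<in> carrier G" "l \<in> lcs G (q - 1)" for g l
    using that unfolding q by (auto simp: comm_sub_def simple_comms_def intro!: generate.incl)
  have "commutator G g l \<in> N" if g: "g \<in> carrier G" and l: "l \<in> L" for g l
  proof -
    obtain a x where ax: "a \<in> lcs G (q - 1)" "x \<in> N" "l = a \<otimes> x"
      using l assms(6) unfolding set_mult_def by blast
    have a: "a \<in> carrier G" using ax lcs_carrier by blast
    have "commutator G g l = commutator G g a \<otimes> (a \<otimes> commutator G g x \<otimes> inv a)"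
      using g a ax by (simp add: commutator_def m_assoc inv_mult_group)
    moreover have "commutator G g a \<in> N" using lcs_comm[OF g ax(1)] assms(5) by blast
    moreover have "a \<otimes> commutator G g x \<otimes> inv a \<in> N"
      using a N.commutator_mem[OF g ax(2)] by (rule N.conj_mem)
    ultimately show ?thesis by (simp add: N.m_closed)
  qed
  then show ?thesis
    using assms is_group by (intro mixed_pair.intro mixed_pair_axioms.intro) auto
qed

theorem theoremB:
  fixes G :: "('a, 'b) monoid_scheme" and L N :: "'a set"
    and F :: "('f, 'c) monoid_scheme" and R :: "'f set" and q :: nat
  assumes "group G" and "L \<lhd> G" and "N \<lhd> G" and "N \<subseteq> L"
    and "q \<ge> 2"
    and "(N = lcs G q \<and> L = lcs G (q - 1))
         \<or> (lcs G q \<subseteq> N \<and> L = lcs G (q - 1) <#>\<^bsub>G\<^esub> N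
            \<and> presentation F R G \<and> R \<subseteq> lcs F q)"
  shows "dimW G L N = Sup {enat l | l. \<exists>\<alpha>.
            coarse_hom_from_Z G (comm_sub G N) (d_scl G N) (d_scl G L) l \<alpha>}
     \<and> dimW G L N = Inf {enat l | l. \<forall>A. A \<subseteq> comm_sub G N \<and> d_bounded (d_scl G L) A
            \<longrightarrow> (\<exists>\<beta>. coarse_hom_to_Z G (comm_sub G N) (d_scl G N) A l \<beta>)}
     \<and> dimW G L N \<le> Sup {enat l | l. \<exists>\<alpha>.
            coarse_hom_from_Z G (comm_sub G N) (d_cl G N) (d_cl G L) l \<alpha>}
     \<and> dimW G L N = Sup {asdim A (d_scl G N) | A.
            A \<subseteq> comm_sub G N \<and> d_bounded (d_scl G L) A}
     \<and> dimW G L N \<le> Sup {asdim A (d_cl G N) | A.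
            A \<subseteq> comm_sub G N \<and> d_bounded (d_cl G L) A}"
proof -
  interpret group G by fact
  interpret N: normal N G by fact
  \<comment> \<open>In case (a) an element of \<open>L\<close> is written as itself times 1; in case
    (b) equality is assumed.\<close>
  have "L \<subseteq> lcs G (q - 1) <#>\<^bsub>G\<^esub> N"
    using assms(6)
  proof
    assume "N = lcs G q \<and> L = lcs G (q - 1)"
    then show ?thesis
      using lcs_carrier[of "q - 1"] N.one_closed by (force simp: set_mult_def)
  qed simp
  then interpret mixed_pair G N L
    using assms by (intro mixed_pair_of_lcs[of N L q]) auto
  show ?thesis by (rule dimW_characterization)
qed

end
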